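(* Let $G$ be a Lie group, $M$ a differentiable manifold endowed with a metric $d\in\mathcal L(M)$, $X\subset M$ a non-empty compact subset, and $\varphi:G\times M\to M$ a smooth left action of $G$ on $M$. Then every piecewise continuously differentiable path $\eta:[a,b]\to G/H_X$ is Lipschitz as a map into $(G/H_X,d_X)$; in particular, $\eta$ is rectifiable in $(G/H_X,d_X)$. The same holds with $(G/H_X,\hat d_X)$ in place of $(G/H_X,d_X)$.
   Context: All differentiable manifolds (including Lie groups) are Hausdorff with countable basis. A Finsler metric on a manifold $M$ is a continuous function $F:TM\to\mathbb R$ whose restriction to each tangent space is a norm; its distance function is $d_F(x,y)=\inf_\gamma\int F(\gamma'(t))\,dt$ over piecewise continuously differentiable paths connecting $x$ and $y$. $\mathcal L(M)$: the set of metrics $d$ on $M$ inducing the manifold topology and such that there is a Finsler metric $F$ on $M$ for which every $p\in M$ has a neighborhood $V_p$ on which $d$ and $d_F$ are Lipschitz equivalent ($c\,d\le d_F\le C\,d$ on $V_p\times V_p$ for some $c,C>0$). $H_X=\{g\in G:gX=X\}$ is a closed subgroup of $G$, and $G/H_X$ carries its unique differentiable structure for which the natural $G$-action is smooth. $d_X(g_1H_X,g_2H_X)=d_H(g_1X,g_2X)$, where $d_H(A,B)=\max\{\sup_{a\in A}d(a,B),\sup_{b\in B}d(b,A)\}$. The length of a path in a metric space $(N,\rho)$ is $\ell_\rho(\gamma)=\sup\sum_i\rho(\gamma(t_i),\gamma(t_{i-1}))$ over partitions; $\gamma$ is rectifiable if $\ell_\rho(\gamma)<\infty$. $\hat d_X(p,q)=\inf_\gamma\ell_{d_X}(\gamma)$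 over $d_X$-continuous paths from $p$ to $q$. *)

theory Defs
  imports
    "HOL-Analysis.Analysis"
    "HOL-Algebra.Group_Action"
    "HOL-Algebra.Left_Coset"
begin

section \<open>Smooth manifolds\<close>

text \<open>
  A manifold is modelled on a linear subspace of a Euclidean space type, so that every dimension,
  including \<open>0\<close> (which no type of class \<open>euclidean_space\<close> has), is available. A differentiable
  structure is given by any (not necessarily maximal) smooth atlas; a chart is a pair \<open>(U, \<phi>)\<close>, of
  which the values of \<open>\<phi>\<close> outside \<open>U\<close> are irrelevant.
\<close>

type_synonym ('a, 'e) chart = "'a set \<times> ('a \<Rightarrow> 'e)"

record ('a, 'e) manifold =
  mtop :: "'a topology"
  model :: "'e set"
  atlas :: "('a, 'e) chart set"

text \<open>
  Used for \<open>S\<close> relatively open in the subspace \<open>E\<close>. Then \<open>f' x v\<close> is uniquely determined for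
  \<open>x \<in> S\<close> and \<open>v \<in> E\<close>, although \<open>f' x\<close> is not determined off \<open>E\<close>.
\<close>

primrec Ck_on :: "nat \<Rightarrow> 'e::euclidean_space set \<Rightarrow> 'e set \<Rightarrow> ('e \<Rightarrow> 'f::euclidean_space) \<Rightarrow> bool"
where
  "Ck_on 0 E S f \<longleftrightarrow> continuous_on S f"
| "Ck_on (Suc k) E S f \<longleftrightarrow>
     (\<exists>f'. (\<forall>x\<in>S. (f has_derivative f' x) (at x within S)) \<and>
           (\<forall>v\<in>E. Ck_on k E S (\<lambda>x. f' x v)))"

definition smooth_on ::
  "'e::euclidean_space set \<Rightarrow> 'e set \<Rightarrow> ('e \<Rightarrow> 'f::euclidean_space) \<Rightarrow> bool" where
  "smooth_on E S f \<longleftrightarrow> (\<forall>k. Ck_on k E S f)"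

definition smooth_manifold :: "('a, 'e::euclidean_space) manifold \<Rightarrow> bool" where
  "smooth_manifold M \<longleftrightarrow>
     Hausdorff_space (mtop M) \<and> second_countable (mtop M) \<and> subspace (model M) \<and>
     (\<Union>(U, \<phi>)\<in>atlas M. U) = topspace (mtop M) \<and>
     (\<forall>(U, \<phi>)\<in>atlas M.
        openin (mtop M) U \<and> openin (top_of_set (model M)) (\<phi> ` U) \<and>
        homeomorphic_map (subtopology (mtop M) U) (top_of_set (\<phi> ` U)) \<phi>) \<and>
     (\<forall>(U, \<phi>)\<in>atlas M. \<forall>(V, \<psi>)\<in>atlas M.
        smooth_on (model M) (\<phi> ` (U \<inter> V)) (\<psi> \<circ> inv_into U \<phi>))"

definition smooth_map ::
  "('a, 'e::euclidean_space) manifold \<Rightarrow> ('b, 'f::euclidean_space) manifold \<Rightarrow> ('a \<Rightarrow> 'b) \<Rightarrow> bool"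
where
  "smooth_map M N f \<longleftrightarrow>
     continuous_map (mtop M) (mtop N) f \<and>
     (\<forall>(U, \<phi>)\<in>atlas M. \<forall>(V, \<psi>)\<in>atlas N.
        smooth_on (model M) (\<phi> ` {x \<in> U. f x \<in> V}) (\<psi> \<circ> f \<circ> inv_into U \<phi>))"

definition prod_manifold ::
  "('a, 'e) manifold \<Rightarrow> ('b, 'f) manifold \<Rightarrow> ('a \<times> 'b, 'e \<times> 'f) manifold" where
  "prod_manifold M N =
     \<lparr>mtop = prod_topology (mtop M) (mtop N),
      model = model M \<times> model N,
      atlas = {(U \<times> V, map_prod \<phi> \<psi>) | U \<phi> V \<psi>. (U, \<phi>) \<in> atlas M \<and> (V, \<psi>) \<in> atlas N}\<rparr>"


section \<open>Tangent bundle and piecewise continuously differentiable paths\<close>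

text \<open>
  A tangent vector at \<open>p\<close> is the family of its coordinate representations in all charts at \<open>p\<close>,
  related by the derivatives of the coordinate changes; the entries at all other charts are set
  to \<open>0\<close>. Vector space operations are entrywise.
\<close>

type_synonym ('a, 'e) tvec = "('a, 'e) chart \<Rightarrow> 'e"

definition tangent_space ::
  "('a, 'e::euclidean_space) manifold \<Rightarrow> 'a \<Rightarrow> ('a, 'e) tvec set" where
  "tangent_space M p =
     {v. (\<forall>c. if c \<in> atlas M \<and> p \<in> fst c then v c \<in> model M else v c = 0) \<and>
         (\<forall>(U, \<phi>)\<in>atlas M. \<forall>(V, \<psi>)\<in>atlas M. p \<in> U \<inter> V \<longrightarrow>
            v (V, \<psi>) =
              frechet_derivative (\<psi> \<circ> inv_into U \<phi>) (at (\<phi> p) within \<phi> ` (U \<inter> V)) (v (U, \<phi>)))}"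

definition tangent_bundle ::
  "('a, 'e::euclidean_space) manifold \<Rightarrow> ('a \<times> ('a, 'e) tvec) set" where
  "tangent_bundle M = (SIGMA p : topspace (mtop M). tangent_space M p)"

definition tangent_topology ::
  "('a, 'e::euclidean_space) manifold \<Rightarrow> ('a \<times> ('a, 'e) tvec) topology" where
  "tangent_topology M = topology_generated_by
     {{(p, v) \<in> tangent_bundle M. p \<in> U \<and> (\<phi> p, v (U, \<phi>)) \<in> W} | U \<phi> W.
        (U, \<phi>) \<in> atlas M \<and> open W}"

definition interval_partition :: "real \<Rightarrow> real \<Rightarrow> nat \<Rightarrow> (nat \<Rightarrow> real) \<Rightarrow> bool" where
  "interval_partition a b n t \<longleftrightarrow> t 0 = a \<and> t n = b \<and> (\<forall>i<n. t i < t (Suc i))"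

text \<open>Continuously differentiable on the closed interval, with one-sided derivatives at its ends.\<close>

definition C1_path_on ::
  "('a, 'e::euclidean_space) manifold \<Rightarrow> real \<Rightarrow> real \<Rightarrow> (real \<Rightarrow> 'a) \<Rightarrow> bool" where
  "C1_path_on M a b \<gamma> \<longleftrightarrow>
     continuous_map (top_of_set {a..b}) (mtop M) \<gamma> \<and>
     (\<forall>(U, \<phi>)\<in>atlas M. \<exists>\<gamma>'. continuous_on {t \<in> {a..b}. \<gamma> t \<in> U} \<gamma>' \<and>
        (\<forall>t\<in>{a..b}. \<gamma> t \<in> U \<longrightarrow>
           (\<phi> \<circ> \<gamma> has_vector_derivative \<gamma>' t) (at t within {a..b})))"

text \<open>
  Unlike for \<open>piecewise_C1_differentiable_on\<close>, the derivative has one-sided limits at the finitely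
  many exceptional points. The definition implies \<open>a \<le> b\<close>.
\<close>

definition piecewise_C1_path ::
  "('a, 'e::euclidean_space) manifold \<Rightarrow> real \<Rightarrow> real \<Rightarrow> (real \<Rightarrow> 'a) \<Rightarrow> bool" where
  "piecewise_C1_path M a b \<gamma> \<longleftrightarrow>
     continuous_map (top_of_set {a..b}) (mtop M) \<gamma> \<and>
     (\<exists>n t. interval_partition a b n t \<and> (\<forall>i<n. C1_path_on M (t i) (t (Suc i)) \<gamma>))"

text \<open>At the finitely many points where \<open>\<gamma>\<close> is not differentiable the value is immaterial.\<close>

definition velocity ::
  "('a, 'e::euclidean_space) manifold \<Rightarrow> (real \<Rightarrow> 'a) \<Rightarrow> real \<Rightarrow> 'a \<times> ('a, 'e) tvec" where
  "velocity M \<gamma> t =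
     (\<gamma> t, \<lambda>c. if c \<in> atlas M \<and> \<gamma> t \<in> fst c then vector_derivative (snd c \<circ> \<gamma>) (at t) else 0)"


section \<open>Finsler metrics\<close>

definition finsler_metric ::
  "('a, 'e::euclidean_space) manifold \<Rightarrow> ('a \<times> ('a, 'e) tvec \<Rightarrow> real) \<Rightarrow> bool" where
  "finsler_metric M F \<longleftrightarrow>
     continuous_map (tangent_topology M) euclideanreal F \<and>
     (\<forall>p\<in>topspace (mtop M).
        (\<forall>v\<in>tangent_space M p. F (p, v) \<ge> 0 \<and> (F (p, v) = 0 \<longleftrightarrow> v = (\<lambda>c. 0))) \<and>
        (\<forall>v\<in>tangent_space M p. \<forall>r. F (p, \<lambda>c. r *\<^sub>R v c) = \<bar>r\<bar> * F (p, v)) \<and>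
        (\<forall>v\<in>tangent_space M p. \<forall>w\<in>tangent_space M p.
           F (p, \<lambda>c. v c + w c) \<le> F (p, v) + F (p, w)))"

text \<open>Infinite for points that no path connects.\<close>

definition finsler_dist ::
  "('a, 'e::euclidean_space) manifold \<Rightarrow> ('a \<times> ('a, 'e) tvec \<Rightarrow> real) \<Rightarrow> 'a \<Rightarrow> 'a \<Rightarrow> ereal" where
  "finsler_dist M F x y =
     Inf {ereal (integral {a..b} (\<lambda>t. F (velocity M \<gamma> t))) | a b \<gamma>.
            piecewise_C1_path M a b \<gamma> \<and> \<gamma> a = x \<and> \<gamma> b = y}"

definition locally_finsler_metrics ::
  "('a, 'e::euclidean_space) manifold \<Rightarrow> ('a \<Rightarrow> 'a \<Rightarrow> real) set" where
  "locally_finsler_metrics M =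
     {d. Metric_space (topspace (mtop M)) d \<and>
         Metric_space.mtopology (topspace (mtop M)) d = mtop M \<and>
         (\<exists>F. finsler_metric M F \<and>
            (\<forall>p\<in>topspace (mtop M). \<exists>V. openin (mtop M) V \<and> p \<in> V \<and>
               (\<exists>c>0. \<exists>C>0. \<forall>x\<in>V. \<forall>y\<in>V.
                  ereal (c * d x y) \<le> finsler_dist M F x y \<and>
                  finsler_dist M F x y \<le> ereal (C * d x y))))}"


section \<open>Lie groups, actions and homogeneous spaces\<close>

definition lie_group :: "('g, 'x) monoid_scheme \<Rightarrow> ('g, 'e::euclidean_space) manifold \<Rightarrow> bool" where
  "lie_group G N \<longleftrightarrow>
     group G \<and> smooth_manifold N \<and> topspace (mtop N) = carrier G \<and>
     smooth_map (prod_manifold N N) N (\<lambda>(g, h). g \<otimes>\<^bsub>G\<^esub> h) \<and>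
     smooth_map N N (\<lambda>g. inv\<^bsub>G\<^esub> g)"

definition smooth_action ::
  "('g, 'x) monoid_scheme \<Rightarrow> ('g, 'e::euclidean_space) manifold \<Rightarrow>
   ('m, 'f::euclidean_space) manifold \<Rightarrow> ('g \<Rightarrow> 'm \<Rightarrow> 'm) \<Rightarrow> bool" where
  "smooth_action G N M \<phi> \<longleftrightarrow>
     group_action G (topspace (mtop M)) \<phi> \<and>
     smooth_map (prod_manifold N M) M (\<lambda>(g, x). \<phi> g x)"

definition set_stabilizer ::
  "('g, 'x) monoid_scheme \<Rightarrow> ('g \<Rightarrow> 'm \<Rightarrow> 'm) \<Rightarrow> 'm set \<Rightarrow> 'g set" where
  "set_stabilizer G \<phi> X = {g \<in> carrier G. \<phi> g ` X = X}"

text \<open>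
  \<open>Q\<close> is a differentiable structure on the space of left cosets of \<open>H\<close> with the quotient topology
  for which the natural action of the Lie group \<open>G\<close> is smooth. For closed \<open>H\<close> there is exactly one,
  up to equivalence of atlases.
\<close>

definition homogeneous_manifold ::
  "('g, 'x) monoid_scheme \<Rightarrow> ('g, 'e::euclidean_space) manifold \<Rightarrow> 'g set \<Rightarrow>
   ('g set, 'f::euclidean_space) manifold \<Rightarrow> bool" where
  "homogeneous_manifold G N H Q \<longleftrightarrow>
     smooth_manifold Q \<and>
     topspace (mtop Q) = lcosets\<^bsub>G\<^esub> H \<and>
     quotient_map (mtop N) (mtop Q) (\<lambda>g. g <#\<^bsub>G\<^esub> H) \<and>
     smooth_map (prod_manifold N Q) Q (\<lambda>(g, A). g <#\<^bsub>G\<^esub> A)"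


section \<open>The metrics on the coset space\<close>

definition hausdorff_dist :: "('m \<Rightarrow> 'm \<Rightarrow> real) \<Rightarrow> 'm set \<Rightarrow> 'm set \<Rightarrow> real" where
  "hausdorff_dist d A B = max (SUP a\<in>A. INF b\<in>B. d a b) (SUP b\<in>B. INF a\<in>A. d b a)"

text \<open>
  The choice of representatives is immaterial, see \<open>coset_dist_eq\<close> below. The value \<open>0\<close> outside
  the coset space makes the function symmetric and nonnegative everywhere, as \<open>Metric_space\<close> wants.
\<close>

definition coset_dist ::
  "('g, 'x) monoid_scheme \<Rightarrow> ('g \<Rightarrow> 'm \<Rightarrow> 'm) \<Rightarrow> ('m \<Rightarrow> 'm \<Rightarrow> real) \<Rightarrow> 'm set \<Rightarrow>
   'g set \<Rightarrow> 'g set \<Rightarrow> real" where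
  "coset_dist G \<phi> d X A B =
     (if A \<in> lcosets\<^bsub>G\<^esub> (set_stabilizer G \<phi> X) \<and> B \<in> lcosets\<^bsub>G\<^esub> (set_stabilizer G \<phi> X)
      then hausdorff_dist d (\<phi> (SOME g. g \<in> A) ` X) (\<phi> (SOME g. g \<in> B) ` X)
      else 0)"

lemma image_some_coset:
  assumes act: "group_action G S \<phi>" and X: "X \<subseteq> S" and g: "g \<in> carrier G"
  shows "\<phi> (SOME h. h \<in> g <#\<^bsub>G\<^esub> set_stabilizer G \<phi> X) ` X = \<phi> g ` X"
proof -
  interpret group_action G S \<phi> by (rule act)
  interpret group G using group_hom unfolding group_hom_def by blast
  have "\<phi> \<one>\<^bsub>G\<^esub> ` X = X"
  proof -
    have "\<phi> \<one>\<^bsub>G\<^esub> x = x" if "x \<in> X" for x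
      using X that id_eq_one by (metis restrict_apply' subsetD)
    then show ?thesis by simp
  qed
  then have "\<one>\<^bsub>G\<^esub> \<in> set_stabilizer G \<phi> X"
    by (simp add: set_stabilizer_def)
  then have "g <#\<^bsub>G\<^esub> set_stabilizer G \<phi> X \<noteq> {}"
    by (auto simp: l_coset_def)
  then have "(SOME h. h \<in> g <#\<^bsub>G\<^esub> set_stabilizer G \<phi> X) \<in> g <#\<^bsub>G\<^esub> set_stabilizer G \<phi> X"
    by (simp add: some_in_eq)
  then obtain h where h: "h \<in> carrier G" "\<phi> h ` X = X"
    and eq: "(SOME h. h \<in> g <#\<^bsub>G\<^esub> set_stabilizer G \<phi> X) = g \<otimes>\<^bsub>G\<^esub> h"
    by (auto simp: l_coset_def set_stabilizer_def)
  have "\<phi> (g \<otimes>\<^bsub>G\<^esub> h) ` X = \<phi> g ` (\<phi> h ` X)"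
    unfolding image_image using composition_rule X g h(1) by (intro image_cong) auto
  then show ?thesis by (simp add: eq h(2))
qed

lemma coset_dist_eq:
  assumes "group_action G S \<phi>" "X \<subseteq> S" "g \<in> carrier G" "h \<in> carrier G"
  shows "coset_dist G \<phi> d X (g <#\<^bsub>G\<^esub> set_stabilizer G \<phi> X) (h <#\<^bsub>G\<^esub> set_stabilizer G \<phi> X) =
         hausdorff_dist d (\<phi> g ` X) (\<phi> h ` X)"
  using assms by (auto simp: coset_dist_def image_some_coset LCOSETS_def)

definition path_length :: "('a \<Rightarrow> 'a \<Rightarrow> ereal) \<Rightarrow> real \<Rightarrow> real \<Rightarrow> (real \<Rightarrow> 'a) \<Rightarrow> ereal" where
  "path_length \<rho> a b \<gamma> =
     Sup {\<Sum>i<n. \<rho> (\<gamma> (t (Suc i))) (\<gamma> (t i)) | n t. interval_partition a b n t}"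

definition rectifiable_path :: "('a \<Rightarrow> 'a \<Rightarrow> ereal) \<Rightarrow> real \<Rightarrow> real \<Rightarrow> (real \<Rightarrow> 'a) \<Rightarrow> bool" where
  "rectifiable_path \<rho> a b \<gamma> \<longleftrightarrow> path_length \<rho> a b \<gamma> < \<infinity>"

definition lipschitz_path :: "('a \<Rightarrow> 'a \<Rightarrow> ereal) \<Rightarrow> real \<Rightarrow> real \<Rightarrow> (real \<Rightarrow> 'a) \<Rightarrow> bool" where
  "lipschitz_path \<rho> a b \<gamma> \<longleftrightarrow>
     (\<exists>L\<ge>0. \<forall>s\<in>{a..b}. \<forall>t\<in>{a..b}. \<rho> (\<gamma> s) (\<gamma> t) \<le> ereal (L * \<bar>s - t\<bar>))"

text \<open>Infinite for points that no rectifiable path connects.\<close>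

definition induced_dist :: "'a set \<Rightarrow> ('a \<Rightarrow> 'a \<Rightarrow> real) \<Rightarrow> 'a \<Rightarrow> 'a \<Rightarrow> ereal" where
  "induced_dist S \<rho> p q =
     Inf {path_length (\<lambda>x y. ereal (\<rho> x y)) a b \<gamma> | a b \<gamma>.
            a \<le> b \<and> continuous_map (top_of_set {a..b}) (Metric_space.mtopology S \<rho>) \<gamma> \<and>
            \<gamma> a = p \<and> \<gamma> b = q}"

definition coset_dist_hat ::
  "('g, 'x) monoid_scheme \<Rightarrow> ('g \<Rightarrow> 'm \<Rightarrow> 'm) \<Rightarrow> ('m \<Rightarrow> 'm \<Rightarrow> real) \<Rightarrow> 'm set \<Rightarrow>
   'g set \<Rightarrow> 'g set \<Rightarrow> ereal" where
  "coset_dist_hat G \<phi> d X =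
     induced_dist (lcosets\<^bsub>G\<^esub> (set_stabilizer G \<phi> X)) (coset_dist G \<phi> d X)"

end

theory Submission
  imports Defs
begin

text \<open>
  The orbit map \<open>g \<mapsto> gH\<close> from \<open>G\<close> to \<open>G/H\<close> is a continuously differentiable open map in charts. At a
  point where the rank of its derivative is maximal, its image is locally the image of a slice of
  that dimension; were the rank smaller than the dimension of \<open>G/H\<close>, the image of an open set would
  be negligible, so the orbit map is a submersion somewhere and has a Lipschitz local section there.
  Translating this section by \<open>G\<close> lifts \<open>\<eta>\<close> near every parameter to a Lipschitz path \<open>g(t)\<close> in \<open>G\<close>, and
  \<open>d\<^sub>X(\<eta>(s), \<eta>(t)) \<le> sup {d(g(s)x, g(t)x) | x \<in> X}\<close>. Since \<open>X\<close> is compact, the action is smooth, and \<open>d\<close>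
  is locally bounded by a multiple of the Euclidean distance in charts, the right hand side is at most
  a constant times \<open>|s - t|\<close>.
\<close>

section \<open>Local sections of open maps of class C1\<close>

text \<open>\<open>homogeneous_manifold\<close> only provides the quotient topology and a smooth
  action, so that the orbit map is a submersion has to be derived. Openness of this map comes from
  the group structure, and openness is what a deficient rank contradicts. A point of maximal rank
  serves better than an arbitrary one: the rank is constant around it, the map factors through a
  slice, and negligibility of C1 images of negligible sets suffices in place of Sard's theorem. The
  price is that the section sits over an unspecified coset \<open>g0 <# H\<close>, whence the
  translations. It is recorded as Lipschitz in coordinates, which also supplies its continuity. Two
  further points shape the proof. Local estimates become global through the triangle inequality, so
  the Hausdorff distance must first be shown to be a metric on the cosets. For the induced metric,
  the pieces of \<open>\<eta>\<close> themselves compete in the infimum over paths. The comparison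
  of \<open>d\<close> with coordinates rests on the same principle: straight segments in a chart
  compete in the infimum that defines the Finsler distance.\<close>

lemma linear_projection_exists:
  fixes E :: "'e::euclidean_space set"
  assumes "subspace E"
  obtains P where "linear P" "\<And>v. P v \<in> E" "\<And>v. v \<in> E \<Longrightarrow> P v = v"
proof -
  have "\<exists>g. g ` UNIV \<subseteq> E \<and> linear g \<and> (\<forall>v\<in>E. g (id v) = v)"
    by (rule linear_exists_left_inverse_on[OF linear_id assms]) simp
  then show thesis using that by auto
qed

text \<open>Models may be proper subspaces, where neither the inverse function theorem nor
  uniqueness of derivatives applies directly. Composition with a projection onto \<open>E\<close>
  turns a derivative within a relatively open set into one at an interior point of the whole
  space.\<close>

lemma has_derivative_compose_projection:
  fixes f :: "'e::euclidean_space \<Rightarrow> 'k::euclidean_space" and P :: "'e \<Rightarrow> 'e"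
  assumes f': "(f has_derivative f') (at (P x) within S)" and S: "openin (top_of_set E) S" "P x \<in> S"
    and P: "linear P" "\<And>v. P v \<in> E"
  shows "((\<lambda>x. f (P x)) has_derivative (\<lambda>v. f' (P v))) (at x)"
proof -
  obtain O' where O': "open O'" "S = E \<inter> O'"
    using S by (auto simp: openin_open)
  have "P -` S = P -` O'" using O' P(2) by auto
  moreover have "continuous_on UNIV P"
    using P(1) by (intro linear_continuous_on) (simp add: linear_conv_bounded_linear)
  ultimately have op: "open (P -` S)" using O'(1) by (simp add: open_vimage)
  have 1: "(P has_derivative P) (at x within P -` S)"
    by (rule bounded_linear_imp_has_derivative) (use P(1) in \<open>simp add: linear_linear\<close>)
  have 2: "(f has_derivative f') (at (P x) within P ` (P -` S))"
    by (rule has_derivative_subset[OF f']) auto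
  show ?thesis
    using diff_chain_within[OF 1 2] at_within_open[OF _ op, of x] S(2) by (simp add: o_def)
qed

text \<open>\<open>Ck_on\<close> gives continuity of \<open>f' x v\<close> for each fixed
  \<open>v \<in> E\<close> only. In finite dimension this already is continuity in the operator
  norm, tested on the vectors \<open>P i\<close> for basis vectors \<open>i\<close>.\<close>

lemma C1_extend:
  fixes f :: "'e::euclidean_space \<Rightarrow> 'k::euclidean_space"
  assumes C1: "Ck_on (Suc 0) E S f" and S: "openin (top_of_set E) S"
    and P: "linear P" "\<And>v. P v \<in> E" "\<And>v. v \<in> E \<Longrightarrow> P v = v"
  obtains D :: "'e \<Rightarrow> 'e \<Rightarrow>\<^sub>L 'k" where "open (P -` S)"
    "\<And>x. P x \<in> S \<Longrightarrow> ((\<lambda>x. f (P x)) has_derivative blinfun_apply (D x)) (at x)"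
    "continuous_on (P -` S) D"
proof -
  obtain f' where f': "\<And>x. x \<in> S \<Longrightarrow> (f has_derivative f' x) (at x within S)"
    and cont: "\<And>v. v \<in> E \<Longrightarrow> continuous_on S (\<lambda>x. f' x v)"
    using C1 by auto
  have contP: "continuous_on A P" for A
    using P(1) by (simp add: linear_continuous_on linear_linear)
  obtain O' where O': "open O'" "S = E \<inter> O'"
    using S by (auto simp: openin_open)
  have vim: "P -` S = P -` O'" using O' P(2) by auto
  have op: "open (P -` S)"
    unfolding vim using contP[of UNIV] O'(1) by (simp add: continuous_on_open_vimage)
  \<comment> \<open>The inner \<open>P v\<close> matters: \<open>f' (P x)\<close> is not determined
    off \<open>E\<close>.\<close>
  define D where "D x = Blinfun (\<lambda>v. f' (P x) (P v))" for x
  have D: "((\<lambda>x. f (P x)) has_derivative blinfun_apply (D x)) (at x)"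
          "blinfun_apply (D x) = (\<lambda>v. f' (P x) (P v))" if "P x \<in> S" for x
  proof -
    have 3: "((\<lambda>x. f (P x)) has_derivative (\<lambda>v. f' (P x) (P v))) (at x)"
      by (rule has_derivative_compose_projection[OF f'[OF that] S that P(1,2)])
    show "blinfun_apply (D x) = (\<lambda>v. f' (P x) (P v))"
      unfolding D_def using has_derivative_bounded_linear[OF 3]
      by (simp add: bounded_linear_Blinfun_apply)
    with 3 show "((\<lambda>x. f (P x)) has_derivative blinfun_apply (D x)) (at x)" by simp
  qed
  have "continuous_on (P -` S) D"
  proof (rule continuous_on_blinfun_componentwise)
    fix i :: 'e
    have "continuous_on (P -` S) (\<lambda>x. f' (P x) (P i))"
      by (rule continuous_on_compose2[OF cont[OF P(2)] contP]) auto
    then show "continuous_on (P -` S) (\<lambda>x. blinfun_apply (D x) i)"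
      by (rule continuous_on_eq) (simp add: D)
  qed
  with op D show thesis using that by blast
qed

lemma C1_derivative_within:
  fixes f :: "'e::euclidean_space \<Rightarrow> 'k::euclidean_space"
  assumes C1: "Ck_on (Suc 0) E S f" and S: "openin (top_of_set E) S" and E: "subspace E"
  obtains D :: "'e \<Rightarrow> 'e \<Rightarrow>\<^sub>L 'k" where "continuous_on S D"
    "\<And>x. x \<in> S \<Longrightarrow> (f has_derivative blinfun_apply (D x)) (at x within S)"
proof -
  obtain P :: "'e \<Rightarrow> 'e" where P: "linear P" "\<And>v. P v \<in> E" "\<And>v. v \<in> E \<Longrightarrow> P v = v"
    by (rule linear_projection_exists[OF E]) blast
  obtain D :: "'e \<Rightarrow> 'e \<Rightarrow>\<^sub>L 'k" where D: "open (P -` S)"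
    "\<And>x. P x \<in> S \<Longrightarrow> ((\<lambda>x. f (P x)) has_derivative blinfun_apply (D x)) (at x)"
    "continuous_on (P -` S) D"
    using C1_extend[OF C1 S P] by blast
  have PS: "P x = x" if "x \<in> S" for x using S openin_imp_subset that P(3) by blast
  show thesis
  proof (rule that[of D])
    show "continuous_on S D" using PS by (intro continuous_on_subset[OF D(3)]) auto
    show "(f has_derivative blinfun_apply (D x)) (at x within S)" if "x \<in> S" for x
      by (rule has_derivative_transform[OF that _ has_derivative_at_withinI[OF D(2)]]) (simp_all add: PS that)
  qed
qed

text \<open>Only directions in \<open>E\<close> are compared. After composition with a projection
  onto \<open>E\<close> both are derivatives at an interior point, where uniqueness holds.\<close>

lemma has_derivative_within_subspace_unique:
  fixes f :: "'e::euclidean_space \<Rightarrow> 'k::euclidean_space"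
  assumes "(f has_derivative f') (at x within S)" "(f has_derivative f'') (at x within S)"
    and S: "openin (top_of_set E) S" "x \<in> S" and E: "subspace E" and w: "w \<in> E"
  shows "f' w = f'' w"
proof -
  obtain P :: "'e \<Rightarrow> 'e" where P: "linear P" "\<And>v. P v \<in> E" "\<And>v. v \<in> E \<Longrightarrow> P v = v"
    by (rule linear_projection_exists[OF E]) blast
  have "P x = x" using S openin_imp_subset P(3) by blast
  then have "(\<lambda>v. f' (P v)) = (\<lambda>v. f'' (P v))"
    using has_derivative_compose_projection[of f _ P x, OF _ S(1) _ P(1,2)] assms
    by (intro has_derivative_unique[of "\<lambda>x. f (P x)" _ x]) auto
  from fun_cong[OF this, of w] show ?thesis using P(3)[OF w] by simp
qed

text \<open>The mean value inequality for \<open>f - D x0\<close>, whose derivative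
  \<open>D x - D x0\<close> has norm at most \<open>e\<close> near \<open>x0\<close> by
  continuity.\<close>

lemma C1_approx_linear:
  fixes f :: "'e::euclidean_space \<Rightarrow> 'k::euclidean_space" and D :: "'e \<Rightarrow> 'e \<Rightarrow>\<^sub>L 'k"
  assumes T: "open T" "x0 \<in> T" "e > 0"
    and der: "\<And>x. x \<in> T \<Longrightarrow> (f has_derivative blinfun_apply (D x)) (at x)"
    and cont: "continuous_on T D"
  obtains \<epsilon> where "\<epsilon> > 0" "ball x0 \<epsilon> \<subseteq> T"
    "\<And>x y. x \<in> ball x0 \<epsilon> \<Longrightarrow> y \<in> ball x0 \<epsilon> \<Longrightarrow> norm (f x - f y - D x0 (x - y)) \<le> e * norm (x - y)"
proof -
  obtain d1 where d1: "d1 > 0" "ball x0 d1 \<subseteq> T"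
    using T open_contains_ball by blast
  obtain d2 where d2: "d2 > 0" "\<And>x. x \<in> T \<Longrightarrow> dist x x0 \<le> d2 \<Longrightarrow> dist (D x) (D x0) < e"
    using continuous_onE[OF cont T(2,3)] by metis
  define \<epsilon> where "\<epsilon> = min d1 d2"
  have sub: "ball x0 \<epsilon> \<subseteq> T" using d1 by (auto simp: \<epsilon>_def)
  have "norm ((f x - D x0 x) - (f y - D x0 y)) \<le> e * norm (x - y)"
    if "x \<in> ball x0 \<epsilon>" "y \<in> ball x0 \<epsilon>" for x y
  proof (rule differentiable_bound[where S = "ball x0 \<epsilon>" and f' = "\<lambda>x. blinfun_apply (D x - D x0)"])
    fix z assume z: "z \<in> ball x0 \<epsilon>"
    then have "z \<in> T" using sub by auto
    show "((\<lambda>x. f x - D x0 x) has_derivative (D z - D x0)) (at z within ball x0 \<epsilon>)"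
      unfolding blinfun.diff_left
      by (intro has_derivative_diff has_derivative_at_withinI[OF der[OF \<open>z \<in> T\<close>]]
          bounded_linear_imp_has_derivative blinfun.bounded_linear_right)
    have "dist (D z) (D x0) < e" using d2(2)[OF \<open>z \<in> T\<close>] z by (auto simp: \<epsilon>_def dist_commute)
    then show "onorm (blinfun_apply (D z - D x0)) \<le> e"
      by (simp add: dist_norm norm_blinfun.rep_eq)
  qed (use that in auto)
  moreover have "f x - D x0 x - (f y - D x0 y) = f x - f y - D x0 (x - y)" for x y
    by (simp add: blinfun.diff_right)
  moreover have "\<epsilon> > 0" using d1 d2 by (simp add: \<epsilon>_def)
  ultimately show thesis
    using that[of \<epsilon>] sub by simp
qed

lemma C1_locally_lipschitz:
  fixes f :: "'e::euclidean_space \<Rightarrow> 'k::euclidean_space"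
  assumes C1: "Ck_on (Suc 0) E S f" and S: "openin (top_of_set E) S" and E: "subspace E"
    and x0: "x0 \<in> S"
  obtains \<epsilon> L where "\<epsilon> > 0" "L > 0"
    "\<And>x y. x \<in> S \<inter> ball x0 \<epsilon> \<Longrightarrow> y \<in> S \<inter> ball x0 \<epsilon> \<Longrightarrow> norm (f x - f y) \<le> L * norm (x - y)"
proof -
  obtain P :: "'e \<Rightarrow> 'e" where P: "linear P" "\<And>v. P v \<in> E" "\<And>v. v \<in> E \<Longrightarrow> P v = v"
    by (rule linear_projection_exists[OF E]) blast
  obtain D :: "'e \<Rightarrow> 'e \<Rightarrow>\<^sub>L 'k" where D: "open (P -` S)"
    "\<And>x. P x \<in> S \<Longrightarrow> ((\<lambda>x. f (P x)) has_derivative blinfun_apply (D x)) (at x)"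
    "continuous_on (P -` S) D"
    using C1_extend[OF C1 S P] by blast
  have SE: "S \<subseteq> E" using S openin_imp_subset by blast
  then have "x0 \<in> P -` S" using x0 P(3) by auto
  then obtain \<epsilon> where e: "\<epsilon> > 0"
    "\<And>x y. x \<in> ball x0 \<epsilon> \<Longrightarrow> y \<in> ball x0 \<epsilon> \<Longrightarrow> norm (f (P x) - f (P y) - D x0 (x - y)) \<le> 1 * norm (x - y)"
    by (rule C1_approx_linear[OF D(1) _ zero_less_one _ D(3), where f = "\<lambda>x. f (P x)"]) (use D(2) \<open>x0 \<in> P -` S\<close> in blast)+
  \<comment> \<open>The derivative at \<open>x0\<close> contributes its norm to the constant, the
    deviation from it the summand 1.\<close>
  have pos: "norm (D x0) + 1 > 0" by (simp add: add_nonneg_pos)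
  show thesis
  proof (rule that[OF e(1) pos])
    fix x y assume xy: "x \<in> S \<inter> ball x0 \<epsilon>" "y \<in> S \<inter> ball x0 \<epsilon>"
    then have "P x = x" "P y = y" using P(3) SE by auto
    with xy have "norm (f x - f y - D x0 (x - y)) \<le> norm (x - y)"
      using e(2)[of x y] by simp
    moreover have "norm (D x0 (x - y)) \<le> norm (D x0) * norm (x - y)" by (rule norm_blinfun)
    moreover have "norm (f x - f y) \<le> norm (D x0 (x - y)) + norm (f x - f y - D x0 (x - y))"
      by (rule norm_triangle_sub)
    ultimately show "norm (f x - f y) \<le> (norm (D x0) + 1) * norm (x - y)"
      by (simp add: distrib_right)
  qed
qed

text \<open>Half of the constant rank theorem. Near a point of maximal rank the rank cannot drop,
  because injectivity on a complement \<open>W\<close> of the kernel persists. In the coordinates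
  \<open>\<Psi>\<close> the map depends only on the component along \<open>W\<close>, which
  \<open>A (f (\<Psi> y))\<close> reads off; adding the constant \<open>k\<close> gives the point of
  the slice with that component.\<close>

lemma rank_normal_form:
  fixes f :: "'e::euclidean_space \<Rightarrow> 'k::euclidean_space" and D :: "'e \<Rightarrow> 'e \<Rightarrow>\<^sub>L 'k"
  assumes T: "open T" "x0 \<in> T"
    and der: "\<And>x. x \<in> T \<Longrightarrow> (f has_derivative blinfun_apply (D x)) (at x)"
    and cont: "continuous_on T D"
    and max: "\<And>x. x \<in> T \<Longrightarrow> dim (range (D x)) \<le> dim (range (D x0))"
  obtains A :: "'k \<Rightarrow> 'e" and U V k \<Psi> L
  where "linear A" "inj_on A (range (D x0))" "open U" "x0 \<in> U" "U \<subseteq> T" "open V"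
    "A (f x0) + k \<in> V" "\<Psi> (A (f x0) + k) = x0" "\<Psi> ` V = U" "\<Psi> differentiable_on V"
    "\<And>y. y \<in> V \<Longrightarrow> f (\<Psi> y) = f (\<Psi> (A (f (\<Psi> y)) + k))"
    "\<And>y. y \<in> V \<Longrightarrow> A (f (\<Psi> y)) + k \<in> V"
    "\<And>y. y \<in> V \<Longrightarrow> \<exists>r\<in>range (D x0). A (f (\<Psi> y)) = A r"
    "\<And>z. A z + k \<in> V \<Longrightarrow> A (f (\<Psi> (A z + k))) = A z"
    "\<And>x y. x \<in> V \<Longrightarrow> y \<in> V \<Longrightarrow> norm (\<Psi> x - \<Psi> y) \<le> L * norm (x - y)"
proof -
  define K where "K = {v. D x0 v = 0}"
  have K: "subspace K"
    unfolding K_def by (auto simp: subspace_def blinfun.add_right blinfun.scaleR_right)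
  obtain p :: "'e \<Rightarrow> 'e" where p: "linear p" "\<And>v. p v \<in> K" "\<And>v. v \<in> K \<Longrightarrow> p v = v"
    by (rule linear_projection_exists[OF K]) blast
  define W where "W = {v. p v = 0}"
  have W: "subspace W"
    unfolding W_def using p(1) by (simp add: linear_subspace_kernel)
  have linD: "linear (blinfun_apply (D x))" for x
    by (simp add: blinfun.bounded_linear_right bounded_linear.linear)
  have KW: "v = 0" if "v \<in> K" "v \<in> W" for v
    using that p(3)[of v] by (auto simp: W_def)
  have inj: "inj_on (D x0) W"
    using linear_injective_on_subspace_0[OF linD W] KW by (auto simp: K_def)
  obtain A where "A ` UNIV \<subseteq> W" and A: "linear A" and AD: "\<And>w. w \<in> W \<Longrightarrow> A (D x0 w) = w"
    using linear_exists_left_inverse_on[OF linD W inj] by auto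
  then have AW: "A z \<in> W" for z by auto
  have pA: "p (A z) = 0" for z using AW by (simp add: W_def)
  have vpW: "v - p v \<in> W" for v
    unfolding W_def using p by (simp add: linear_diff)
  have Dp: "D x0 (p v) = 0" for v using p(2) by (auto simp: K_def)
  have ADx0: "A (D x0 v) = v - p v" for v
    using AD[OF vpW] Dp by (simp add: blinfun.diff_right)
  have blA: "bounded_linear A" and blp: "bounded_linear p"
    using A p(1) by (simp_all add: linear_linear)
  \<comment> \<open>To first order the two summands return complementary parts of a vector:
    \<open>A\<close> after \<open>D x0\<close> is the projection onto \<open>W\<close>,
    \<open>p\<close> the one onto \<open>K\<close>. Hence the derivative of \<open>\<Phi>\<close> at
    \<open>x0\<close> is the identity.\<close>
  define \<Phi> where "\<Phi> x = A (f x) + p x" for x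
  define D' where "D' x = (Blinfun A o\<^sub>L D x) + Blinfun p" for x
  have D': "D' x v = A (D x v) + p v" for x v
    by (simp add: D'_def blinfun.add_left bounded_linear_Blinfun_apply blA blp)
  have der\<Phi>: "(\<Phi> has_derivative D' x) (at x)" if "x \<in> T" for x
  proof -
    have "(\<Phi> has_derivative (\<lambda>v. A (D x v) + p v)) (at x)"
      unfolding \<Phi>_def
      by (intro has_derivative_add bounded_linear_imp_has_derivative[OF blp]
          bounded_linear.has_derivative[OF blA] der[OF that])
    then show ?thesis by (simp add: D'[symmetric])
  qed
  have cont': "continuous_on T D'"
    unfolding D'_def by (intro continuous_intros cont)
  have id: "D' x0 = id_blinfun"
    by (rule blinfun_eqI) (simp add: D' ADx0)
  have inv: "id_blinfun o\<^sub>L D' x0 = id_blinfun"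
    by (rule blinfun_eqI) (simp add: id)
  obtain \<epsilon> where eps: "\<epsilon> > 0" "ball x0 \<epsilon> \<subseteq> T"
    "\<And>x y. x \<in> ball x0 \<epsilon> \<Longrightarrow> y \<in> ball x0 \<epsilon> \<Longrightarrow> norm (\<Phi> x - \<Phi> y - D' x0 (x - y)) \<le> 1/2 * norm (x - y)"
    using C1_approx_linear[OF T _ der\<Phi> cont', of "1/2"] by auto
  \<comment> \<open>A map within 1/2 of the identity shrinks distances at most by half; this is the
    origin of the Lipschitz constant 2 of \<open>\<Psi>\<close>.\<close>
  have expand: "norm (x - y) \<le> 2 * norm (\<Phi> x - \<Phi> y)" if "x \<in> ball x0 \<epsilon>" "y \<in> ball x0 \<epsilon>" for x y
  proof -
    have "norm (\<Phi> x - \<Phi> y - (x - y)) \<le> 1/2 * norm (x - y)"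
      using eps(3)[OF that] by (simp add: id)
    then show ?thesis
      using norm_triangle_ineq2[of "x - y" "\<Phi> x - \<Phi> y"] by (simp add: norm_minus_commute)
  qed
  have derB: "\<And>x. x \<in> ball x0 \<epsilon> \<Longrightarrow> (\<Phi> has_derivative D' x) (at x)" using der\<Phi> eps by auto
  have contB: "continuous_on (ball x0 \<epsilon>) D'" using cont' eps continuous_on_subset by blast
  have x0B: "x0 \<in> ball x0 \<epsilon>" using eps by simp
  obtain U' V' \<Psi> \<Psi>' where UV: "open U'" "U' \<subseteq> ball x0 \<epsilon>" "x0 \<in> U'" "open V'" "\<Phi> x0 \<in> V'"
    "homeomorphism U' V' \<Phi> \<Psi>"
    and der\<Psi>: "\<And>y. y \<in> V' \<Longrightarrow> (\<Psi> has_derivative (\<Psi>' y)) (at y)"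
    and \<Psi>': "\<And>y. y \<in> V' \<Longrightarrow> \<Psi>' y = inv_into UNIV (blinfun_apply (D'(\<Psi> y)))"
    and bij: "\<And>y. y \<in> V' \<Longrightarrow> bij (blinfun_apply (D'(\<Psi> y)))"
    by (rule inverse_function_theorem[OF open_ball derB contB x0B inv]) auto
  have \<Phi>\<Psi>: "\<Phi> (\<Psi> y) = y" "\<Psi> y \<in> U'" if "y \<in> V'" for y
    using UV(6) that by (auto simp: homeomorphism_def)
  have \<Psi>\<Phi>: "\<Psi> (\<Phi> x) = x" "\<Phi> x \<in> V'" if "x \<in> U'" for x
    using UV(6) that by (auto simp: homeomorphism_def)
  have Af: "A (f (\<Psi> y)) = y - p y" if "y \<in> V'" for y
  proof -
    have "A (f (\<Psi> y)) + p (\<Psi> y) = y" using \<Phi>\<Psi>(1)[OF that] by (simp add: \<Phi>_def)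
    moreover from this have "p y = p (\<Psi> y)"
      using p pA by (metis linear_add add_0)
    ultimately show ?thesis by (simp add: algebra_simps)
  qed
  \<comment> \<open>\<open>D x\<close> is injective on \<open>W\<close> because \<open>D' x\<close>
    is, so by maximality of the rank at \<open>x0\<close> it maps \<open>W\<close> onto its whole
    range. The image of \<open>\<Psi>' y v\<close> therefore equals that of some
    \<open>w \<in> W\<close>. Applying \<open>A\<close> gives a vector in both \<open>K\<close> and
    \<open>W\<close>, hence 0, and this forces \<open>w = 0\<close>.\<close>
  have der0: "D (\<Psi> y) (\<Psi>' y v) = 0" if y: "y \<in> V'" and v: "v \<in> K" for y v
  proof -
    define x where "x = \<Psi> y"
    have xT: "x \<in> T" using \<Phi>\<Psi>(2)[OF y] UV eps by (auto simp: x_def)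
    have injx: "inj (D' x)" using bij[OF y] by (simp add: x_def bij_is_inj)
    have injW: "inj_on (D x) W"
    proof -
      have "w = 0" if "w \<in> W" "D x w = 0" for w
      proof -
        have "D' x w = 0" using that by (simp add: D' W_def linear_0[OF A])
        then show "w = 0" using injx by (metis injD blinfun.zero_right)
      qed
      then show ?thesis using linear_injective_on_subspace_0[OF linD W] by auto
    qed
    have "dim (D x ` W) = dim W"
      by (rule dim_image_eq[OF linD]) (use W injW in \<open>simp add: span_eq_iff[THEN iffD2]\<close>)
    also have "dim W = dim (D x0 ` W)"
      by (rule dim_image_eq[OF linD, symmetric]) (use W inj in \<open>simp add: span_eq_iff[THEN iffD2]\<close>)
    also have "D x0 ` W = range (D x0)"
    proof -
      have "D x0 v \<in> D x0 ` W" for v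
        using vpW[of v] Dp by (intro image_eqI[of _ _ "v - p v"]) (auto simp: blinfun.diff_right)
      then show ?thesis by auto
    qed
    finally have "dim (range (D x)) \<le> dim (D x ` W)" using max[OF xT] by simp
    then have "D x ` W = range (D x)"
      by (intro subspace_dim_equal) (auto simp: linear_subspace_image linD W)
    then obtain w where w: "w \<in> W" "D x (\<Psi>' y v) = D x w" by (metis imageE rangeI)
    have eq: "D' x (\<Psi>' y v) = v"
      using \<Psi>'[OF y] bij[OF y] by (simp add: x_def bij_is_surj surj_f_inv_f)
    then have "A (D x w) = v - p (\<Psi>' y v)" by (simp add: D' w(2)[symmetric] algebra_simps)
    then have "A (D x w) \<in> K" using v p(2) K by (simp add: subspace_diff)
    then have "A (D x w) = 0" using AW KW by blast
    then have "D' x w = 0" using w by (simp add: D' W_def)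
    then have "w = 0" using injx by (metis injD blinfun.zero_right)
    then show ?thesis using w by (simp add: x_def)
  qed
  have y0: "A (f x0) + p x0 = \<Phi> x0" by (simp add: \<Phi>_def)
  obtain \<delta> where del: "\<delta> > 0" "ball (\<Phi> x0) \<delta> \<subseteq> V'"
    using UV open_contains_ball by blast
  text \<open>A neighbourhood saturated for the fibres of \<open>\<lambda>y. y - p y\<close> within a ball, so that segments along
    \<open>K\<close> to the slice \<open>p y = p x0\<close> stay in \<open>V'\<close>.\<close>
  define V where "V = {y \<in> ball (\<Phi> x0) \<delta>. y - p y + p x0 \<in> ball (\<Phi> x0) \<delta>}"
  have VV': "V \<subseteq> V'" using del by (auto simp: V_def)
  have px0: "\<Phi> x0 - p (\<Phi> x0) + p x0 = \<Phi> x0"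
    using Af[OF UV(5)] \<Psi>\<Phi>(1)[OF UV(3)] by (simp add: \<Phi>_def)
  have "open V"
  proof -
    have "V = ball (\<Phi> x0) \<delta> \<inter> (\<lambda>y. y - p y + p x0) -` ball (\<Phi> x0) \<delta>" by (auto simp: V_def)
    moreover have "continuous_on UNIV (\<lambda>y. y - p y + p x0)"
      by (intro continuous_intros linear_continuous_on blp)
    ultimately show ?thesis by (simp add: continuous_on_open_vimage open_Int)
  qed
  have slice: "y - p y + p x0 \<in> V" if "y \<in> V" for y
    using that p by (auto simp: V_def linear_add linear_diff)
  \<comment> \<open>The segment from \<open>y\<close> to its slice point has velocity
    \<open>v \<in> K\<close>, so \<open>der0\<close> makes the derivative of \<open>c\<close> vanish
    and the values at both ends agree.\<close>
  have const: "f (\<Psi> y) = f (\<Psi> (y - p y + p x0))" if y: "y \<in> V" for y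
  proof -
    define v where "v = p x0 - p y"
    have vK: "v \<in> K" unfolding v_def using p K by (simp add: subspace_diff)
    have seg: "y + t *\<^sub>R v \<in> V'" if "t \<in> {0..1}" for t
    proof -
      have "y + t *\<^sub>R v = (1 - t) *\<^sub>R y + t *\<^sub>R (y - p y + p x0)"
        by (simp add: v_def algebra_simps)
      then have "y + t *\<^sub>R v \<in> ball (\<Phi> x0) \<delta>"
        using convexD[OF convex_ball, of y "\<Phi> x0" \<delta> "y - p y + p x0" "1 - t" t] y that
        by (auto simp: V_def)
      then show ?thesis using del by auto
    qed
    define c where "c t = f (\<Psi> (y + t *\<^sub>R v))" for t
    have "(c has_derivative (\<lambda>h. 0)) (at t within {0..1})" if t: "t \<in> {0..1}" for t
    proof -
      have 1: "((\<lambda>t. y + t *\<^sub>R v) has_derivative (\<lambda>h. h *\<^sub>R v)) (at t within {0..1})"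
        by (auto intro!: derivative_eq_intros)
      have 2: "((\<lambda>t. \<Psi> (y + t *\<^sub>R v)) has_derivative (\<lambda>h. \<Psi>' (y + t *\<^sub>R v) (h *\<^sub>R v))) (at t within {0..1})"
        by (rule has_derivative_compose[OF 1 der\<Psi>[OF seg[OF t]]])
      have "\<Psi> (y + t *\<^sub>R v) \<in> T" using \<Phi>\<Psi>(2)[OF seg[OF t]] UV eps by auto
      then have "(c has_derivative (\<lambda>h. D (\<Psi> (y + t *\<^sub>R v)) (\<Psi>' (y + t *\<^sub>R v) (h *\<^sub>R v)))) (at t within {0..1})"
        unfolding c_def by (intro has_derivative_compose[OF 2] der)
      moreover have "h *\<^sub>R v \<in> K" for h :: real using vK K by (simp add: subspace_scale)
      ultimately show ?thesis using der0[OF seg[OF t]] by simp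
    qed
    then obtain C where "\<And>t. t \<in> {0..1} \<Longrightarrow> c t = C"
      using has_derivative_zero_constant[of "{0..1}" c] by auto
    then have "c 0 = c 1" by simp
    then show ?thesis by (simp add: c_def v_def algebra_simps)
  qed
  have imV: "\<Psi> ` V = U' \<inter> \<Phi> -` V"
    using \<Phi>\<Psi> \<Psi>\<Phi> VV' by force
  have "open (U' \<inter> \<Phi> -` V)"
    using UV(1,6) \<open>open V\<close> by (simp add: homeomorphism_def continuous_open_preimage)
  show thesis
  proof (rule that[of A "\<Psi> ` V" V "p x0" \<Psi> 2, unfolded y0])
    show "linear A" by (rule A)
    show "inj_on A (range (D x0))"
    proof (rule inj_onI)
      fix a b assume "a \<in> range (D x0)" "b \<in> range (D x0)" and ab: "A a = A b"
      then obtain u v where "a = D x0 u" "b = D x0 v" by auto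
      with ab have "u - p u = v - p v" by (simp add: ADx0)
      then have "D x0 (u - p u) = D x0 (v - p v)" by simp
      then show "a = b" using Dp \<open>a = _\<close> \<open>b = _\<close> by (simp add: blinfun.diff_right)
    qed
    show "open (\<Psi> ` V)" using imV \<open>open (U' \<inter> \<Phi> -` V)\<close> by simp
    show "\<Phi> x0 \<in> V" using px0 del by (simp add: V_def)
    then show "x0 \<in> \<Psi> ` V" using \<Psi>\<Phi>(1)[OF UV(3)] by force
    show "\<Psi> ` V \<subseteq> T" using imV UV eps by auto
    show "\<Psi> (\<Phi> x0) = x0" using \<Psi>\<Phi>(1)[OF UV(3)] .
    show "\<Psi> differentiable_on V"
      using der\<Psi> VV' by (auto simp: differentiable_on_def differentiable_def intro: has_derivative_at_withinI)
    show "f (\<Psi> y) = f (\<Psi> (A (f (\<Psi> y)) + p x0))" "A (f (\<Psi> y)) + p x0 \<in> V"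
      if "y \<in> V" for y
      using const[OF that] slice[OF that] Af[of y] VV' that by auto
    show "\<exists>r\<in>range (blinfun_apply (D x0)). A (f (\<Psi> y)) = A r" if "y \<in> V" for y
      using Af[of y] VV' that ADx0[of y] by (metis rangeI subsetD)
    show "A (f (\<Psi> (A z + p x0))) = A z" if "A z + p x0 \<in> V" for z
      using Af[of "A z + p x0"] that VV' pA p by (auto simp: linear_add)
    show "norm (\<Psi> x - \<Psi> y) \<le> 2 * norm (x - y)" if "x \<in> V" "y \<in> V" for x y
      using expand[of "\<Psi> x" "\<Psi> y"] \<Phi>\<Psi> VV' that UV(2) by (metis subsetD)
  qed (use \<open>open V\<close> in auto)
qed

text \<open>A point of maximal rank exists since ranks are bounded by the dimension. Openness
  excludes a deficient rank there, so \<open>A\<close> is injective on all of \<open>F\<close>, and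
  \<open>y\<close> is lifted to the slice point \<open>\<Psi> (A y + k)\<close>, projected back to
  \<open>E\<close>.\<close>

lemma C1_open_map_local_section:
  fixes f :: "'e::euclidean_space \<Rightarrow> 'k::euclidean_space"
  assumes C1: "Ck_on (Suc 0) E S f" and S: "openin (top_of_set E) S" "S \<noteq> {}"
    and E: "subspace E" and F: "subspace F" and fF: "f ` S \<subseteq> F"
    and opn: "\<And>T. openin (top_of_set E) T \<Longrightarrow> T \<subseteq> S \<Longrightarrow> openin (top_of_set F) (f ` T)"
  obtains x0 Y \<sigma> L where "x0 \<in> S" "openin (top_of_set F) Y" "f x0 \<in> Y" "\<sigma> (f x0) = x0"
    "\<sigma> ` Y \<subseteq> S" "\<And>y. y \<in> Y \<Longrightarrow> f (\<sigma> y) = y" "L \<ge> 0"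
    "\<And>y z. y \<in> Y \<Longrightarrow> z \<in> Y \<Longrightarrow> norm (\<sigma> y - \<sigma> z) \<le> L * norm (y - z)"
proof -
  obtain P :: "'e \<Rightarrow> 'e" where P: "linear P" "\<And>v. P v \<in> E" "\<And>v. v \<in> E \<Longrightarrow> P v = v"
    by (rule linear_projection_exists[OF E]) blast
  obtain p :: "'k \<Rightarrow> 'k" where p: "linear p" "\<And>v. p v \<in> F" "\<And>v. v \<in> F \<Longrightarrow> p v = v"
    by (rule linear_projection_exists[OF F]) blast
  obtain D :: "'e \<Rightarrow> 'e \<Rightarrow>\<^sub>L 'k" where T: "open (P -` S)"
    and D: "\<And>x. P x \<in> S \<Longrightarrow> ((\<lambda>x. f (P x)) has_derivative blinfun_apply (D x)) (at x)"
    and contD: "continuous_on (P -` S) D"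
    using C1_extend[OF C1 S(1) P] by blast
  have SE: "S \<subseteq> E" using S(1) openin_imp_subset by blast
  define T where "T = P -` S"
  have "T \<noteq> {}" using S(2) SE P(3) by (force simp: T_def)
  then obtain a where "a \<in> T" by blast
  have "dim (range (D x)) < Suc DIM('k)" for x
    using dim_subset_UNIV[of "range (D x)"] by simp
  then obtain x1 where x1: "x1 \<in> T" and max: "\<And>x. x \<in> T \<Longrightarrow> dim (range (D x)) \<le> dim (range (D x1))"
    using ex_has_greatest_nat[of "\<lambda>x. x \<in> T" a "\<lambda>x. dim (range (D x))" "Suc DIM('k)"] \<open>a \<in> T\<close>
    by (auto intro: less_imp_le)
  define g where "g x = f (P x)" for x
  have openT: "open T" using T by (simp add: T_def)
  have derg: "\<And>x. x \<in> T \<Longrightarrow> (g has_derivative blinfun_apply (D x)) (at x)"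
    using D by (simp add: T_def g_def[abs_def])
  have contT: "continuous_on T D" using contD by (simp add: T_def)
  have gF: "g x \<in> F" if "x \<in> T" for x using fF that by (auto simp: T_def g_def)
  \<comment> \<open>Near \<open>x1\<close> the values of \<open>g\<close> are fixed by
    \<open>p\<close>, so by uniqueness those of its derivative are as well.\<close>
  have rF: "D x1 v \<in> F" for v
  proof -
    have "bounded_linear p" using p(1) by (simp add: linear_linear)
    then have "((\<lambda>x. p (g x)) has_derivative (\<lambda>v. p (D x1 v))) (at x1)"
      by (rule bounded_linear.has_derivative[OF _ derg[OF x1]])
    then have "(g has_derivative (\<lambda>v. p (D x1 v))) (at x1)"
      by (rule has_derivative_transform_within_open[OF _ openT x1]) (use gF p in auto)
    then have "blinfun_apply (D x1) = (\<lambda>v. p (D x1 v))"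
      using derg[OF x1] by (rule has_derivative_unique[symmetric])
    then have "D x1 v = p (D x1 v)" by (rule fun_cong)
    then show ?thesis using p(2) by metis
  qed
  obtain A :: "'k \<Rightarrow> 'e" and U V k \<Psi> L
    where A: "linear A" and injA: "inj_on A (range (D x1))"
      and U: "open U" "x1 \<in> U" "U \<subseteq> T" and V: "open V" "A (g x1) + k \<in> V"
      and \<Psi>1: "\<Psi> (A (g x1) + k) = x1" and \<Psi>V: "\<Psi> ` V = U" and diff\<Psi>: "\<Psi> differentiable_on V"
      and gc: "\<And>y. y \<in> V \<Longrightarrow> g (\<Psi> y) = g (\<Psi> (A (g (\<Psi> y)) + k))"
      and gV: "\<And>y. y \<in> V \<Longrightarrow> A (g (\<Psi> y)) + k \<in> V"
      and gR: "\<And>y. y \<in> V \<Longrightarrow> \<exists>r\<in>range (D x1). A (g (\<Psi> y)) = A r"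
      and Ag: "\<And>z. A z + k \<in> V \<Longrightarrow> A (g (\<Psi> (A z + k))) = A z"
      and Lip: "\<And>x y. x \<in> V \<Longrightarrow> y \<in> V \<Longrightarrow> norm (\<Psi> x - \<Psi> y) \<le> L * norm (x - y)"
  proof (rule rank_normal_form[where f = g, OF openT x1 _ contT], goal_cases)
    case 1
    show ?case by (rule derg) fact
  next
    case 2
    show ?case by (rule max) fact
  next
    case prems: 3
    show ?case by (rule prems(1)) (fact prems(2-))+
  qed
  have blA: "bounded_linear A" and blp: "bounded_linear p" and blP: "bounded_linear P"
    using A p(1) P(1) by (simp_all add: linear_linear)
  have R: "range (D x1) = F"
  proof (rule ccontr)
    assume "range (D x1) \<noteq> F"
    then obtain v where v: "v \<in> F" "v \<notin> range (D x1)" using rF by blast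
    \<comment> \<open>\<open>F\<close> may be a proper subspace and hence negligible, so measure
      would see nothing inside it. Source and target are therefore thickened by the kernel of
      \<open>p\<close>. The thickened range \<open>H\<close> is still a proper subspace, as it
      misses \<open>v\<close>.\<close>
    define H where "H = p -` range (D x1)"
    have H: "subspace H"
      unfolding H_def using p(1) blinfun.bounded_linear_right[of "D x1"]
      by (intro linear_subspace_vimage linear_subspace_image) (auto simp: bounded_linear.linear)
    have "v \<notin> H" using v p by (simp add: H_def)
    then have "dim H \<noteq> DIM('k)"
      using H dim_eq_full[of H] span_eq_iff[THEN iffD2, OF H] by auto
    then have "negligible H"
      using dim_subset_UNIV[of H] by (intro negligible_lowdim) simp
    define Z where "Z = {z \<in> H. A (p z) + k \<in> V}"
    \<comment> \<open>On the \<open>F\<close> component \<open>q\<close> follows \<open>g\<close>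
      along the slice; the component \<open>z - p z\<close> is left unchanged.\<close>
    define q where "q z = g (\<Psi> (A (p z) + k)) + (z - p z)" for z
    have "negligible Z" using \<open>negligible H\<close> by (rule negligible_subset) (auto simp: Z_def)
    moreover have "q differentiable_on Z"
      unfolding differentiable_on_def
    proof (rule ballI, rule differentiable_at_withinI)
      fix z assume z: "z \<in> Z"
      then have zV: "A (p z) + k \<in> V" by (simp add: Z_def)
      have 1: "(\<lambda>z. A (p z) + k) differentiable (at z)"
        by (intro differentiable_add differentiable_const bounded_linear_imp_differentiable
            bounded_linear_compose[OF blA blp])
      have 2: "\<Psi> differentiable (at (A (p z) + k))"
        using diff\<Psi> zV V(1) by (simp add: differentiable_on_eq_differentiable_at)
      have 3: "g differentiable (at (\<Psi> (A (p z) + k)))"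
        using derg[of "\<Psi> (A (p z) + k)"] \<Psi>V U(3) zV by (auto simp: differentiable_def)
      have "(\<lambda>z. g (\<Psi> (A (p z) + k))) differentiable (at z)"
        using differentiable_compose[OF 3 differentiable_compose[OF 2 1]] by simp
      then show "q differentiable (at z)"
        unfolding q_def
        by (intro differentiable_add differentiable_diff differentiable_ident
            bounded_linear_imp_differentiable[OF blp])
    qed
    ultimately have neg: "negligible (q ` Z)"
      by (intro negligible_differentiable_image_negligible) auto
    \<comment> \<open>\<open>x1\<close> need not lie in \<open>E\<close>. The shift by
      \<open>x1 - P x1\<close> carries points of \<open>E\<close> near \<open>P x1\<close> into
      \<open>U\<close>, and \<open>P\<close> undoes it.\<close>
    define T' where "T' = E \<inter> (\<lambda>v. v + (x1 - P x1)) -` U"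
    have PT': "P (v + (x1 - P x1)) = v" if "v \<in> T'" for v
      using that P by (simp add: T'_def linear_add linear_diff)
    have "open ((\<lambda>v. v + (x1 - P x1)) -` U)"
      by (intro open_vimage U continuous_intros)
    then have "openin (top_of_set E) T'" unfolding T'_def by (rule openin_open_Int)
    moreover have "T' \<subseteq> S"
    proof
      fix v assume v: "v \<in> T'"
      then have "v + (x1 - P x1) \<in> T" using U(3) by (auto simp: T'_def)
      then show "v \<in> S" using PT'[OF v] by (simp add: T_def)
    qed
    ultimately have "openin (top_of_set F) (f ` T')" by (rule opn)
    then obtain Y where Y: "open Y" "f ` T' = F \<inter> Y" by (auto simp: openin_open)
    \<comment> \<open>The value \<open>p z\<close> is attained at some \<open>\<Psi> y\<close>,
      hence by \<open>gc\<close> on the slice, at a point whose component is \<open>A r\<close> with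
      \<open>r\<close> in the range of \<open>D x1\<close>. Restoring the component
      \<open>z - p z\<close> turns \<open>r\<close> into a preimage of \<open>z\<close> that lies in
      \<open>H\<close>.\<close>
    have "p -` Y \<subseteq> q ` Z"
    proof
      fix z assume "z \<in> p -` Y"
      then have "p z \<in> f ` T'" using Y p by auto
      then obtain v where v: "v \<in> T'" "p z = f v" by blast
      then have "p z = g (v + (x1 - P x1))" using PT' by (simp add: g_def)
      moreover have "v + (x1 - P x1) \<in> \<Psi> ` V" using v by (simp add: T'_def \<Psi>V)
      then obtain y where "v + (x1 - P x1) = \<Psi> y" "y \<in> V" by (rule imageE)
      ultimately have y: "y \<in> V" "p z = g (\<Psi> y)" by simp_all
      obtain r where r: "r \<in> range (D x1)" "A (g (\<Psi> y)) = A r" using gR[OF y(1)] by blast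
      then have pr: "p r = r" using rF p(3) by blast
      have "p (r + (z - p z)) = r"
        using p pr by (simp add: linear_add linear_diff)
      moreover from this have "q (r + (z - p z)) = z"
        using gc[OF y(1)] r(2) y(2) by (simp add: q_def)
      ultimately show "z \<in> q ` Z"
        using gV[OF y(1)] r by (intro image_eqI[of _ _ "r + (z - p z)"]) (auto simp: Z_def H_def)
    qed
    then have "negligible (p -` Y)" using neg negligible_subset by blast
    moreover have "open (p -` Y)"
      by (intro open_vimage Y linear_continuous_on blp)
    moreover have "p -` Y \<noteq> {}"
    proof -
      have "P x1 \<in> T'" using U P by (auto simp: T'_def)
      then have "f (P x1) \<in> F \<inter> Y" using Y by blast
      then show ?thesis using p(3) by force
    qed
    ultimately show False using open_not_negligible by blast
  qed
  define Y where "Y = F \<inter> (\<lambda>y. A y + k) -` V"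
  define \<sigma> where "\<sigma> y = P (\<Psi> (A y + k))" for y
  obtain BA where BA: "BA > 0" "\<And>y. norm (A y) \<le> norm y * BA" using bounded_linear.pos_bounded[OF blA] by blast
  obtain BP where BP: "BP > 0" "\<And>y. norm (P y) \<le> norm y * BP" using bounded_linear.pos_bounded[OF blP] by blast
  have inT: "\<Psi> (A y + k) \<in> T" if "y \<in> Y" for y using that \<Psi>V U(3) by (auto simp: Y_def)
  \<comment> \<open>The constant is the product of those of \<open>P\<close>, \<open>\<Psi>\<close>
    and \<open>A\<close>; \<open>max\<close> secures its sign, as none is known for
    \<open>L\<close>.\<close>
  show thesis
  proof (rule that[of "P x1" Y \<sigma> "BP * (max 0 L * BA)"])
    show "P x1 \<in> S" using x1 by (simp add: T_def)
    have "open ((\<lambda>y. A y + k) -` V)"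
      by (intro open_vimage V continuous_on_add continuous_on_const linear_continuous_on blA)
    then show "openin (top_of_set F) Y" unfolding Y_def by (rule openin_open_Int)
    show "f (P x1) \<in> Y" using V(2) gF[OF x1] by (simp add: Y_def g_def)
    show "\<sigma> (f (P x1)) = P x1" using \<Psi>1 by (simp add: \<sigma>_def g_def)
    show "\<sigma> ` Y \<subseteq> S" using inT by (auto simp: \<sigma>_def T_def)
    show "f (\<sigma> y) = y" if y: "y \<in> Y" for y
    proof -
      have "A (g (\<Psi> (A y + k))) = A y" using Ag y by (simp add: Y_def)
      then have "g (\<Psi> (A y + k)) = y"
        using injA gF[OF inT[OF y]] y unfolding R by (auto simp: Y_def inj_on_def)
      then show ?thesis by (simp add: g_def \<sigma>_def)
    qed
    show "0 \<le> BP * (max 0 L * BA)" using BA BP by simp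
    show "norm (\<sigma> y - \<sigma> z) \<le> BP * (max 0 L * BA) * norm (y - z)" if "y \<in> Y" "z \<in> Y" for y z
    proof -
      have "norm (\<sigma> y - \<sigma> z) \<le> norm (\<Psi> (A y + k) - \<Psi> (A z + k)) * BP"
        using BP(2)[of "\<Psi> (A y + k) - \<Psi> (A z + k)"] P(1) by (simp add: \<sigma>_def linear_diff)
      also have "norm (\<Psi> (A y + k) - \<Psi> (A z + k)) \<le> L * norm (A y + k - (A z + k))"
        by (rule Lip) (use that in \<open>auto simp: Y_def\<close>)
      also have "\<dots> \<le> max 0 L * norm (A (y - z))"
        using A by (simp add: linear_diff mult_right_mono)
      also have "\<dots> \<le> max 0 L * (norm (y - z) * BA)" by (intro mult_left_mono BA) simp
      finally show ?thesis using BP by (simp add: mult_ac mult_right_mono)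
    qed
  qed
qed

section \<open>The Hausdorff distance and Lipschitz paths\<close>

context Metric_space
begin

text \<open>The one-sided half of the Hausdorff distance. The triangle inequality and definiteness
  are proved for each half and then combined by \<open>max\<close>.\<close>

definition excess :: "'a set \<Rightarrow> 'a set \<Rightarrow> real" where
  "excess A B = (SUP a\<in>A. INF b\<in>B. d a b)"

lemma hausdorff_dist_excess: "hausdorff_dist d A B = max (excess A B) (excess B A)"
  by (simp add: hausdorff_dist_def excess_def)

lemma bdd_below_dist: "bdd_below (d a ` B)"
  by (intro bdd_belowI[of _ 0]) auto

text \<open>A real \<open>SUP\<close> carries information only for sets bounded above. One fixed
  pair \<open>a0\<close>, \<open>b0\<close> bounds all the distances through the triangle
  inequality.\<close>

lemma bdd_above_INF_dist:
  assumes "mbounded A" "B \<subseteq> M" "B \<noteq> {}"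
  shows "bdd_above ((\<lambda>a. INF b\<in>B. d a b) ` A)"
proof (cases "A = {}")
  case False
  then obtain a0 where a0: "a0 \<in> A" by blast
  obtain b0 where b0: "b0 \<in> B" using assms by blast
  obtain K where K: "\<And>x y. x \<in> A \<Longrightarrow> y \<in> A \<Longrightarrow> d x y \<le> K" and AM: "A \<subseteq> M"
    using assms(1) by (auto simp: mbounded_alt)
  have "(INF b\<in>B. d a b) \<le> K + d a0 b0" if "a \<in> A" for a
  proof -
    have "(INF b\<in>B. d a b) \<le> d a b0" by (rule cINF_lower[OF bdd_below_dist b0])
    also have "\<dots> \<le> d a a0 + d a0 b0" using triangle AM assms(2) that a0 b0 by blast
    also have "\<dots> \<le> K + d a0 b0" using K that a0 by simp
    finally show ?thesis .
  qed
  then show ?thesis by (intro bdd_aboveI[of _ "K + d a0 b0"]) auto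
qed simp

lemma excess_leI:
  assumes "A \<noteq> {}" "\<And>a. a \<in> A \<Longrightarrow> \<exists>b\<in>B. d a b \<le> K"
  shows "excess A B \<le> K"
  unfolding excess_def
proof (rule cSUP_least[OF assms(1)])
  fix a assume "a \<in> A"
  then obtain b where "b \<in> B" "d a b \<le> K" using assms(2) by blast
  then show "(INF b\<in>B. d a b) \<le> K" using cINF_lower[OF bdd_below_dist, of b B a] by linarith
qed

lemma INF_le_excess:
  assumes "mbounded A" "B \<subseteq> M" "B \<noteq> {}" "a \<in> A"
  shows "(INF b\<in>B. d a b) \<le> excess A B"
  unfolding excess_def by (rule cSUP_upper[OF assms(4) bdd_above_INF_dist[OF assms(1-3)]])

lemma excess_nonneg:
  assumes "mbounded A" "B \<subseteq> M" "B \<noteq> {}" "A \<noteq> {}"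
  shows "0 \<le> excess A B"
proof -
  obtain a where a: "a \<in> A" using assms by blast
  have "0 \<le> (INF b\<in>B. d a b)" using assms by (intro cINF_greatest) auto
  also have "\<dots> \<le> excess A B" by (rule INF_le_excess[OF assms(1-3) a])
  finally show ?thesis .
qed

text \<open>For fixed \<open>b\<close> the infimum over \<open>c\<close> of the triangle inequality
  is taken first; since \<open>excess B C\<close> does not depend on \<open>b\<close>, the infimum
  over \<open>b\<close> can follow.\<close>

lemma excess_triangle:
  assumes "mbounded A" "mbounded B" "C \<subseteq> M" "A \<noteq> {}" "B \<noteq> {}" "C \<noteq> {}"
  shows "excess A C \<le> excess A B + excess B C"
  unfolding excess_def[of A C]
proof (rule cSUP_least[OF assms(4)])
  fix a assume a: "a \<in> A"
  have AM: "A \<subseteq> M" and BM: "B \<subseteq> M" using assms by (auto simp: mbounded_alt)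
  have "(INF c\<in>C. d a c) - excess B C \<le> d a b" if b: "b \<in> B" for b
  proof -
    have "(INF c\<in>C. d a c) - d a b \<le> (INF c\<in>C. d b c)"
    proof (rule cINF_greatest[OF assms(6)])
      fix c assume c: "c \<in> C"
      have "(INF c\<in>C. d a c) \<le> d a c" by (rule cINF_lower[OF bdd_below_dist c])
      also have "\<dots> \<le> d a b + d b c" using triangle a b c AM BM assms(3) by blast
      finally show "(INF c\<in>C. d a c) - d a b \<le> d b c" by simp
    qed
    also have "\<dots> \<le> excess B C" by (rule INF_le_excess[OF assms(2,3,6) b])
    finally show ?thesis by simp
  qed
  then have "(INF c\<in>C. d a c) - excess B C \<le> (INF b\<in>B. d a b)"
    by (intro cINF_greatest[OF assms(5)])
  also have "\<dots> \<le> excess A B" by (rule INF_le_excess[OF assms(1) BM assms(5) a])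
  finally show "(INF c\<in>C. d a c) \<le> excess A B + excess B C" by simp
qed

text \<open>A point of \<open>A\<close> outside the closed set \<open>B\<close> is the centre of a
  ball disjoint from \<open>B\<close>, whose radius would be a lower bound for the excess.\<close>

lemma excess_zero_subset:
  assumes "mbounded A" "B \<subseteq> M" "B \<noteq> {}" "closedin mtopology B" "excess A B \<le> 0"
  shows "A \<subseteq> B"
proof
  fix a assume a: "a \<in> A"
  then have aM: "a \<in> M" using assms(1) by (auto simp: mbounded_alt)
  show "a \<in> B"
  proof (rule ccontr)
    assume "a \<notin> B"
    then obtain r where r: "r > 0" "disjnt B (mball a r)"
      using assms(4) aM by (auto simp: closedin_metric)
    have "r \<le> d a b" if "b \<in> B" for b
      using r that aM assms(2) by (force simp: disjnt_iff)
    then have "r \<le> (INF b\<in>B. d a b)" by (intro cINF_greatest[OF assms(3)])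
    also have "\<dots> \<le> excess A B" by (rule INF_le_excess[OF assms(1-3) a])
    finally show False using r(1) assms(5) by simp
  qed
qed

text \<open>Each point is matched with the one of the same parameter \<open>x\<close>, which avoids
  any search for nearest points. In the application \<open>f\<close> and \<open>g\<close> are the
  actions of two coset representatives.\<close>

lemma hausdorff_dist_image_le:
  assumes "X \<noteq> {}" "\<And>x. x \<in> X \<Longrightarrow> d (f x) (g x) \<le> K"
  shows "hausdorff_dist d (f ` X) (g ` X) \<le> K"
  unfolding hausdorff_dist_excess
proof (rule max.boundedI)
  show "excess (f ` X) (g ` X) \<le> K" using assms by (intro excess_leI) auto
  have "\<exists>b\<in>f ` X. d (g x) b \<le> K" if "x \<in> X" for x
    using assms(2)[OF that] that by (auto simp: commute)
  then show "excess (g ` X) (f ` X) \<le> K" using assms(1) by (intro excess_leI) auto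
qed

text \<open>Compact sets are bounded, which makes the suprema meaningful, and closed, so that
  distance 0 implies equality; injectivity of \<open>R\<close> carries this back to the index
  set.\<close>

lemma Metric_space_hausdorff_dist:
  assumes "inj_on R S" and cpt: "\<And>p. p \<in> S \<Longrightarrow> compactin mtopology (R p)" and ne: "\<And>p. p \<in> S \<Longrightarrow> R p \<noteq> {}"
  shows "Metric_space S (\<lambda>p q. if p \<in> S \<and> q \<in> S then hausdorff_dist d (R p) (R q) else 0)"
proof -
  have bd: "mbounded (R p)" "R p \<subseteq> M" "closedin mtopology (R p)" if "p \<in> S" for p
    using cpt[OF that] compactin_subset_topspace[OF cpt[OF that]]
    by (auto simp: compactin_imp_mbounded compactin_imp_closedin Hausdorff_space_mtopology)
  show ?thesis
  proof
    fix x y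
    show "0 \<le> (if x \<in> S \<and> y \<in> S then hausdorff_dist d (R x) (R y) else 0)"
      using excess_nonneg[of "R x" "R y"] bd ne by (simp add: hausdorff_dist_excess le_max_iff_disj)
    show "(if x \<in> S \<and> y \<in> S then hausdorff_dist d (R x) (R y) else 0) =
      (if y \<in> S \<and> x \<in> S then hausdorff_dist d (R y) (R x) else 0)"
      by (simp add: hausdorff_dist_excess max.commute)
  next
    fix x y assume xy: "x \<in> S" "y \<in> S"
    have "hausdorff_dist d (R x) (R x) \<le> 0" if "x \<in> S" for x
    proof -
      have "\<exists>b\<in>R x. d a b \<le> 0" if "a \<in> R x" for a
        using bd(2)[OF \<open>x \<in> S\<close>] that by (intro bexI[OF _ that]) auto
      then have "excess (R x) (R x) \<le> 0" using ne[OF that] by (intro excess_leI)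
      then show ?thesis by (simp add: hausdorff_dist_excess)
    qed
    moreover have "hausdorff_dist d (R x) (R x) \<ge> 0" if "x \<in> S" for x
      using excess_nonneg[of "R x" "R x"] bd ne that by (simp add: hausdorff_dist_excess)
    moreover have "x = y" if "hausdorff_dist d (R x) (R y) = 0"
    proof -
      have "excess (R x) (R y) \<le> 0" "excess (R y) (R x) \<le> 0"
        using that by (auto simp: hausdorff_dist_excess max_def split: if_splits)
      then have "R x = R y"
        using excess_zero_subset[of "R x" "R y"] excess_zero_subset[of "R y" "R x"] bd ne xy by blast
      then show ?thesis using assms(1) xy by (meson inj_onD)
    qed
    ultimately show "((if x \<in> S \<and> y \<in> S then hausdorff_dist d (R x) (R y) else 0) = 0) = (x = y)"
      using xy by (auto intro: antisym)
  next
    fix x y z assume S: "x \<in> S" "y \<in> S" "z \<in> S"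
    have "excess (R x) (R z) \<le> excess (R x) (R y) + excess (R y) (R z)"
      "excess (R z) (R x) \<le> excess (R z) (R y) + excess (R y) (R x)"
      using S bd ne by (auto intro!: excess_triangle)
    then show "(if x \<in> S \<and> z \<in> S then hausdorff_dist d (R x) (R z) else 0)
       \<le> (if x \<in> S \<and> y \<in> S then hausdorff_dist d (R x) (R y) else 0) +
         (if y \<in> S \<and> z \<in> S then hausdorff_dist d (R y) (R z) else 0)"
      using S unfolding hausdorff_dist_excess by (simp only: if_True simp_thms)
  qed
qed

end

section \<open>Lipschitz paths: length, induced distance and gluing\<close>

lemma interval_partition_mono:
  assumes "interval_partition a b n t" "i \<le> j" "j \<le> n"
  shows "t i \<le> t j"
  using assms(2,3)
proof (induction j rule: dec_induct)
  case (step j)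
  then have "t j < t (Suc j)" using assms(1) by (simp add: interval_partition_def)
  then show ?case using step by simp
qed simp

lemma path_length_le:
  assumes "\<And>s u. s \<in> {a..b} \<Longrightarrow> u \<in> {a..b} \<Longrightarrow> \<rho> (\<gamma> s) (\<gamma> u) \<le> ereal (L * \<bar>s - u\<bar>)"
  shows "path_length \<rho> a b \<gamma> \<le> ereal (L * (b - a))"
  unfolding path_length_def
proof (rule Sup_least, clarify)
  fix n t assume t: "interval_partition a b n t"
  have "(\<Sum>i<n. \<rho> (\<gamma> (t (Suc i))) (\<gamma> (t i))) \<le> (\<Sum>i<n. ereal (L * (t (Suc i) - t i)))"
  proof (rule sum_mono)
    fix i assume i: "i \<in> {..<n}"
    have "t 0 = a" "t n = b" using t by (auto simp: interval_partition_def)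
    then have "t i \<in> {a..b}" "t (Suc i) \<in> {a..b}" "t i \<le> t (Suc i)"
      using interval_partition_mono[OF t] i by (metis atLeastAtMost_iff le0 less_imp_le lessThan_iff Suc_leI le_SucI order_refl)+
    then show "\<rho> (\<gamma> (t (Suc i))) (\<gamma> (t i)) \<le> ereal (L * (t (Suc i) - t i))"
      using assms[of "t (Suc i)" "t i"] by simp
  qed
  also have "\<dots> = ereal (L * (\<Sum>i<n. t (Suc i) - t i))" by (simp add: sum_distrib_left)
  also have "(\<Sum>i<n. t (Suc i) - t i) = b - a"
    using t by (simp add: sum_lessThan_telescope interval_partition_def)
  finally show "(\<Sum>i<n. \<rho> (\<gamma> (t (Suc i))) (\<gamma> (t i))) \<le> ereal (L * (b - a))" .
qed

lemma lipschitz_path_rectifiable: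
  assumes "lipschitz_path \<rho> a b \<gamma>"
  shows "rectifiable_path \<rho> a b \<gamma>"
proof -
  obtain L where "\<And>s u. s \<in> {a..b} \<Longrightarrow> u \<in> {a..b} \<Longrightarrow> \<rho> (\<gamma> s) (\<gamma> u) \<le> ereal (L * \<bar>s - u\<bar>)"
    using assms unfolding lipschitz_path_def by blast
  then have "path_length \<rho> a b \<gamma> \<le> ereal (L * (b - a))" by (rule path_length_le)
  also have "\<dots> < \<infinity>" by simp
  finally show ?thesis by (simp add: rectifiable_path_def)
qed

lemma (in Metric_space) lipschitz_continuous_map:
  assumes "\<And>s. s \<in> {a..b} \<Longrightarrow> \<gamma> s \<in> M"
    and "L \<ge> 0" "\<And>s u. s \<in> {a..b} \<Longrightarrow> u \<in> {a..b} \<Longrightarrow> d (\<gamma> s) (\<gamma> u) \<le> L * \<bar>s - u\<bar>"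
  shows "continuous_map (top_of_set {a..b}) mtopology \<gamma>"
  unfolding continuous_map_to_metric
proof (intro ballI allI impI, goal_cases)
  case (1 s \<epsilon>)
  \<comment> \<open>The summand 1 allows for \<open>L = 0\<close>.\<close>
  define \<delta> where "\<delta> = \<epsilon> / (L + 1)"
  have "\<gamma> u \<in> mball (\<gamma> s) \<epsilon>" if "u \<in> {a..b} \<inter> ball s \<delta>" for u
  proof -
    have "d (\<gamma> s) (\<gamma> u) \<le> L * \<bar>s - u\<bar>" using assms(3) 1 that by simp
    also have "\<dots> \<le> L * \<delta>" using that assms(2) by (intro mult_left_mono) (auto simp: dist_real_def)
    also have "\<dots> < \<epsilon>" using 1 assms(2) by (simp add: \<delta>_def field_simps)
    finally show ?thesis using assms(1) 1 that by simp
  qed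
  moreover have "\<delta> > 0" using 1 assms(2) by (simp add: \<delta>_def)
  ultimately show ?case using 1
    by (intro exI[of _ "{a..b} \<inter> ball s \<delta>"]) auto
qed

text \<open>Every piece of the path is a continuous competitor in the infimum, and its length is at
  most \<open>L\<close> times the length of its parameter interval. So the same constant works for
  the induced distance.\<close>

lemma lipschitz_path_induced_dist:
  assumes M: "Metric_space S \<rho>" and S: "\<And>s. s \<in> {a..b} \<Longrightarrow> \<gamma> s \<in> S"
    and lip: "lipschitz_path (\<lambda>p q. ereal (\<rho> p q)) a b \<gamma>"
  shows "lipschitz_path (induced_dist S \<rho>) a b \<gamma>"
proof -
  obtain L where L: "L \<ge> 0" "\<And>s u. s \<in> {a..b} \<Longrightarrow> u \<in> {a..b} \<Longrightarrow> \<rho> (\<gamma> s) (\<gamma> u) \<le> L * \<bar>s - u\<bar>"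
    using lip by (auto simp: lipschitz_path_def)
  have *: "induced_dist S \<rho> (\<gamma>' v) (\<gamma>' w) \<le> ereal (L * (w - v))"
    if "v \<le> w" "\<And>s. s \<in> {v..w} \<Longrightarrow> \<gamma>' s \<in> S"
      "\<And>s u. s \<in> {v..w} \<Longrightarrow> u \<in> {v..w} \<Longrightarrow> \<rho> (\<gamma>' s) (\<gamma>' u) \<le> L * \<bar>s - u\<bar>" for v w \<gamma>'
  proof -
    have "induced_dist S \<rho> (\<gamma>' v) (\<gamma>' w) \<le> path_length (\<lambda>x y. ereal (\<rho> x y)) v w \<gamma>'"
      unfolding induced_dist_def using that(1) Metric_space.lipschitz_continuous_map[OF M that(2) L(1) that(3)]
      by (intro Inf_lower) blast
    also have "\<dots> \<le> ereal (L * (w - v))" using that(3) by (intro path_length_le) simp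
    finally show ?thesis .
  qed
  show ?thesis
    unfolding lipschitz_path_def
  proof (intro exI[of _ L] conjI ballI)
    fix s t assume st: "s \<in> {a..b}" "t \<in> {a..b}"
    show "induced_dist S \<rho> (\<gamma> s) (\<gamma> t) \<le> ereal (L * \<bar>s - t\<bar>)"
    proof (cases "s \<le> t")
      case True
      then show ?thesis using *[of s t \<gamma>] S L st by auto
    next
      \<comment> \<open>Competitors run forward in their parameter; for \<open>t < s\<close> the
        path is reversed by reflecting the parameter.\<close>
      case False
      then show ?thesis using *[of "- s" "- t" "\<lambda>u. \<gamma> (- u)"] S L(2)[of "- _" "- _"] st
        by (force simp: abs_minus_commute)
    qed
  qed (rule L)
qed

text \<open>For parameters on both sides of \<open>b\<close> the triangle inequality through
  \<open>\<gamma> b\<close> costs nothing, because the two parameter distances add up. So the larger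
  of the two constants suffices.\<close>

lemma lipschitz_path_join:
  assumes \<rho>: "Metric_space S \<rho>" and S: "\<And>s. s \<in> {a..c} \<Longrightarrow> \<gamma> s \<in> S" and "a \<le> b" "b \<le> c"
    and 1: "lipschitz_path (\<lambda>p q. ereal (\<rho> p q)) a b \<gamma>"
    and 2: "lipschitz_path (\<lambda>p q. ereal (\<rho> p q)) b c \<gamma>"
  shows "lipschitz_path (\<lambda>p q. ereal (\<rho> p q)) a c \<gamma>"
proof -
  interpret Metric_space S \<rho> by (rule \<rho>)
  obtain L1 where L1: "L1 \<ge> 0" "\<And>s u. s \<in> {a..b} \<Longrightarrow> u \<in> {a..b} \<Longrightarrow> \<rho> (\<gamma> s) (\<gamma> u) \<le> L1 * \<bar>s - u\<bar>"
    using 1 by (auto simp: lipschitz_path_def)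
  obtain L2 where L2: "L2 \<ge> 0" "\<And>s u. s \<in> {b..c} \<Longrightarrow> u \<in> {b..c} \<Longrightarrow> \<rho> (\<gamma> s) (\<gamma> u) \<le> L2 * \<bar>s - u\<bar>"
    using 2 by (auto simp: lipschitz_path_def)
  define L where "L = max L1 L2"
  have le: "L1 * \<bar>s - u\<bar> \<le> L * \<bar>s - u\<bar>" "L2 * \<bar>s - u\<bar> \<le> L * \<bar>s - u\<bar>" for s u
    by (auto simp: L_def intro: mult_right_mono)
  have *: "\<rho> (\<gamma> s) (\<gamma> u) \<le> L * \<bar>s - u\<bar>" if su: "s \<in> {a..c}" "u \<in> {a..c}" "s \<le> u" for s u
  proof -
    consider "u \<le> b" | "b \<le> s" | "s \<le> b" "b \<le> u" by linarith
    then show ?thesis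
    proof cases
      case 1
      then show ?thesis using L1(2)[of s u] le(1)[of s u] su by simp
    next
      case 2
      then show ?thesis using L2(2)[of s u] le(2)[of s u] su by simp
    next
      case 3
      have "\<rho> (\<gamma> s) (\<gamma> u) \<le> \<rho> (\<gamma> s) (\<gamma> b) + \<rho> (\<gamma> b) (\<gamma> u)"
        using triangle S su assms(3,4) by auto
      also have "\<dots> \<le> L * \<bar>s - b\<bar> + L * \<bar>b - u\<bar>"
        using L1(2)[of s b] L2(2)[of b u] le(1)[of s b] le(2)[of b u] 3 su by simp
      also have "\<dots> = L * \<bar>s - u\<bar>" using 3 by (simp add: algebra_simps)
      finally show ?thesis .
    qed
  qed
  show ?thesis
    unfolding lipschitz_path_def
  proof (intro exI[of _ L] conjI ballI)
    show "0 \<le> L" using L1 by (simp add: L_def)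
    fix s t assume "s \<in> {a..c}" "t \<in> {a..c}"
    then show "ereal (\<rho> (\<gamma> s) (\<gamma> t)) \<le> ereal (L * \<bar>s - t\<bar>)"
      using *[of s t] *[of t s] by (cases "s \<le> t") (auto simp: commute abs_minus_commute)
  qed
qed

lemma lipschitz_path_local:
  assumes \<rho>: "Metric_space S \<rho>" and S: "\<And>s. s \<in> {a..b} \<Longrightarrow> \<gamma> s \<in> S" and "a \<le> b"
    and loc: "\<And>x. x \<in> {a..b} \<Longrightarrow> \<exists>\<delta>>0. \<exists>L\<ge>0. \<forall>s\<in>{a..b} \<inter> ball x \<delta>. \<forall>u\<in>{a..b} \<inter> ball x \<delta>.
      \<rho> (\<gamma> s) (\<gamma> u) \<le> L * \<bar>s - u\<bar>"
  shows "lipschitz_path (\<lambda>p q. ereal (\<rho> p q)) a b \<gamma>"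
proof -
  \<comment> \<open>Bisection: \<open>P\<close> passes to the union of adjacent intervals and holds
    on short ones. The premise makes it vacuous for intervals that stick out of
    \<open>{a..b}\<close>, which the bisection principle also asks about.\<close>
  define P where "P u v \<longleftrightarrow> a \<le> u \<and> v \<le> b \<longrightarrow> lipschitz_path (\<lambda>p q. ereal (\<rho> p q)) u v \<gamma>" for u v
  have "P a b"
    using \<open>a \<le> b\<close>
  proof (induction rule: Bolzano)
    case (trans u v w)
    then show ?case
      unfolding P_def using S by (auto intro!: lipschitz_path_join[OF \<rho>, of u w _ v])
  next
    case (local x)
    then obtain \<delta> L where "\<delta> > 0" "L \<ge> 0" and L: "\<And>s u. s \<in> {a..b} \<inter> ball x \<delta> \<Longrightarrow> u \<in> {a..b} \<inter> ball x \<delta> \<Longrightarrow>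
      \<rho> (\<gamma> s) (\<gamma> u) \<le> L * \<bar>s - u\<bar>"
      using loc[of x] by auto
    have "P u v" if "u \<le> x" "x \<le> v" "v - u < \<delta>" for u v
      unfolding P_def lipschitz_path_def
    proof (intro impI exI[of _ L] conjI ballI)
      fix s t assume "a \<le> u \<and> v \<le> b" "s \<in> {u..v}" "t \<in> {u..v}"
      moreover from this have "\<bar>x - s\<bar> < \<delta>" "\<bar>x - t\<bar> < \<delta>"
        using that unfolding atLeastAtMost_iff by linarith+
      ultimately show "ereal (\<rho> (\<gamma> s) (\<gamma> t)) \<le> ereal (L * \<bar>s - t\<bar>)"
        using L[of s t] by (simp add: dist_real_def)
    qed (rule \<open>L \<ge> 0\<close>)
    then show ?case using \<open>\<delta> > 0\<close> by blast
  qed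
  then show ?thesis by (simp add: P_def)
qed

lemma lipschitz_path_partition:
  assumes \<rho>: "Metric_space S \<rho>" and S: "\<And>s. s \<in> {a..b} \<Longrightarrow> \<gamma> s \<in> S"
    and t: "interval_partition a b n t"
    and seg: "\<And>i. i < n \<Longrightarrow> lipschitz_path (\<lambda>p q. ereal (\<rho> p q)) (t i) (t (Suc i)) \<gamma>"
  shows "lipschitz_path (\<lambda>p q. ereal (\<rho> p q)) a b \<gamma>"
proof -
  have ab: "t 0 = a" "t n = b" using t by (auto simp: interval_partition_def)
  have "lipschitz_path (\<lambda>p q. ereal (\<rho> p q)) (t 0) (t k) \<gamma>" if "k \<le> n" for k
    using that
  proof (induction k)
    case 0
    have "\<rho> (\<gamma> (t 0)) (\<gamma> (t 0)) = 0"
      using S[of "t 0"] ab interval_partition_mono[OF t, of 0 n] Metric_space.zero[OF \<rho>] by simp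
    then show ?case by (auto simp: lipschitz_path_def intro!: exI[of _ 0])
  next
    case (Suc k)
    have le: "t 0 \<le> t k" "t k \<le> t (Suc k)" "t (Suc k) \<le> t n"
      using Suc.prems by (auto intro!: interval_partition_mono[OF t])
    show ?case
      by (rule lipschitz_path_join[OF \<rho> _ le(1,2)]) (use Suc seg S ab le in auto)
  qed
  then show ?thesis using ab by force
qed

section \<open>Charts\<close>

text \<open>The requirements of \<open>smooth_manifold\<close> on a single chart. Kept apart so that
  product charts can be used directly, without first showing that \<open>prod_manifold\<close> is a
  smooth manifold.\<close>

definition is_chart :: "('a, 'e::euclidean_space) manifold \<Rightarrow> 'a set \<Rightarrow> ('a \<Rightarrow> 'e) \<Rightarrow> bool" where
  "is_chart M U \<phi> \<longleftrightarrow> openin (mtop M) U \<and> openin (top_of_set (model M)) (\<phi> ` U) \<and>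
     homeomorphic_map (subtopology (mtop M) U) (top_of_set (\<phi> ` U)) \<phi>"

lemma smooth_manifold_chart:
  assumes "smooth_manifold M" "(U, \<phi>) \<in> atlas M"
  shows "is_chart M U \<phi>"
  using assms by (auto simp: smooth_manifold_def is_chart_def)

lemma smooth_manifold_chart_exists:
  assumes "smooth_manifold M" "p \<in> topspace (mtop M)"
  obtains U \<phi> where "(U, \<phi>) \<in> atlas M" "p \<in> U"
  using assms by (force simp: smooth_manifold_def)

lemma is_chart_topspace:
  assumes "is_chart M U \<phi>"
  shows "U \<subseteq> topspace (mtop M)" "topspace (subtopology (mtop M) U) = U"
  using assms openin_subset by (auto simp: is_chart_def)

lemma is_chart_inj:
  assumes "is_chart M U \<phi>"
  shows "inj_on \<phi> U"
proof -
  have "inj_on \<phi> (topspace (subtopology (mtop M) U))"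
    using assms unfolding is_chart_def by (intro homeomorphic_imp_injective_map) auto
  then show ?thesis using is_chart_topspace(2)[OF assms] by metis
qed

lemma is_chart_open_image:
  assumes "is_chart M U \<phi>" "openin (mtop M) W" "W \<subseteq> U"
  shows "openin (top_of_set (model M)) (\<phi> ` W)"
proof -
  have "openin (subtopology (mtop M) U) W"
    using assms by (metis openin_subtopology_Int2 inf.absorb_iff2 inf.absorb_iff1)
  then have "openin (top_of_set (\<phi> ` U)) (\<phi> ` W)"
    using assms unfolding is_chart_def by (meson homeomorphic_imp_open_map open_map_def)
  then show ?thesis using assms(1) unfolding is_chart_def by (meson openin_trans)
qed

lemma is_chart_open_preimage:
  assumes "is_chart M U \<phi>" "openin (top_of_set (model M)) T"
  shows "openin (mtop M) {x \<in> U. \<phi> x \<in> T}"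
proof -
  have "continuous_map (subtopology (mtop M) U) (top_of_set (\<phi> ` U)) \<phi>"
    using assms unfolding is_chart_def by (intro homeomorphic_imp_continuous_map) auto
  moreover have "openin (top_of_set (\<phi> ` U)) (\<phi> ` U \<inter> T)"
  proof -
    obtain O' where "open O'" "T = model M \<inter> O'" using assms(2) by (auto simp: openin_open)
    moreover have "\<phi> ` U \<subseteq> model M" using assms(1) openin_imp_subset unfolding is_chart_def by blast
    ultimately show ?thesis by (auto simp: openin_open)
  qed
  ultimately have "openin (subtopology (mtop M) U) {x \<in> topspace (subtopology (mtop M) U). \<phi> x \<in> \<phi> ` U \<inter> T}"
    by (rule openin_continuous_map_preimage)
  then have "openin (subtopology (mtop M) U) {x \<in> U. \<phi> x \<in> T}"
    unfolding is_chart_topspace(2)[OF assms(1)] by (rule back_subst[of "openin _"]) blast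
  then show ?thesis using assms(1) unfolding is_chart_def by (meson openin_trans_full)
qed

lemma is_chart_open_preimage_open:
  assumes "is_chart M U \<phi>" "open T"
  shows "openin (mtop M) {x \<in> U. \<phi> x \<in> T}"
proof -
  have "{x \<in> U. \<phi> x \<in> T} = {x \<in> U. \<phi> x \<in> model M \<inter> T}"
    using assms(1) openin_imp_subset unfolding is_chart_def by blast
  then show ?thesis
    using is_chart_open_preimage[OF assms(1), of "model M \<inter> T"] assms(2) by (simp add: openin_open_Int)
qed

lemma is_chart_inv:
  assumes "is_chart M U \<phi>" "x \<in> U"
  shows "inv_into U \<phi> (\<phi> x) = x"
  using is_chart_inj[OF assms(1)] assms(2) by simp

lemma is_chart_prod:
  assumes "is_chart M U \<phi>" "is_chart N V \<psi>"
  shows "is_chart (prod_manifold M N) (U \<times> V) (map_prod \<phi> \<psi>)"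
proof -
  obtain f g where
    "homeomorphic_maps (subtopology (mtop M) U) (top_of_set (\<phi> ` U)) \<phi> f"
    "homeomorphic_maps (subtopology (mtop N) V) (top_of_set (\<psi> ` V)) \<psi> g"
    using assms unfolding is_chart_def homeomorphic_map_maps by blast
  then have "homeomorphic_maps (prod_topology (subtopology (mtop M) U) (subtopology (mtop N) V))
      (prod_topology (top_of_set (\<phi> ` U)) (top_of_set (\<psi> ` V)))
      (\<lambda>(x, y). (\<phi> x, \<psi> y)) (\<lambda>(x, y). (f x, g y))"
    by (simp add: homeomorphic_maps_prod del: prod_topology_subtopology_eu)
  then have "homeomorphic_map (subtopology (prod_topology (mtop M) (mtop N)) (U \<times> V))
      (top_of_set (\<phi> ` U \<times> \<psi> ` V)) (map_prod \<phi> \<psi>)"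
    unfolding homeomorphic_map_maps map_prod_def prod_topology_subtopology_eu subtopology_Times by blast
  moreover have "openin (prod_topology (top_of_set (model M)) (top_of_set (model N))) (\<phi> ` U \<times> \<psi> ` V)"
    using assms unfolding is_chart_def openin_prod_Times_iff by blast
  moreover have "map_prod \<phi> \<psi> ` (U \<times> V) = \<phi> ` U \<times> \<psi> ` V" by auto
  ultimately show ?thesis
    using assms by (simp add: is_chart_def prod_manifold_def openin_prod_Times_iff)
qed

lemma smooth_on_imp_C1: "smooth_on E S f \<Longrightarrow> Ck_on (Suc 0) E S f"
  unfolding smooth_on_def by blast

lemma chart_locally_lipschitz:
  assumes c: "is_chart M U \<phi>" and V: "openin (mtop N) V" and E: "subspace (model M)"
    and f: "continuous_map (mtop M) (mtop N) f"
    and sm: "smooth_on (model M) (\<phi> ` {x \<in> U. f x \<in> V}) (\<psi> \<circ> f \<circ> inv_into U \<phi>)"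
    and p: "p \<in> U" "f p \<in> V"
  obtains W L where "openin (mtop M) W" "p \<in> W" "W \<subseteq> {x \<in> U. f x \<in> V}" "L > 0"
    "\<And>x y. x \<in> W \<Longrightarrow> y \<in> W \<Longrightarrow> norm (\<psi> (f x) - \<psi> (f y)) \<le> L * norm (\<phi> x - \<phi> y)"
proof -
  have D: "openin (mtop M) {x \<in> U. f x \<in> V}"
  proof -
    have "{x \<in> U. f x \<in> V} = U \<inter> {x \<in> topspace (mtop M). f x \<in> V}"
      using is_chart_topspace(1)[OF c] by blast
    then show ?thesis
      using openin_continuous_map_preimage[OF f V] c by (simp add: is_chart_def openin_Int)
  qed
  have S: "openin (top_of_set (model M)) (\<phi> ` {x \<in> U. f x \<in> V})"
    by (rule is_chart_open_image[OF c D]) auto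
  have pS: "\<phi> p \<in> \<phi> ` {x \<in> U. f x \<in> V}" using p by blast
  obtain \<epsilon> L where eL: "\<epsilon> > 0" "L > 0"
    "\<And>x y. x \<in> \<phi> ` {x \<in> U. f x \<in> V} \<inter> ball (\<phi> p) \<epsilon> \<Longrightarrow> y \<in> \<phi> ` {x \<in> U. f x \<in> V} \<inter> ball (\<phi> p) \<epsilon> \<Longrightarrow>
      norm ((\<psi> \<circ> f \<circ> inv_into U \<phi>) x - (\<psi> \<circ> f \<circ> inv_into U \<phi>) y) \<le> L * norm (x - y)"
    by (rule C1_locally_lipschitz[OF smooth_on_imp_C1[OF sm] S E pS]) blast
  define W where "W = {x \<in> U. f x \<in> V} \<inter> {x \<in> U. \<phi> x \<in> ball (\<phi> p) \<epsilon>}"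
  show thesis
  proof (rule that[of W L])
    show "openin (mtop M) W"
      unfolding W_def by (intro openin_Int D is_chart_open_preimage_open[OF c] open_ball)
    show "p \<in> W" using p eL by (simp add: W_def)
    show "norm (\<psi> (f x) - \<psi> (f y)) \<le> L * norm (\<phi> x - \<phi> y)" if "x \<in> W" "y \<in> W" for x y
      using eL(3)[of "\<phi> x" "\<phi> y"] that is_chart_inv[OF c] by (auto simp: W_def)
  qed (use eL in \<open>auto simp: W_def\<close>)
qed

text \<open>The neighbourhood is shrunk to a box, so that one variable can be held fixed while the
  other varies. It is applied to the group multiplication and to the actions on \<open>M\<close> and
  on the coset space.\<close>

lemma smooth_map2_locally_lipschitz:
  assumes M: "smooth_manifold M" and N: "smooth_manifold N" and K: "smooth_manifold K"
    and f: "smooth_map (prod_manifold M N) K (\<lambda>(x, y). f x y)"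
    and \<phi>: "(U, \<phi>) \<in> atlas M" and \<psi>: "(V, \<psi>) \<in> atlas N" and \<kappa>: "(Z, \<kappa>) \<in> atlas K"
    and p: "p \<in> U" "q \<in> V" "f p q \<in> Z"
  obtains A B L where "openin (mtop M) A" "p \<in> A" "A \<subseteq> U" "openin (mtop N) B" "q \<in> B" "B \<subseteq> V" "L > 0"
    "\<And>x y. x \<in> A \<Longrightarrow> y \<in> B \<Longrightarrow> f x y \<in> Z"
    "\<And>x y x' y'. x \<in> A \<Longrightarrow> x' \<in> A \<Longrightarrow> y \<in> B \<Longrightarrow> y' \<in> B \<Longrightarrow>
      norm (\<kappa> (f x y) - \<kappa> (f x' y')) \<le> L * norm ((\<phi> x, \<psi> y) - (\<phi> x', \<psi> y'))"
proof -
  have c: "is_chart (prod_manifold M N) (U \<times> V) (map_prod \<phi> \<psi>)"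
    by (intro is_chart_prod smooth_manifold_chart M N \<phi> \<psi>)
  have at: "(U \<times> V, map_prod \<phi> \<psi>) \<in> atlas (prod_manifold M N)"
    using \<phi> \<psi> by (auto simp: prod_manifold_def)
  have Z: "openin (mtop K) Z" using smooth_manifold_chart[OF K \<kappa>] by (simp add: is_chart_def)
  have E: "subspace (model (prod_manifold M N))"
    using M N by (simp add: prod_manifold_def smooth_manifold_def subspace_Times)
  have cont: "continuous_map (mtop (prod_manifold M N)) (mtop K) (\<lambda>(x, y). f x y)"
    and sm: "smooth_on (model (prod_manifold M N)) (map_prod \<phi> \<psi> ` {z \<in> U \<times> V. (\<lambda>(x, y). f x y) z \<in> Z})
      (\<kappa> \<circ> (\<lambda>(x, y). f x y) \<circ> inv_into (U \<times> V) (map_prod \<phi> \<psi>))"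
    using f at \<kappa> unfolding smooth_map_def by blast+
  have pq: "(p, q) \<in> U \<times> V" "(\<lambda>(x, y). f x y) (p, q) \<in> Z" using p by auto
  obtain W L where W: "openin (mtop (prod_manifold M N)) W" "(p, q) \<in> W"
    "W \<subseteq> {z \<in> U \<times> V. (\<lambda>(x, y). f x y) z \<in> Z}" "L > 0"
    "\<And>x y. x \<in> W \<Longrightarrow> y \<in> W \<Longrightarrow> norm (\<kappa> ((\<lambda>(x, y). f x y) x) - \<kappa> ((\<lambda>(x, y). f x y) y))
       \<le> L * norm (map_prod \<phi> \<psi> x - map_prod \<phi> \<psi> y)"
  proof (rule chart_locally_lipschitz[where f = "\<lambda>(x, y). f x y" and \<psi> = \<kappa>, OF c Z E cont sm pq], goal_cases)
    case prems: 1
    show ?case by (rule prems(1)) (fact prems(2-))+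
  qed
  have "openin (prod_topology (mtop M) (mtop N)) W" using W(1) by (simp add: prod_manifold_def)
  from openin_prod_topology_alt[THEN iffD1, OF this, rule_format, OF W(2)]
  obtain A B where AB: "openin (mtop M) A" "openin (mtop N) B" "p \<in> A" "q \<in> B" "A \<times> B \<subseteq> W"
    by auto
  have sub: "x \<in> U \<and> y \<in> V \<and> f x y \<in> Z" if "x \<in> A" "y \<in> B" for x y
  proof -
    have "(x, y) \<in> A \<times> B" using that by simp
    from subsetD[OF W(3) subsetD[OF AB(5) this]] show ?thesis by simp
  qed
  show thesis
  proof (rule that[of A B L])
    show "A \<subseteq> U" "B \<subseteq> V" using sub AB(3,4) by blast+
    show "f x y \<in> Z" if "x \<in> A" "y \<in> B" for x y using that sub by simp
    show "norm (\<kappa> (f x y) - \<kappa> (f x' y')) \<le> L * norm ((\<phi> x, \<psi> y) - (\<phi> x', \<psi> y'))"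
      if "x \<in> A" "x' \<in> A" "y \<in> B" "y' \<in> B" for x y x' y'
      using W(5)[of "(x, y)" "(x', y')"] that subsetD[OF AB(5)] by simp
  qed (use AB W in auto)
qed

text \<open>Differentiability of the orbit map is obtained from the jointly smooth action by
  freezing the coset at \<open>H\<close>. With \<open>0 \<in> F\<close> the directions
  \<open>(v, 0)\<close> are among those whose derivatives are known to be continuous.\<close>

lemma Ck_on_slice:
  fixes f :: "'e::euclidean_space \<times> 'f::euclidean_space \<Rightarrow> 'k::euclidean_space"
  assumes C1: "Ck_on (Suc 0) (E \<times> F) D f" and F: "0 \<in> F"
    and S: "\<And>x. x \<in> S \<Longrightarrow> (x, c) \<in> D"
  shows "Ck_on (Suc 0) E S (\<lambda>x. f (x, c))"
proof -
  obtain f' where f': "\<And>x. x \<in> D \<Longrightarrow> (f has_derivative f' x) (at x within D)"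
    and cont: "\<And>v. v \<in> E \<times> F \<Longrightarrow> continuous_on D (\<lambda>x. f' x v)"
    using C1 by auto
  have "((\<lambda>x. f (x, c)) has_derivative (\<lambda>v. f' (x, c) (v, 0))) (at x within S)" if "x \<in> S" for x
  proof -
    have 1: "((\<lambda>x. (x, c)) has_derivative (\<lambda>v. (v, 0))) (at x within S)"
      by (auto intro!: derivative_eq_intros)
    have 2: "(f has_derivative f' (x, c)) (at (x, c) within (\<lambda>x. (x, c)) ` S)"
      by (rule has_derivative_subset[OF f'[OF S[OF that]]]) (use S in auto)
    show ?thesis using diff_chain_within[OF 1 2] by (simp add: o_def)
  qed
  moreover have "continuous_on S (\<lambda>x. f' (x, c) (v, 0))" if "v \<in> E" for v
    by (rule continuous_on_compose2[OF cont, of "(v, 0)" S "\<lambda>x. (x, c)"])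
      (use that F S in \<open>auto intro!: continuous_intros\<close>)
  ultimately show ?thesis
    unfolding Ck_on.simps by (intro exI[of _ "\<lambda>x v. f' (x, c) (v, 0)"]) blast
qed

section \<open>Finsler metrics in charts\<close>

lemma C1_imp_continuous_on:
  assumes "Ck_on (Suc 0) E S f"
  shows "continuous_on S f"
proof -
  obtain f' where "\<And>x. x \<in> S \<Longrightarrow> (f has_derivative f' x) (at x within S)"
    using assms by auto
  then show ?thesis by (rule has_derivative_continuous_on)
qed

section \<open>Tangent vectors and their coordinates\<close>

definition chart_change :: "('a, 'e) chart \<Rightarrow> ('a, 'e) chart \<Rightarrow> 'e \<Rightarrow> 'e::euclidean_space" where
  "chart_change c c' = snd c' \<circ> inv_into (fst c) (snd c)"

definition chart_deriv :: "('a, 'e) chart \<Rightarrow> ('a, 'e) chart \<Rightarrow> 'a \<Rightarrow> 'e \<Rightarrow> 'e::euclidean_space" where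
  "chart_deriv c c' q = frechet_derivative (chart_change c c') (at (snd c q) within snd c ` (fst c \<inter> fst c'))"

text \<open>For \<open>q\<close> in the domain of \<open>c\<close>, the tangent vector with
  coordinates \<open>w\<close> in the chart \<open>c\<close>. The entries in other charts are forced
  by the transformation rule of \<open>tangent_space\<close>, as are the zeros at charts that miss
  \<open>q\<close>.\<close>

definition chart_vec ::
  "('a, 'e::euclidean_space) manifold \<Rightarrow> ('a, 'e) chart \<Rightarrow> 'a \<Rightarrow> 'e \<Rightarrow> ('a, 'e) tvec" where
  "chart_vec M c q w = (\<lambda>c'. if c' \<in> atlas M \<and> q \<in> fst c' then chart_deriv c c' q w else 0)"

context
  fixes M :: "('a, 'e::euclidean_space) manifold"
  assumes M: "smooth_manifold M"
begin

lemma atlas_chart: "c \<in> atlas M \<Longrightarrow> is_chart M (fst c) (snd c)"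
  using smooth_manifold_chart[OF M, of "fst c" "snd c"] by simp

lemma atlas_open: "c \<in> atlas M \<Longrightarrow> openin (mtop M) (fst c)"
  using atlas_chart[of c] by (simp add: is_chart_def)

lemma subspace_model: "subspace (model M)"
  using M by (simp add: smooth_manifold_def)

lemma chart_in_model: "c \<in> atlas M \<Longrightarrow> q \<in> fst c \<Longrightarrow> snd c q \<in> model M"
  using atlas_chart[of c] openin_imp_subset unfolding is_chart_def by blast

lemma openin_chart_overlap:
  assumes "c \<in> atlas M" "c' \<in> atlas M"
  shows "openin (top_of_set (model M)) (snd c ` (fst c \<inter> fst c'))"
  using assms by (intro is_chart_open_image[OF atlas_chart] openin_Int atlas_open) auto

lemma chart_change_eq:
  assumes "c \<in> atlas M" "q \<in> fst c"
  shows "chart_change c c' (snd c q) = snd c' q"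
  using is_chart_inv[OF atlas_chart] assms by (simp add: chart_change_def)

lemma chart_change_C1:
  assumes "c \<in> atlas M" "c' \<in> atlas M"
  shows "Ck_on (Suc 0) (model M) (snd c ` (fst c \<inter> fst c')) (chart_change c c')"
  using M assms unfolding smooth_manifold_def chart_change_def
  by (intro smooth_on_imp_C1) (force simp: case_prod_beta)

lemma chart_change_has_derivative:
  assumes "c \<in> atlas M" "c' \<in> atlas M" "q \<in> fst c" "q \<in> fst c'"
  shows "(chart_change c c' has_derivative chart_deriv c c' q) (at (snd c q) within snd c ` (fst c \<inter> fst c'))"
proof -
  obtain D :: "'e \<Rightarrow> 'e \<Rightarrow>\<^sub>L 'e" where
    "\<And>x. x \<in> snd c ` (fst c \<inter> fst c') \<Longrightarrow>
      (chart_change c c' has_derivative blinfun_apply (D x)) (at x within snd c ` (fst c \<inter> fst c'))"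
    using C1_derivative_within[OF chart_change_C1[OF assms(1,2)] openin_chart_overlap[OF assms(1,2)] subspace_model]
    by metis
  then have "chart_change c c' differentiable (at (snd c q) within snd c ` (fst c \<inter> fst c'))"
    using assms(3,4) unfolding differentiable_def by blast
  then show ?thesis
    unfolding chart_deriv_def using frechet_derivative_works by blast
qed

text \<open>\<open>frechet_derivative\<close> within a subset of a proper subspace is an arbitrary
  choice off the model. Along the model it agrees with any derivative taken within a smaller
  relatively open set.\<close>

lemma chart_deriv_unique:
  assumes "c \<in> atlas M" "c' \<in> atlas M" "q \<in> fst c" "q \<in> fst c'" "w \<in> model M"
    and "(chart_change c c' has_derivative f') (at (snd c q) within S)"
    and "openin (top_of_set (model M)) S" "snd c q \<in> S" "S \<subseteq> snd c ` (fst c \<inter> fst c')"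
  shows "chart_deriv c c' q w = f' w"
  by (rule has_derivative_within_subspace_unique[OF has_derivative_subset[OF chart_change_has_derivative[OF assms(1-4)] assms(9)]
        assms(6,7,8) subspace_model assms(5)])

text \<open>The coordinate change takes values in the model, so a projection \<open>P\<close> onto
  the model leaves it unchanged; by uniqueness \<open>P\<close> also fixes its derivative along the
  model.\<close>

lemma chart_deriv_in_model:
  assumes "c \<in> atlas M" "c' \<in> atlas M" "q \<in> fst c" "q \<in> fst c'" "w \<in> model M"
  shows "chart_deriv c c' q w \<in> model M"
proof -
  obtain P :: "'e \<Rightarrow> 'e" where P: "linear P" "\<And>v. P v \<in> model M" "\<And>v. v \<in> model M \<Longrightarrow> P v = v"
    by (rule linear_projection_exists[OF subspace_model]) blast
  let ?S = "snd c ` (fst c \<inter> fst c')"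
  have "bounded_linear P" using P(1) by (simp add: linear_linear)
  then have "((\<lambda>x. P (chart_change c c' x)) has_derivative (\<lambda>v. P (chart_deriv c c' q v))) (at (snd c q) within ?S)"
    by (rule bounded_linear.has_derivative[OF _ chart_change_has_derivative[OF assms(1-4)]])
  then have "(chart_change c c' has_derivative (\<lambda>v. P (chart_deriv c c' q v))) (at (snd c q) within ?S)"
    by (rule has_derivative_transform[rotated 2])
      (use assms P(3) chart_in_model[OF assms(2)] chart_change_eq[OF assms(1), of _ c'] in auto)
  then have "chart_deriv c c' q w = P (chart_deriv c c' q w)"
    using assms by (intro chart_deriv_unique[of c c' q w _ ?S] openin_chart_overlap) auto
  then show ?thesis using P(2) by metis
qed

text \<open>The chain rule on the triple overlap, followed by uniqueness there.\<close>

lemma chart_deriv_cocycle: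
  assumes c: "c \<in> atlas M" "c' \<in> atlas M" "c'' \<in> atlas M" and q: "q \<in> fst c" "q \<in> fst c'" "q \<in> fst c''"
    and w: "w \<in> model M"
  shows "chart_deriv c' c'' q (chart_deriv c c' q w) = chart_deriv c c'' q w"
proof -
  let ?S = "snd c ` (fst c \<inter> fst c' \<inter> fst c'')"
  have S: "openin (top_of_set (model M)) ?S"
    using c by (intro is_chart_open_image[OF atlas_chart] openin_Int atlas_open) auto
  have 1: "(chart_change c c' has_derivative chart_deriv c c' q) (at (snd c q) within ?S)"
    by (rule has_derivative_subset[OF chart_change_has_derivative]) (use assms in auto)
  have "chart_change c c' ` ?S \<subseteq> snd c' ` (fst c' \<inter> fst c'')"
    using chart_change_eq[OF c(1), of _ c'] by auto
  moreover have eq: "chart_change c c' (snd c q) = snd c' q" by (rule chart_change_eq[OF c(1) q(1)])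
  ultimately have 2: "(chart_change c' c'' has_derivative chart_deriv c' c'' q)
      (at (chart_change c c' (snd c q)) within chart_change c c' ` ?S)"
    using has_derivative_subset[OF chart_change_has_derivative[OF c(2,3) q(2,3)]] by simp
  have "(chart_change c c'' has_derivative chart_deriv c' c'' q \<circ> chart_deriv c c' q) (at (snd c q) within ?S)"
    by (rule has_derivative_transform[OF _ _ diff_chain_within[OF 1 2]])
      (use q chart_change_eq[OF c(1), of _ c'] chart_change_eq[OF c(1), of _ c''] chart_change_eq[OF c(2), of _ c''] in auto)
  then show ?thesis
    using assms S by (subst chart_deriv_unique[of c c'' q w _ ?S]) (auto simp: o_def)
qed

lemma chart_vec_tangent:
  assumes "c \<in> atlas M" "q \<in> fst c" "w \<in> model M"
  shows "chart_vec M c q w \<in> tangent_space M q"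
proof -
  have entry: "if c' \<in> atlas M \<and> q \<in> fst c' then chart_vec M c q w c' \<in> model M else chart_vec M c q w c' = 0" for c'
    using chart_deriv_in_model[OF assms(1) _ assms(2) _ assms(3), of c'] by (simp add: chart_vec_def)
  have change: "chart_vec M c q w (V, \<psi>) =
      frechet_derivative (\<psi> \<circ> inv_into U \<phi>) (at (\<phi> q) within \<phi> ` (U \<inter> V)) (chart_vec M c q w (U, \<phi>))"
    if "(U, \<phi>) \<in> atlas M" "(V, \<psi>) \<in> atlas M" "q \<in> U \<inter> V" for U \<phi> V \<psi>
    using chart_deriv_cocycle[OF assms(1) that(1,2) assms(2) _ _ assms(3)] that
    by (simp add: chart_vec_def chart_deriv_def[of "(U, \<phi>)"] chart_change_def[of "(U, \<phi>)"])
  show ?thesis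
    unfolding tangent_space_def using entry change by (intro CollectI conjI) blast+
qed

lemma chart_vec_linear:
  assumes "c \<in> atlas M" "q \<in> fst c"
  shows "chart_vec M c q (r *\<^sub>R w) = (\<lambda>c'. r *\<^sub>R chart_vec M c q w c')"
  using linear_scale[OF has_derivative_linear[OF chart_change_has_derivative[OF assms(1) _ assms(2)]]]
  by (auto simp: chart_vec_def)

text \<open>Joint continuity in the point and the vector requires operator norm continuity of the
  derivative; the chosen \<open>chart_deriv\<close> is replaced by such a continuous
  \<open>D\<close>, with which it agrees on the model.\<close>

lemma chart_deriv_continuous:
  assumes "c \<in> atlas M" "c' \<in> atlas M"
  shows "continuous_on (snd c ` (fst c \<inter> fst c') \<times> model M)
    (\<lambda>(x, w). chart_deriv c c' (inv_into (fst c) (snd c) x) w)"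
proof -
  let ?S = "snd c ` (fst c \<inter> fst c')"
  obtain D :: "'e \<Rightarrow> 'e \<Rightarrow>\<^sub>L 'e" where D: "continuous_on ?S D"
    "\<And>x. x \<in> ?S \<Longrightarrow> (chart_change c c' has_derivative blinfun_apply (D x)) (at x within ?S)"
    using C1_derivative_within[OF chart_change_C1[OF assms] openin_chart_overlap[OF assms] subspace_model]
    by metis
  have "continuous_on (?S \<times> model M) (\<lambda>z. blinfun_apply (D (fst z)) (snd z))"
    by (intro continuous_intros continuous_on_compose2[OF D(1)]) auto
  moreover have "blinfun_apply (D (fst z)) (snd z) = chart_deriv c c' (inv_into (fst c) (snd c) (fst z)) (snd z)"
    if z: "z \<in> ?S \<times> model M" for z
  proof -
    obtain q w where q: "q \<in> fst c" "q \<in> fst c'" "z = (snd c q, w)" "w \<in> model M" using z by auto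
    have "chart_deriv c c' q w = D (snd c q) w"
      by (rule chart_deriv_unique[OF assms q(1,2,4) D(2) openin_chart_overlap[OF assms]]) (use q in auto)
    then show ?thesis using is_chart_inv[OF atlas_chart[OF assms(1)] q(1)] q by simp
  qed
  ultimately show ?thesis
    unfolding case_prod_beta by (subst continuous_on_cong[OF refl]) auto
qed

text \<open>The inverse of a bundle trivialization. It makes a Finsler metric a continuous function
  of coordinates, to which compactness arguments apply. The topology being generated by sets, it
  suffices to look at preimages of generators.\<close>

lemma chart_vec_continuous:
  assumes c: "c \<in> atlas M"
  shows "continuous_map (top_of_set (snd c ` fst c \<times> model M)) (tangent_topology M)
    (\<lambda>(x, w). (inv_into (fst c) (snd c) x, chart_vec M c (inv_into (fst c) (snd c) x) w))"
    (is "continuous_map ?T _ ?h")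
proof -
  have h: "?h (snd c q, w) = (q, chart_vec M c q w)" if "q \<in> fst c" for q w
    using is_chart_inv[OF atlas_chart[OF c] that] by simp
  have in_bundle: "(q, chart_vec M c q w) \<in> tangent_bundle M" if "q \<in> fst c" "w \<in> model M" for q w
    using chart_vec_tangent[OF c that] is_chart_topspace(1)[OF atlas_chart[OF c]] that
    by (auto simp: tangent_bundle_def)
  show ?thesis
    unfolding tangent_topology_def
  proof (rule continuous_on_generated_topo)
    fix B assume "B \<in> {{(p, v) \<in> tangent_bundle M. p \<in> U \<and> (\<phi> p, v (U, \<phi>)) \<in> W} | U \<phi> W.
        (U, \<phi>) \<in> atlas M \<and> open W}"
    then obtain U \<phi> W where c': "(U, \<phi>) \<in> atlas M" and W: "open W"
      and B: "B = {(p, v) \<in> tangent_bundle M. p \<in> U \<and> (\<phi> p, v (U, \<phi>)) \<in> W}" by blast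
    define c' where "c' = (U, \<phi>)"
    let ?S = "snd c ` (fst c \<inter> U)"
    \<comment> \<open>\<open>?g\<close> is \<open>?h\<close> read in the chart \<open>c'\<close>:
      the pair of coordinates that the generator \<open>B\<close> tests against
      \<open>W\<close>.\<close>
    let ?g = "\<lambda>z. (chart_change c c' (fst z), (\<lambda>(x, w). chart_deriv c c' (inv_into (fst c) (snd c) x) w) z)"
    have g: "?g (snd c q, w) = (\<phi> q, chart_vec M c q w (U, \<phi>))" if "q \<in> fst c" "q \<in> U" for q w
      using chart_change_eq[OF c that(1)] is_chart_inv[OF atlas_chart[OF c] that(1)] that c'
      by (simp add: c'_def chart_vec_def)
    have "continuous_on ?S (chart_change c c')"
      using C1_imp_continuous_on[OF chart_change_C1[OF c, of c']] c' by (simp add: c'_def)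
    then have "continuous_on (?S \<times> model M) (\<lambda>z. chart_change c c' (fst z))"
      by (rule continuous_on_compose2) (auto intro: continuous_intros)
    then have "continuous_on (?S \<times> model M) ?g"
      using chart_deriv_continuous[OF c, of c'] c'
      by (intro continuous_on_Pair) (simp_all add: c'_def)
    then have "openin (top_of_set (?S \<times> model M)) ((?S \<times> model M) \<inter> ?g -` W)"
      using W continuous_openin_preimage_gen by blast
    moreover have "openin ?T (?S \<times> model M)"
    proof -
      have "openin (top_of_set (model M)) ?S"
        using openin_chart_overlap[OF c c'] by simp
      then have "openin (top_of_set (snd c ` fst c)) ?S"
        using openin_subset_trans chart_in_model[OF c] by blast
      then show ?thesis
        using openin_Times[of "snd c ` fst c" ?S "model M" "model M"] by simp
    qed
    ultimately have "openin ?T ((?S \<times> model M) \<inter> ?g -` W)"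
      using openin_trans by blast
    moreover have "(?S \<times> model M) \<inter> ?g -` W = ?h -` B \<inter> topspace ?T" (is "?l = ?r")
    proof (rule Set.set_eqI)
      fix z
      show "z \<in> ?l \<longleftrightarrow> z \<in> ?r"
      proof (cases "z \<in> snd c ` fst c \<times> model M")
        case True
        then obtain q w where q: "q \<in> fst c" "z = (snd c q, w)" "w \<in> model M" by auto
        have "snd c q \<in> ?S \<longleftrightarrow> q \<in> U"
          using is_chart_inj[OF atlas_chart[OF c]] q by (auto simp: inj_on_def)
        then have "z \<in> ?l \<longleftrightarrow> q \<in> U \<and> ?g (snd c q, w) \<in> W" using q by auto
        also have "\<dots> \<longleftrightarrow> q \<in> U \<and> (\<phi> q, chart_vec M c q w (U, \<phi>)) \<in> W" using g[OF q(1)] by auto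
        also have "\<dots> \<longleftrightarrow> (q, chart_vec M c q w) \<in> B" using in_bundle[OF q(1,3)] by (simp add: B)
        also have "\<dots> \<longleftrightarrow> z \<in> ?r" using True h[OF q(1), of w] unfolding q(2) by simp
        finally show ?thesis .
      qed auto
    qed
    ultimately show "openin ?T (?h -` B \<inter> topspace ?T)" by simp
  next
    show "?h ` topspace ?T \<subseteq> \<Union> {{(p, v) \<in> tangent_bundle M. p \<in> U \<and> (\<phi> p, v (U, \<phi>)) \<in> W} | U \<phi> W.
        (U, \<phi>) \<in> atlas M \<and> open W}" (is "_ \<subseteq> \<Union> ?B")
    proof
      fix y assume "y \<in> ?h ` topspace ?T"
      then obtain q w where q: "q \<in> fst c" "w \<in> model M" "y = ?h (snd c q, w)" by auto
      then have "y \<in> {(p, v) \<in> tangent_bundle M. p \<in> fst c \<and> (snd c p, v (fst c, snd c)) \<in> UNIV}"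
        using h[OF q(1), of w] in_bundle[OF q(1,2)] by simp
      moreover have "{(p, v) \<in> tangent_bundle M. p \<in> fst c \<and> (snd c p, v (fst c, snd c)) \<in> UNIV} \<in> ?B"
        using c by (intro CollectI exI[of _ "fst c"] exI[of _ "snd c"] exI[of _ UNIV] conjI refl) auto
      ultimately show "y \<in> \<Union> ?B" by (rule UnionI[rotated])
    qed
  qed
qed

end

section \<open>Finsler length of straight segments in a chart\<close>

lemma is_chart_inv_continuous:
  assumes "is_chart M U \<phi>"
  shows "continuous_map (top_of_set (\<phi> ` U)) (mtop M) (inv_into U \<phi>)"
  unfolding continuous_map_def
proof (intro conjI allI impI)
  show "inv_into U \<phi> \<in> topspace (top_of_set (\<phi> ` U)) \<rightarrow> topspace (mtop M)"
    using is_chart_topspace(1)[OF assms] inv_into_into[of _ \<phi> U] by auto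
  fix W assume W: "openin (mtop M) W"
  have "openin (mtop M) (U \<inter> W)" using assms W by (simp add: is_chart_def openin_Int)
  then have "openin (top_of_set (model M)) (\<phi> ` (U \<inter> W))" by (rule is_chart_open_image[OF assms]) simp
  moreover have "\<phi> ` U \<subseteq> model M" using assms openin_imp_subset unfolding is_chart_def by blast
  ultimately have "openin (top_of_set (\<phi> ` U)) (\<phi> ` (U \<inter> W))"
    by (meson openin_subset_trans image_mono inf_le1)
  also have "\<phi> ` (U \<inter> W) = {x \<in> topspace (top_of_set (\<phi> ` U)). inv_into U \<phi> x \<in> W}"
    using is_chart_inv[OF assms] by auto
  finally show "openin (top_of_set (\<phi> ` U)) {x \<in> topspace (top_of_set (\<phi> ` U)). inv_into U \<phi> x \<in> W}" .
qed

context
  fixes M :: "('a, 'e::euclidean_space) manifold" and c :: "('a, 'e) chart" and x y :: 'e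
    and \<gamma> :: "real \<Rightarrow> 'a"
  assumes M: "smooth_manifold M" and c: "c \<in> atlas M" and x: "x \<in> model M" and y: "y \<in> model M"
  defines "\<gamma> \<equiv> \<lambda>t. inv_into (fst c) (snd c) (x + t *\<^sub>R (y - x))"
begin

lemma line_in_model: "x + t *\<^sub>R (y - x) \<in> model M"
  by (intro subspace_add subspace_scale subspace_diff subspace_model[OF M] x y)

lemma chart_line:
  assumes "x + t *\<^sub>R (y - x) \<in> snd c ` fst c"
  shows "\<gamma> t \<in> fst c" "snd c (\<gamma> t) = x + t *\<^sub>R (y - x)"
  using assms by (auto simp: \<gamma>_def inv_into_into f_inv_into_f)

text \<open>Chart images are relatively open and the whole line lies in the model, so it stays in
  the overlap for parameters near \<open>t\<close>. The derivative is therefore two-sided, as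
  \<open>velocity\<close> requires, also at the ends of the segment.\<close>

lemma segment_has_vector_derivative:
  assumes t: "x + t *\<^sub>R (y - x) \<in> snd c ` fst c" and c': "c' \<in> atlas M" "\<gamma> t \<in> fst c'"
  shows "(snd c' \<circ> \<gamma> has_vector_derivative chart_deriv c c' (\<gamma> t) (y - x)) (at t)"
proof -
  let ?S = "snd c ` (fst c \<inter> fst c')" and ?l = "\<lambda>t. x + t *\<^sub>R (y - x)"
  obtain O' where O': "open O'" "?S = model M \<inter> O'"
    using openin_chart_overlap[OF M c c'(1)] by (auto simp: openin_open)
  define T where "T = ?l -` O'"
  have T: "open T" unfolding T_def by (intro open_vimage O' continuous_intros)
  have lS: "?l ` T \<subseteq> ?S" using line_in_model by (auto simp: T_def O'(2))
  have eq: "snd c (\<gamma> t) = ?l t" by (rule chart_line[OF t])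
  then have "?l t \<in> ?S" using chart_line(1)[OF t] c'(2) by (metis IntI image_eqI)
  then have tT: "t \<in> T" by (auto simp: T_def O'(2))
  have 1: "(?l has_derivative (\<lambda>h. h *\<^sub>R (y - x))) (at t within T)"
    by (auto intro!: derivative_eq_intros)
  have deriv: "(chart_change c c' has_derivative chart_deriv c c' (\<gamma> t)) (at (?l t) within ?S)"
    using chart_change_has_derivative[OF M c c'(1) chart_line(1)[OF t] c'(2)] by (simp add: eq)
  have 2: "(chart_change c c' has_derivative chart_deriv c c' (\<gamma> t)) (at (?l t) within ?l ` T)"
    by (rule has_derivative_subset[OF deriv lS])
  have "(chart_change c c' \<circ> ?l has_derivative chart_deriv c c' (\<gamma> t) \<circ> (\<lambda>h. h *\<^sub>R (y - x))) (at t)"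
    using diff_chain_within[OF 1 2] at_within_open[OF tT T] by simp
  moreover have "chart_change c c' \<circ> ?l = snd c' \<circ> \<gamma>"
    by (simp add: chart_change_def \<gamma>_def fun_eq_iff)
  moreover have "chart_deriv c c' (\<gamma> t) \<circ> (\<lambda>h. h *\<^sub>R (y - x)) = (\<lambda>h. h *\<^sub>R chart_deriv c c' (\<gamma> t) (y - x))"
    using linear_scale[OF has_derivative_linear[OF deriv]] by (simp add: fun_eq_iff)
  ultimately show ?thesis by (simp add: has_vector_derivative_def)
qed

lemma segment_velocity:
  assumes t: "x + t *\<^sub>R (y - x) \<in> snd c ` fst c"
  shows "velocity M \<gamma> t = (\<gamma> t, chart_vec M c (\<gamma> t) (y - x))"
  using vector_derivative_at[OF segment_has_vector_derivative[OF t]]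
  by (auto simp: velocity_def chart_vec_def)

context
  assumes seg: "\<And>t. t \<in> {0..1} \<Longrightarrow> x + t *\<^sub>R (y - x) \<in> snd c ` fst c"
begin

lemma segment_piecewise_C1: "piecewise_C1_path M 0 1 \<gamma>"
proof -
  let ?l = "\<lambda>t. x + t *\<^sub>R (y - x)"
  have "continuous_map (top_of_set {0..1}) (top_of_set (snd c ` fst c)) ?l"
    using seg by (auto intro!: continuous_intros)
  then have "continuous_map (top_of_set {0..1}) (mtop M) (inv_into (fst c) (snd c) \<circ> ?l)"
    by (rule continuous_map_compose[OF _ is_chart_inv_continuous[OF atlas_chart[OF M c]]])
  then have cont: "continuous_map (top_of_set {0..1}) (mtop M) \<gamma>"
    by (simp add: \<gamma>_def o_def)
  have "\<exists>\<gamma>'. continuous_on {t \<in> {0..1}. \<gamma> t \<in> U} \<gamma>' \<and>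
        (\<forall>t\<in>{0..1}. \<gamma> t \<in> U \<longrightarrow> (\<phi> \<circ> \<gamma> has_vector_derivative \<gamma>' t) (at t within {0..1}))"
    if U: "(U, \<phi>) \<in> atlas M" for U \<phi>
  proof (intro exI conjI ballI impI)
    let ?c = "(U, \<phi>)"
    show "(\<phi> \<circ> \<gamma> has_vector_derivative chart_deriv c ?c (\<gamma> t) (y - x)) (at t within {0..1})"
      if "t \<in> {0..1}" "\<gamma> t \<in> U" for t
      using segment_has_vector_derivative[OF seg[OF that(1)] U] that
      by (auto intro: has_vector_derivative_at_within)
    have "continuous_on {t \<in> {0..1}. \<gamma> t \<in> U} (\<lambda>t. (?l t, y - x))"
      by (intro continuous_intros)
    moreover have "(?l t, y - x) \<in> snd c ` (fst c \<inter> fst ?c) \<times> model M" if "t \<in> {t \<in> {0..1}. \<gamma> t \<in> U}" for t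
      using chart_line[OF seg, of t] that subspace_diff[OF subspace_model[OF M] y x]
      by (auto intro!: image_eqI[of _ _ "\<gamma> t"])
    ultimately have "continuous_on {t \<in> {0..1}. \<gamma> t \<in> U}
        (\<lambda>t. (\<lambda>(x, w). chart_deriv c ?c (inv_into (fst c) (snd c) x) w) (?l t, y - x))"
      by (intro continuous_on_compose2[OF chart_deriv_continuous[OF M c U]]) auto
    then show "continuous_on {t \<in> {0..1}. \<gamma> t \<in> U} (\<lambda>t. chart_deriv c ?c (\<gamma> t) (y - x))"
      by (simp add: \<gamma>_def)
  qed
  then have "C1_path_on M 0 1 \<gamma>"
    using cont by (auto simp: C1_path_on_def)
  moreover have "interval_partition 0 1 1 real" by (simp add: interval_partition_def)
  ultimately show ?thesis
    using cont unfolding piecewise_C1_path_def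
    by (intro conjI exI[of _ 1] exI[of _ real]) auto
qed

lemma finsler_dist_segment_le:
  assumes F: "finsler_metric M F"
    and B: "\<And>t. t \<in> {0..1} \<Longrightarrow> F (\<gamma> t, chart_vec M c (\<gamma> t) (y - x)) \<le> B"
  shows "finsler_dist M F (\<gamma> 0) (\<gamma> 1) \<le> ereal B"
proof -
  have "F (\<gamma> 0, chart_vec M c (\<gamma> 0) (y - x)) \<ge> 0"
  proof -
    have "\<gamma> 0 \<in> fst c" using chart_line(1)[OF seg, of 0] by simp
    then show ?thesis
      using F chart_vec_tangent[OF M c, of "\<gamma> 0" "y - x"] subspace_diff[OF subspace_model[OF M] y x]
        is_chart_topspace(1)[OF atlas_chart[OF M c]]
      unfolding finsler_metric_def by blast
  qed
  then have "0 \<le> B" using B[of 0] by simp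
  \<comment> \<open>If the speed is not integrable, its integral is 0 by convention, which
    \<open>0 \<le> B\<close> covers.\<close>
  have "integral {0..1} (\<lambda>t. F (velocity M \<gamma> t)) \<le> B"
  proof (cases "(\<lambda>t. F (velocity M \<gamma> t)) integrable_on {0..1}")
    case True
    then have "integral {0..1} (\<lambda>t. F (velocity M \<gamma> t)) \<le> integral {0..1} (\<lambda>t::real. B)"
      by (rule integral_le) (use B segment_velocity[OF seg] in auto)
    then show ?thesis by simp
  next
    case False
    then show ?thesis using \<open>0 \<le> B\<close> by (simp add: not_integrable_integral)
  qed
  then have "ereal (integral {0..1} (\<lambda>t. F (velocity M \<gamma> t))) \<le> ereal B" by simp
  moreover have "finsler_dist M F (\<gamma> 0) (\<gamma> 1) \<le> ereal (integral {0..1} (\<lambda>t. F (velocity M \<gamma> t)))"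
    unfolding finsler_dist_def using segment_piecewise_C1 by (intro Inf_lower) blast
  ultimately show ?thesis by (rule order_trans[rotated])
qed

end
end

text \<open>Continuity bounds \<open>F\<close> on a compact ball times the unit sphere of the model,
  and homogeneity extends the bound to all vectors. The case \<open>w = 0\<close> stands apart; for
  a model of dimension 0 the sphere is empty and this is the only case.\<close>

lemma finsler_chart_bound:
  fixes M :: "('a, 'e::euclidean_space) manifold"
  assumes M: "smooth_manifold M" and F: "finsler_metric M F" and c: "c \<in> atlas M" and p: "p \<in> fst c"
  obtains r B where "r > 0" "model M \<inter> ball (snd c p) r \<subseteq> snd c ` fst c" "B \<ge> 0"
    "\<And>q w. q \<in> fst c \<Longrightarrow> snd c q \<in> ball (snd c p) r \<Longrightarrow> w \<in> model M \<Longrightarrow> F (q, chart_vec M c q w) \<le> B * norm w"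
proof -
  let ?E = "model M"
  let ?h = "\<lambda>(x, w). (inv_into (fst c) (snd c) x, chart_vec M c (inv_into (fst c) (snd c) x) w)"
  have E: "subspace ?E" by (rule subspace_model[OF M])
  have "openin (top_of_set ?E) (snd c ` fst c)"
    using atlas_chart[OF M c] by (simp add: is_chart_def)
  then obtain r where r: "r > 0" "?E \<inter> cball (snd c p) r \<subseteq> snd c ` fst c"
    using p unfolding openin_contains_cball by blast
  define K where "K = (?E \<inter> cball (snd c p) r) \<times> (?E \<inter> sphere 0 1)"
  define H where "H = F \<circ> ?h"
  have "continuous_map (top_of_set (snd c ` fst c \<times> ?E)) euclideanreal H"
    unfolding H_def using F chart_vec_continuous[OF M c] unfolding finsler_metric_def by (blast intro: continuous_map_compose)
  then have "continuous_on (snd c ` fst c \<times> ?E) H" by simp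
  then have "continuous_on K H"
    by (rule continuous_on_subset) (use r in \<open>auto simp: K_def\<close>)
  moreover have "compact K"
    unfolding K_def using closed_subspace[OF E] by (intro compact_Times closed_Int_compact) auto
  ultimately have "bounded (H ` K)"
    by (intro compact_imp_bounded compact_continuous_image)
  then obtain B where B: "B > 0" "\<And>z. z \<in> K \<Longrightarrow> \<bar>H z\<bar> \<le> B"
    unfolding bounded_pos by auto
  show thesis
  proof (rule that[of r B])
    show "?E \<inter> ball (snd c p) r \<subseteq> snd c ` fst c" using r(2) by auto
    fix q w assume q: "q \<in> fst c" "snd c q \<in> ball (snd c p) r" and w: "w \<in> ?E"
    have top: "q \<in> topspace (mtop M)" using is_chart_topspace(1)[OF atlas_chart[OF M c]] q by blast
    show "F (q, chart_vec M c q w) \<le> B * norm w"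
    proof (cases "w = 0")
      case True
      have "chart_vec M c q 0 = (\<lambda>c'. 0)"
        using chart_vec_linear[OF M c q(1), of 0 0] by simp
      moreover have "chart_vec M c q 0 \<in> tangent_space M q"
        using chart_vec_tangent[OF M c q(1)] subspace_0[OF E] by blast
      ultimately show ?thesis using True F top unfolding finsler_metric_def by force
    next
      case False
      define u where "u = (1 / norm w) *\<^sub>R w"
      have u: "u \<in> ?E" "norm u = 1" "w = norm w *\<^sub>R u"
        using False w E by (auto simp: u_def subspace_scale)
      have "(snd c q, u) \<in> K" using q u chart_in_model[OF M c q(1)] by (auto simp: K_def)
      then have "F (q, chart_vec M c q u) \<le> B"
        using B(2)[of "(snd c q, u)"] is_chart_inv[OF atlas_chart[OF M c] q(1)] by (simp add: H_def)
      moreover have "F (q, chart_vec M c q w) = norm w * F (q, chart_vec M c q u)"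
      proof -
        have "chart_vec M c q w = (\<lambda>c'. norm w *\<^sub>R chart_vec M c q u c')"
          using chart_vec_linear[OF M c q(1), of "norm w" u] u(3) by simp
        moreover have "F (q, \<lambda>c'. norm w *\<^sub>R chart_vec M c q u c') = \<bar>norm w\<bar> * F (q, chart_vec M c q u)"
          using F top chart_vec_tangent[OF M c q(1) u(1)] unfolding finsler_metric_def by blast
        ultimately show ?thesis by simp
      qed
      ultimately show ?thesis by (metis mult.commute mult_left_mono norm_ge_zero)
    qed
  qed (use r B in auto)
qed

text \<open>On \<open>V\<close> a multiple of \<open>d\<close> lies below the Finsler distance, and
  this in turn below the length of the straight coordinate segment. Convexity of the coordinate ball
  keeps the segment where \<open>F\<close> is bounded; only its end points have to lie in
  \<open>V\<close>.\<close>

lemma locally_finsler_chart_lipschitz: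
  fixes M :: "('a, 'e::euclidean_space) manifold"
  assumes M: "smooth_manifold M" and d: "d \<in> locally_finsler_metrics M"
    and c: "(U, \<phi>) \<in> atlas M" and p: "p \<in> U"
  obtains W L where "openin (mtop M) W" "p \<in> W" "W \<subseteq> U" "L > 0"
    "\<And>x y. x \<in> W \<Longrightarrow> y \<in> W \<Longrightarrow> d x y \<le> L * norm (\<phi> x - \<phi> y)"
proof -
  let ?c = "(U, \<phi>)"
  have pM: "p \<in> topspace (mtop M)" using is_chart_topspace(1)[OF smooth_manifold_chart[OF M c]] p by blast
  obtain F where F: "finsler_metric M F" and
    "\<forall>p\<in>topspace (mtop M). \<exists>V. openin (mtop M) V \<and> p \<in> V \<and>
               (\<exists>c>0. \<exists>C>0. \<forall>x\<in>V. \<forall>y\<in>V.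
                  ereal (c * d x y) \<le> finsler_dist M F x y \<and>
                  finsler_dist M F x y \<le> ereal (C * d x y))"
    using d unfolding locally_finsler_metrics_def by blast
  then obtain V k where V: "openin (mtop M) V" "p \<in> V" "k > 0"
    "\<And>x y. x \<in> V \<Longrightarrow> y \<in> V \<Longrightarrow> ereal (k * d x y) \<le> finsler_dist M F x y"
    using pM by meson
  have pc: "p \<in> fst ?c" using p by simp
  obtain r B where r: "r > 0" "model M \<inter> ball (\<phi> p) r \<subseteq> \<phi> ` U" and B: "B \<ge> 0"
    "\<And>q w. q \<in> U \<Longrightarrow> \<phi> q \<in> ball (\<phi> p) r \<Longrightarrow> w \<in> model M \<Longrightarrow> F (q, chart_vec M ?c q w) \<le> B * norm w"
    by (rule finsler_chart_bound[OF M F c pc]) auto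
  define W where "W = V \<inter> {q \<in> U. \<phi> q \<in> ball (\<phi> p) r}"
  have ch: "is_chart M U \<phi>" by (rule smooth_manifold_chart[OF M c])
  have bound: "d a b \<le> B / k * norm (\<phi> a - \<phi> b)" if ab: "a \<in> W" "b \<in> W" for a b
  proof -
    define x y where "x = \<phi> a" and "y = \<phi> b"
    have xy: "x \<in> model M \<inter> ball (\<phi> p) r" "y \<in> model M \<inter> ball (\<phi> p) r"
      using ab chart_in_model[OF M c] by (auto simp: W_def x_def y_def)
    have conv: "convex (model M \<inter> ball (\<phi> p) r)"
      by (intro convex_Int subspace_imp_convex subspace_model[OF M] convex_ball)
    have line: "x + t *\<^sub>R (y - x) \<in> model M \<inter> ball (\<phi> p) r" if "t \<in> {0..1}" for t
      using convexD[OF conv xy, of "1 - t" t] that by (simp add: algebra_simps)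
    let ?g = "\<lambda>t. inv_into (fst ?c) (snd ?c) (x + t *\<^sub>R (y - x))"
    have "finsler_dist M F (?g 0) (?g 1) \<le> ereal (B * norm (y - x))"
    proof (rule finsler_dist_segment_le[OF M c _ _ _ F])
      show "x \<in> model M" "y \<in> model M" using xy by auto
      show "x + t *\<^sub>R (y - x) \<in> snd ?c ` fst ?c" if "t \<in> {0..1}" for t
        using line[OF that] r(2) by auto
      fix t :: real assume t: "t \<in> {0..1}"
      then have "x + t *\<^sub>R (y - x) \<in> \<phi> ` U" using line r(2) by blast
      then have "?g t \<in> U" "\<phi> (?g t) = x + t *\<^sub>R (y - x)"
        by (auto simp: inv_into_into f_inv_into_f)
      then show "F (?g t, chart_vec M ?c (?g t) (y - x)) \<le> B * norm (y - x)"
        using line[OF t] xy by (intro B(2)) (auto intro: subspace_diff[OF subspace_model[OF M]])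
    qed
    moreover have "?g 0 = a" "?g 1 = b"
      using is_chart_inv[OF ch] ab by (auto simp: x_def y_def W_def)
    ultimately have "ereal (k * d a b) \<le> ereal (B * norm (y - x))"
      using order_trans[OF V(4)[of a b]] ab unfolding W_def by (metis (no_types, lifting) IntD1)
    then have "k * d a b \<le> B * norm (x - y)" by (simp add: norm_minus_commute)
    then show ?thesis using V(3) by (simp add: field_simps x_def y_def)
  qed
  \<comment> \<open>Adding 1 makes the constant positive even when \<open>B = 0\<close>.\<close>
  show thesis
  proof (rule that[of W "B / k + 1"])
    show "openin (mtop M) W" unfolding W_def
      by (intro openin_Int V is_chart_open_preimage_open[OF ch] open_ball)
    show "p \<in> W" using V p r by (simp add: W_def)
    show "B / k + 1 > 0" using B V by (simp add: add_nonneg_pos)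
    show "d x y \<le> (B / k + 1) * norm (\<phi> x - \<phi> y)" if "x \<in> W" "y \<in> W" for x y
      using bound[OF that] by (simp add: distrib_right add_increasing2)
  qed (auto simp: W_def)
qed

section \<open>Homogeneous spaces\<close>

lemma Ck_on_Suc_0_cong:
  assumes "Ck_on (Suc 0) E S f" "\<And>x. x \<in> S \<Longrightarrow> g x = f x"
  shows "Ck_on (Suc 0) E S g"
proof -
  obtain f' where f': "\<forall>x\<in>S. (f has_derivative f' x) (at x within S)" "\<forall>v\<in>E. Ck_on 0 E S (\<lambda>x. f' x v)"
    using assms(1) by auto
  then have "\<forall>x\<in>S. (g has_derivative f' x) (at x within S)"
    using assms(2) by (blast intro: has_derivative_transform)
  then show ?thesis unfolding Ck_on.simps using f'(2) by auto
qed

lemma smooth_map2_continuous: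
  assumes "smooth_map (prod_manifold M N) K (\<lambda>(x, y). f x y)"
  shows "continuous_map (prod_topology (mtop M) (mtop N)) (mtop K) (\<lambda>(x, y). f x y)"
  using assms by (simp add: smooth_map_def prod_manifold_def)

lemma smooth_map2_continuous_right:
  assumes "smooth_map (prod_manifold M N) K (\<lambda>(x, y). f x y)" "p \<in> topspace (mtop M)"
  shows "continuous_map (mtop N) (mtop K) (f p)"
proof -
  have "continuous_map (mtop N) (prod_topology (mtop M) (mtop N)) (\<lambda>y. (p, y))"
    using assms(2) by (simp add: continuous_map_pairedI)
  from continuous_map_compose[OF this smooth_map2_continuous[OF assms(1)]]
  show ?thesis by (simp add: o_def)
qed

lemma smooth_map2_continuous_left:
  assumes "smooth_map (prod_manifold M N) K (\<lambda>(x, y). f x y)" "q \<in> topspace (mtop N)"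
  shows "continuous_map (mtop M) (mtop K) (\<lambda>x. f x q)"
proof -
  have "continuous_map (mtop M) (prod_topology (mtop M) (mtop N)) (\<lambda>x. (x, q))"
    using assms(2) by (simp add: continuous_map_pairedI)
  from continuous_map_compose[OF this smooth_map2_continuous[OF assms(1)]]
  show ?thesis by (simp add: o_def)
qed

lemma lie_group_topspace: "lie_group G N \<Longrightarrow> topspace (mtop N) = carrier G"
  by (simp add: lie_group_def)

context
  fixes G :: "('g, 'x) monoid_scheme" (structure)
    and N :: "('g, 'e::euclidean_space) manifold"
    and Q :: "('g set, 'k::euclidean_space) manifold" and H
  assumes lie: "lie_group G N" and H: "subgroup H G" and hom: "homogeneous_manifold G N H Q"
begin

interpretation group G
  using lie by (simp add: lie_group_def)

lemma coset_in_Q: "g \<in> carrier G \<Longrightarrow> g <# H \<in> topspace (mtop Q)"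
  using hom by (auto simp: homogeneous_manifold_def LCOSETS_def)

lemma coset_exists:
  assumes "q \<in> topspace (mtop Q)"
  obtains g where "g \<in> carrier G" "q = g <# H"
  using assms hom by (auto simp: homogeneous_manifold_def LCOSETS_def)

text \<open>The saturation of an open set is the union of its right translates by elements of
  \<open>H\<close>, each a preimage under a right multiplication. The quotient topology then makes
  the image open.\<close>

lemma coset_map_open: "open_map (mtop N) (mtop Q) (\<lambda>g. g <# H)"
  unfolding open_map_def
proof (intro allI impI)
  fix T assume T: "openin (mtop N) T"
  have TG: "T \<subseteq> carrier G" using openin_subset[OF T] lie_group_topspace[OF lie] by simp
  have "{g \<in> topspace (mtop N). g <# H \<in> (\<lambda>g. g <# H) ` T} = (\<Union>h\<in>H. {g \<in> topspace (mtop N). g \<otimes> h \<in> T})"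
  proof (intro equalityI subsetI)
    fix g assume "g \<in> {g \<in> topspace (mtop N). g <# H \<in> (\<lambda>g. g <# H) ` T}"
    then obtain t where t: "g \<in> carrier G" "t \<in> T" "g <# H = t <# H" by (auto simp: lie_group_topspace[OF lie])
    then have "t \<in> g <# H" using lcos_self[OF _ H, of t] TG by auto
    then obtain h where "h \<in> H" "t = g \<otimes> h" by (auto simp: l_coset_def)
    then show "g \<in> (\<Union>h\<in>H. {g \<in> topspace (mtop N). g \<otimes> h \<in> T})"
      using t by (auto simp: lie_group_topspace[OF lie])
  next
    fix g assume "g \<in> (\<Union>h\<in>H. {g \<in> topspace (mtop N). g \<otimes> h \<in> T})"
    then obtain h where h: "h \<in> H" "g \<in> carrier G" "g \<otimes> h \<in> T" by (auto simp: lie_group_topspace[OF lie])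
    then have "g \<otimes> h \<in> g <# H" by (auto simp: l_coset_def)
    then have "g <# H = (g \<otimes> h) <# H" using h(2) H by (rule l_repr_independence)
    then show "g \<in> {g \<in> topspace (mtop N). g <# H \<in> (\<lambda>g. g <# H) ` T}"
      using h by (auto simp: lie_group_topspace[OF lie])
  qed
  moreover have "openin (mtop N) {g \<in> topspace (mtop N). g \<otimes> h \<in> T}" if "h \<in> H" for h
  proof (rule openin_continuous_map_preimage[OF smooth_map2_continuous_left T])
    show "smooth_map (prod_manifold N N) N (\<lambda>(x, y). x \<otimes> y)" using lie by (simp add: lie_group_def)
    show "h \<in> topspace (mtop N)" using that subgroup.subset[OF H] lie_group_topspace[OF lie] by auto
  qed
  ultimately have "openin (mtop N) {g \<in> topspace (mtop N). g <# H \<in> (\<lambda>g. g <# H) ` T}"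
    by (simp only:) (auto intro!: openin_Union)
  moreover have "(\<lambda>g. g <# H) ` T \<subseteq> topspace (mtop Q)" using TG coset_in_Q by auto
  ultimately show "openin (mtop Q) ((\<lambda>g. g <# H) ` T)"
    using hom unfolding homogeneous_manifold_def quotient_map_def by blast
qed

text \<open>The orbit map in charts around the identity and around \<open>H\<close> is C1 and open,
  so it has a local section. The base point \<open>g0\<close> is wherever the rank is maximal and
  cannot be prescribed; \<open>s (g0 <# H) = g0\<close> anchors the section for later continuity
  arguments.\<close>

lemma lipschitz_local_section:
  obtains g0 U \<phi> V \<psi> Y s L where "(U, \<phi>) \<in> atlas N" "g0 \<in> U" "(V, \<psi>) \<in> atlas Q"
    "openin (mtop Q) Y" "g0 <# H \<in> Y" "Y \<subseteq> V" "s (g0 <# H) = g0" "L \<ge> 0"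
    "\<And>q. q \<in> Y \<Longrightarrow> s q \<in> U \<and> s q <# H = q"
    "\<And>q q'. q \<in> Y \<Longrightarrow> q' \<in> Y \<Longrightarrow> norm (\<phi> (s q) - \<phi> (s q')) \<le> L * norm (\<psi> q - \<psi> q')"
proof -
  have N: "smooth_manifold N" and Q: "smooth_manifold Q"
    and act: "smooth_map (prod_manifold N Q) Q (\<lambda>(g, A). g <# A)"
    using lie hom by (auto simp: lie_group_def homogeneous_manifold_def)
  have cont: "continuous_map (mtop N) (mtop Q) (\<lambda>g. g <# H)"
    using hom unfolding homogeneous_manifold_def by (blast intro: quotient_imp_continuous_map)
  obtain U \<phi> where U: "(U, \<phi>) \<in> atlas N" "\<one> \<in> U"
    by (rule smooth_manifold_chart_exists[OF N, of \<one>]) (auto simp: lie_group_topspace[OF lie])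
  have "\<one> <# H = H" by (rule lcos_mult_one[OF subgroup.subset[OF H]])
  then have HQ: "H \<in> topspace (mtop Q)" using coset_in_Q[OF one_closed] by simp
  then obtain V \<psi> where V: "(V, \<psi>) \<in> atlas Q" "H \<in> V"
    by (rule smooth_manifold_chart_exists[OF Q])
  have cU: "is_chart N U \<phi>" and cV: "is_chart Q V \<psi>"
    using smooth_manifold_chart N Q U V by blast+
  have UG: "U \<subseteq> carrier G" using is_chart_topspace(1)[OF cU] lie_group_topspace[OF lie] by simp
  define D where "D = {g \<in> U. g <# H \<in> V}"
  have D: "openin (mtop N) D"
  proof -
    have "D = U \<inter> {g \<in> topspace (mtop N). g <# H \<in> V}"
      using is_chart_topspace(1)[OF cU] by (auto simp: D_def)
    then show ?thesis
      using openin_continuous_map_preimage[OF cont, of V] cU cV by (simp add: is_chart_def openin_Int)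
  qed
  define f where "f x = \<psi> (inv_into U \<phi> x <# H)" for x
  have f: "f (\<phi> g) = \<psi> (g <# H)" if "g \<in> U" for g using is_chart_inv[OF cU that] by (simp add: f_def)
  let ?S = "\<phi> ` D"
  have S: "openin (top_of_set (model N)) ?S" by (rule is_chart_open_image[OF cU D]) (auto simp: D_def)
  have C1: "Ck_on (Suc 0) (model N) ?S f"
  proof -
    let ?D' = "map_prod \<phi> \<psi> ` {z \<in> U \<times> V. (\<lambda>(g, A). g <# A) z \<in> V}"
    let ?F = "\<psi> \<circ> (\<lambda>(g, A). g <# A) \<circ> inv_into (U \<times> V) (map_prod \<phi> \<psi>)"
    have "(U \<times> V, map_prod \<phi> \<psi>) \<in> atlas (prod_manifold N Q)"
      using U V by (auto simp: prod_manifold_def)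
    then have "smooth_on (model (prod_manifold N Q)) ?D' ?F"
      using act V(1) unfolding smooth_map_def by blast
    then have "Ck_on (Suc 0) (model N \<times> model Q) ?D' ?F"
      by (intro smooth_on_imp_C1) (simp add: prod_manifold_def)
    moreover have "(x, \<psi> H) \<in> ?D'" if "x \<in> ?S" for x
      using that V(2) by (force simp: D_def)
    moreover have "0 \<in> model Q" using Q by (simp add: smooth_manifold_def subspace_0)
    ultimately have "Ck_on (Suc 0) (model N) ?S (\<lambda>x. ?F (x, \<psi> H))"
      by (intro Ck_on_slice)
    moreover have "f x = ?F (x, \<psi> H)" if x: "x \<in> ?S" for x
    proof -
      obtain g where g: "g \<in> U" "x = \<phi> g" using x by (auto simp: D_def)
      have "inv_into (U \<times> V) (map_prod \<phi> \<psi>) (map_prod \<phi> \<psi> (g, H)) = (g, H)"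
        using g V by (intro is_chart_inv[OF is_chart_prod[OF cU cV]]) simp
      then show ?thesis using f[OF g(1)] by (simp add: g(2))
    qed
    ultimately show ?thesis by (rule Ck_on_Suc_0_cong)
  qed
  have subN: "subspace (model N)" and subQ: "subspace (model Q)"
    using N Q by (auto simp: smooth_manifold_def)
  have "\<psi> ` V \<subseteq> model Q" using cV openin_imp_subset unfolding is_chart_def by blast
  then have range_f: "f ` ?S \<subseteq> model Q" using f by (auto simp: D_def)
  have open_f: "openin (top_of_set (model Q)) (f ` T)" if T: "openin (top_of_set (model N)) T" "T \<subseteq> ?S" for T
  proof -
    let ?T = "{g \<in> U. \<phi> g \<in> T}"
    have "?T \<subseteq> D" using T(2) is_chart_inj[OF cU] by (auto simp: D_def inj_on_def)
    have "openin (mtop Q) ((\<lambda>g. g <# H) ` ?T)"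
      using coset_map_open is_chart_open_preimage[OF cU T(1)] by (simp add: open_map_def)
    then have "openin (top_of_set (model Q)) (\<psi> ` (\<lambda>g. g <# H) ` ?T)"
      by (rule is_chart_open_image[OF cV]) (use \<open>?T \<subseteq> D\<close> in \<open>auto simp: D_def\<close>)
    also have "\<psi> ` (\<lambda>g. g <# H) ` ?T = f ` \<phi> ` ?T"
      unfolding image_image using f by (intro image_cong) auto
    also have "\<phi> ` ?T = T" using T(2) by (auto simp: D_def)
    finally show ?thesis .
  qed
  have "\<one> \<in> D" using U V \<open>\<one> <# H = H\<close> by (simp add: D_def)
  then have "?S \<noteq> {}" by blast
  obtain x0 Y \<sigma> L where x0: "x0 \<in> ?S" and Y: "openin (top_of_set (model Q)) Y" "f x0 \<in> Y"
    and \<sigma>: "\<sigma> (f x0) = x0" "\<sigma> ` Y \<subseteq> ?S" "\<And>y. y \<in> Y \<Longrightarrow> f (\<sigma> y) = y"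
    and L: "L \<ge> 0" "\<And>y z. y \<in> Y \<Longrightarrow> z \<in> Y \<Longrightarrow> norm (\<sigma> y - \<sigma> z) \<le> L * norm (y - z)"
    using C1_open_map_local_section[OF C1 S \<open>?S \<noteq> {}\<close> subN subQ range_f open_f] by metis
  obtain g0 where g0: "g0 \<in> D" "x0 = \<phi> g0" using x0 by blast
  have fx0: "f x0 = \<psi> (g0 <# H)" using f g0 by (simp add: D_def)
  define s where "s q = inv_into U \<phi> (\<sigma> (\<psi> q))" for q
  have s: "s q \<in> U" "\<phi> (s q) = \<sigma> (\<psi> q)" "s q <# H = q" if "q \<in> V" "\<psi> q \<in> Y" for q
  proof -
    have "\<sigma> (\<psi> q) \<in> ?S" using \<sigma>(2) that by blast
    then obtain g where g: "g \<in> D" "\<sigma> (\<psi> q) = \<phi> g" by blast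
    then have sg: "s q = g" using is_chart_inv[OF cU] by (auto simp: s_def D_def)
    show "s q \<in> U" "\<phi> (s q) = \<sigma> (\<psi> q)" using sg g by (auto simp: D_def)
    have "\<psi> (g <# H) = \<psi> q" using \<sigma>(3)[OF that(2)] f g by (simp add: D_def)
    then show "s q <# H = q" using sg g that is_chart_inj[OF cV] by (auto simp: D_def dest: inj_onD)
  qed
  show thesis
  proof (rule that[of U \<phi> g0 V \<psi> "{q \<in> V. \<psi> q \<in> Y}" s L])
    show "openin (mtop Q) {q \<in> V. \<psi> q \<in> Y}" by (rule is_chart_open_preimage[OF cV Y(1)])
    show "g0 <# H \<in> {q \<in> V. \<psi> q \<in> Y}" using g0 Y(2) fx0 by (simp add: D_def)
    show "s (g0 <# H) = g0"
      using \<sigma>(1) g0 is_chart_inv[OF cU] by (simp add: s_def D_def flip: fx0)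
    show "s q \<in> U \<and> s q <# H = q" if "q \<in> {q \<in> V. \<psi> q \<in> Y}" for q using s that by blast
    show "norm (\<phi> (s q) - \<phi> (s q')) \<le> L * norm (\<psi> q - \<psi> q')"
      if "q \<in> {q \<in> V. \<psi> q \<in> Y}" "q' \<in> {q \<in> V. \<psi> q \<in> Y}" for q q'
      using L(2) s that by simp
  qed (use U V g0 L in \<open>auto simp: D_def\<close>)
qed

end

lemma smooth_map2_open_box:
  assumes f: "smooth_map (prod_manifold M N) K (\<lambda>(x, y). f x y)" and W: "openin (mtop K) W"
    and p: "p \<in> topspace (mtop M)" "q \<in> topspace (mtop N)" "f p q \<in> W"
  obtains A B where "openin (mtop M) A" "openin (mtop N) B" "p \<in> A" "q \<in> B"
    "\<And>x y. x \<in> A \<Longrightarrow> y \<in> B \<Longrightarrow> f x y \<in> W"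
proof -
  let ?P = "{z \<in> topspace (prod_topology (mtop M) (mtop N)). (\<lambda>(x, y). f x y) z \<in> W}"
  have "openin (prod_topology (mtop M) (mtop N)) ?P"
    by (rule openin_continuous_map_preimage[OF smooth_map2_continuous[OF f] W])
  moreover have "(p, q) \<in> ?P" using p by simp
  ultimately have "\<exists>A B. openin (mtop M) A \<and> openin (mtop N) B \<and> p \<in> A \<and> q \<in> B \<and> A \<times> B \<subseteq> ?P"
    by (rule openin_prod_topology_alt[THEN iffD1, rule_format])
  then obtain A B where AB: "openin (mtop M) A" "openin (mtop N) B" "p \<in> A" "q \<in> B" "A \<times> B \<subseteq> ?P"
    by (elim exE conjE)
  have "f x y \<in> W" if "x \<in> A" "y \<in> B" for x y
    using subsetD[OF AB(5), of "(x, y)"] that by simp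
  with AB(1-4) show thesis using that by blast
qed

section \<open>Cosets of the stabilizer as translates of a compact set\<close>

lemma subgroup_set_stabilizer:
  assumes act: "group_action G S \<phi>" and X: "X \<subseteq> S"
  shows "subgroup (set_stabilizer G \<phi> X) G"
proof -
  interpret group_action G S \<phi> by (rule act)
  interpret group G using group_hom unfolding group_hom_def by blast
  have comp: "\<phi> (g \<otimes>\<^bsub>G\<^esub> h) ` X = \<phi> g ` \<phi> h ` X" if "g \<in> carrier G" "h \<in> carrier G" for g h
    unfolding image_image using composition_rule X that by (intro image_cong) auto
  have inv: "\<phi> (inv\<^bsub>G\<^esub> g) ` \<phi> g ` X = X" if "g \<in> carrier G" for g
    unfolding image_image using orbit_sym_aux[OF that _ refl] X by force
  show ?thesis
  proof
    show "set_stabilizer G \<phi> X \<subseteq> carrier G" by (auto simp: set_stabilizer_def)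
    show "g \<otimes>\<^bsub>G\<^esub> h \<in> set_stabilizer G \<phi> X" if "g \<in> set_stabilizer G \<phi> X" "h \<in> set_stabilizer G \<phi> X" for g h
      using that by (simp add: set_stabilizer_def comp)
    show "\<one>\<^bsub>G\<^esub> \<in> set_stabilizer G \<phi> X"
    proof -
      have "\<phi> \<one>\<^bsub>G\<^esub> x = x" if "x \<in> X" for x
        using fun_cong[OF id_eq_one, of x] that X by auto
      then show ?thesis by (simp add: set_stabilizer_def)
    qed
    show "inv\<^bsub>G\<^esub> g \<in> set_stabilizer G \<phi> X" if "g \<in> set_stabilizer G \<phi> X" for g
      using that inv[of g] by (auto simp: set_stabilizer_def)
  qed
qed

text \<open>If \<open>g\<close> and \<open>h\<close> give the same translate of \<open>X\<close>,
  then \<open>inv g\<close> times \<open>h\<close> stabilizes \<open>X\<close>, so both lie in one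
  coset. Cosets thus correspond injectively to translates of \<open>X\<close>, which are compact
  because each group element acts continuously.\<close>

lemma Metric_space_coset_dist:
  assumes act: "group_action G S \<phi>" and d: "Metric_space S d"
    and cont: "\<And>g. g \<in> carrier G \<Longrightarrow>
      continuous_map (Metric_space.mtopology S d) (Metric_space.mtopology S d) (\<phi> g)"
    and X: "compactin (Metric_space.mtopology S d) X" "X \<noteq> {}"
  shows "Metric_space (lcosets\<^bsub>G\<^esub> (set_stabilizer G \<phi> X)) (coset_dist G \<phi> d X)"
proof -
  interpret Metric_space S d by (rule d)
  interpret group_action G S \<phi> by (rule act)
  interpret group G using group_hom unfolding group_hom_def by blast
  have XS: "X \<subseteq> S" using compactin_subset_topspace[OF X(1)] by simp
  let ?H = "set_stabilizer G \<phi> X"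
  have H: "subgroup ?H G" by (rule subgroup_set_stabilizer[OF act XS])
  let ?R = "\<lambda>p. \<phi> (SOME g. g \<in> p) ` X"
  have R: "?R (g <#\<^bsub>G\<^esub> ?H) = \<phi> g ` X" if "g \<in> carrier G" for g
    by (rule image_some_coset[OF act XS that])
  have "inj_on ?R (lcosets\<^bsub>G\<^esub> ?H)"
  proof (rule inj_onI)
    fix p q assume "p \<in> lcosets\<^bsub>G\<^esub> ?H" "q \<in> lcosets\<^bsub>G\<^esub> ?H" and eq: "?R p = ?R q"
    then obtain g h where g: "g \<in> carrier G" "p = g <#\<^bsub>G\<^esub> ?H" and h: "h \<in> carrier G" "q = h <#\<^bsub>G\<^esub> ?H"
      by (auto simp: LCOSETS_def)
    have eq: "\<phi> g ` X = \<phi> h ` X" using eq R g h by simp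
    have "\<phi> (inv\<^bsub>G\<^esub> g \<otimes>\<^bsub>G\<^esub> h) ` X = \<phi> (inv\<^bsub>G\<^esub> g) ` \<phi> h ` X"
      unfolding image_image using composition_rule XS g h by (intro image_cong) auto
    also have "\<dots> = \<phi> (inv\<^bsub>G\<^esub> g) ` \<phi> g ` X" by (simp add: eq)
    also have "\<dots> = X"
      unfolding image_image using orbit_sym_aux[OF g(1) _ refl] XS by force
    finally have "inv\<^bsub>G\<^esub> g \<otimes>\<^bsub>G\<^esub> h \<in> ?H" using g h by (simp add: set_stabilizer_def)
    then have "h \<in> g <#\<^bsub>G\<^esub> ?H"
      by (rule subgroup.lcos_module_rev[OF H is_group g(1) h(1)])
    then show "p = q" using l_repr_independence[OF _ g(1) H] g h by simp
  qed
  moreover have "compactin mtopology (?R p)" "?R p \<noteq> {}" if p: "p \<in> lcosets\<^bsub>G\<^esub> ?H" for p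
  proof -
    obtain g where "g \<in> carrier G" "p = g <#\<^bsub>G\<^esub> ?H" using p by (auto simp: LCOSETS_def)
    then show "compactin mtopology (?R p)" using R image_compactin[OF X(1) cont] by simp
    show "?R p \<noteq> {}" using X(2) by simp
  qed
  ultimately have "Metric_space (lcosets\<^bsub>G\<^esub> ?H) (\<lambda>p q. if p \<in> lcosets\<^bsub>G\<^esub> ?H \<and> q \<in> lcosets\<^bsub>G\<^esub> ?H
      then hausdorff_dist d (?R p) (?R q) else 0)"
    by (rule Metric_space_hausdorff_dist)
  then show ?thesis by (simp add: coset_dist_def[abs_def])
qed

text \<open>By continuity the coordinate derivative exceeds its norm at \<open>x\<close> by at most
  1 nearby; the mean value inequality on a convex piece of the interval does the rest.\<close>

lemma C1_path_locally_lipschitz: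
  assumes \<eta>: "C1_path_on M a b \<eta>" and c: "(V, \<psi>) \<in> atlas M" and V: "openin (mtop M) V"
    and x: "x \<in> {a..b}" "\<eta> x \<in> V"
  obtains \<delta> L where "\<delta> > 0" "L \<ge> 0"
    "\<And>s t. s \<in> {a..b} \<inter> ball x \<delta> \<Longrightarrow> t \<in> {a..b} \<inter> ball x \<delta> \<Longrightarrow> norm (\<psi> (\<eta> s) - \<psi> (\<eta> t)) \<le> L * \<bar>s - t\<bar>"
proof -
  let ?I = "{t \<in> {a..b}. \<eta> t \<in> V}"
  have cont: "continuous_map (top_of_set {a..b}) (mtop M) \<eta>" using \<eta> by (simp add: C1_path_on_def)
  obtain \<gamma>' where \<gamma>': "continuous_on ?I \<gamma>'"
    "\<And>t. t \<in> {a..b} \<Longrightarrow> \<eta> t \<in> V \<Longrightarrow> (\<psi> \<circ> \<eta> has_vector_derivative \<gamma>' t) (at t within {a..b})"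
    using \<eta> c unfolding C1_path_on_def by blast
  have "openin (top_of_set {a..b}) {t \<in> topspace (top_of_set {a..b}). \<eta> t \<in> V}"
    by (rule openin_continuous_map_preimage[OF cont V])
  then have "openin (top_of_set {a..b}) ?I" by simp
  then obtain \<delta>1 where \<delta>1: "\<delta>1 > 0" "ball x \<delta>1 \<inter> {a..b} \<subseteq> ?I"
    using x unfolding openin_contains_ball by blast
  have "x \<in> ?I" using x by simp
  then obtain \<delta>2 where \<delta>2: "\<delta>2 > 0" "\<And>t. t \<in> ?I \<Longrightarrow> dist t x \<le> \<delta>2 \<Longrightarrow> dist (\<gamma>' t) (\<gamma>' x) < 1"
    using continuous_onE[OF \<gamma>'(1), of x 1] by auto
  define \<delta> where "\<delta> = min \<delta>1 \<delta>2"
  let ?J = "{a..b} \<inter> ball x \<delta>"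
  have J: "t \<in> ?I" "norm (\<gamma>' t) \<le> norm (\<gamma>' x) + 1" if "t \<in> ?J" for t
  proof -
    show "t \<in> ?I" using that \<delta>1 by (auto simp: \<delta>_def)
    then have "dist (\<gamma>' t) (\<gamma>' x) < 1" using that by (intro \<delta>2) (auto simp: \<delta>_def dist_commute)
    then show "norm (\<gamma>' t) \<le> norm (\<gamma>' x) + 1"
      using norm_triangle_sub[of "\<gamma>' t" "\<gamma>' x"] by (simp add: dist_norm)
  qed
  show thesis
  proof (rule that[of \<delta> "norm (\<gamma>' x) + 1"])
    show "\<delta> > 0" using \<delta>1 \<delta>2 by (simp add: \<delta>_def)
    fix s t assume st: "s \<in> ?J" "t \<in> ?J"
    have "norm ((\<psi> \<circ> \<eta>) s - (\<psi> \<circ> \<eta>) t) \<le> (norm (\<gamma>' x) + 1) * norm (s - t)"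
    proof (rule differentiable_bound[where S = ?J and f' = "\<lambda>t h. h *\<^sub>R \<gamma>' t"])
      show "convex ?J" by (intro convex_Int convex_real_interval convex_ball)
      fix u assume u: "u \<in> ?J"
      then show "((\<psi> \<circ> \<eta>) has_derivative (\<lambda>h. h *\<^sub>R \<gamma>' u)) (at u within ?J)"
        using \<gamma>'(2)[of u] J(1)[OF u] unfolding has_vector_derivative_def
        by (auto intro: has_derivative_subset)
      show "onorm (\<lambda>h. h *\<^sub>R \<gamma>' u) \<le> norm (\<gamma>' x) + 1"
        using J(2)[OF u] by (intro onorm_le) (simp add: mult.commute[of _ "\<bar>_\<bar>"] mult_left_mono)
    qed (use st in auto)
    then show "norm (\<psi> (\<eta> s) - \<psi> (\<eta> t)) \<le> (norm (\<gamma>' x) + 1) * \<bar>s - t\<bar>" by simp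
  qed simp
qed

section \<open>Translated lifts of a path and their effect on the compact set\<close>

context
  fixes G :: "('g, 'x) monoid_scheme"
    and N :: "('g, 'e::euclidean_space) manifold"
    and M :: "('m, 'f::euclidean_space) manifold"
    and d :: "'m \<Rightarrow> 'm \<Rightarrow> real" and X :: "'m set" and \<phi> :: "'g \<Rightarrow> 'm \<Rightarrow> 'm"
  assumes lie: "lie_group G N" and M: "smooth_manifold M" and d: "d \<in> locally_finsler_metrics M"
    and X: "compactin (mtop M) X" "X \<noteq> {}" and act: "smooth_action G N M \<phi>"
begin

interpretation group G
  using lie by (simp add: lie_group_def)

interpretation group_action G "topspace (mtop M)" \<phi>
  using act by (simp add: smooth_action_def)

interpretation Metric_space "topspace (mtop M)" d
  using d by (simp add: locally_finsler_metrics_def)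

lemma mtopology_eq_mtop: "mtopology = mtop M"
  using d by (simp add: locally_finsler_metrics_def)

lemma smooth_N: "smooth_manifold N"
  and smooth_mult: "smooth_map (prod_manifold N N) N (\<lambda>(g, h). g \<otimes>\<^bsub>G\<^esub> h)"
  and smooth_act: "smooth_map (prod_manifold N M) M (\<lambda>(g, x). \<phi> g x)"
  using lie act by (auto simp: lie_group_def smooth_action_def)

lemma Metric_space_coset_dist_Lie:
  "Metric_space (lcosets\<^bsub>G\<^esub> (set_stabilizer G \<phi> X)) (coset_dist G \<phi> d X)"
proof (rule Metric_space_coset_dist[OF group_action_axioms Metric_space_axioms])
  show "continuous_map mtopology mtopology (\<phi> g)" if "g \<in> carrier G" for g
    unfolding mtopology_eq_mtop by (rule smooth_map2_continuous_right[OF smooth_act]) (simp add: that lie_group_topspace[OF lie])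
qed (simp_all add: X mtopology_eq_mtop)

text \<open>The section lives near \<open>g0\<close>, but the estimate is wanted near
  \<open>h\<close> times \<open>g0\<close>. Three changes of distance are composed: left translation
  in coordinates (\<open>L4\<close>), the action in coordinates (\<open>L2\<close>), and the passage
  from coordinates to \<open>d\<close> (\<open>L1\<close>).\<close>

lemma translated_action_locally_lipschitz:
  assumes U: "(U, \<xi>) \<in> atlas N" "g0 \<in> U" and h: "h \<in> carrier G" and x: "x \<in> topspace (mtop M)"
  obtains A B L where "openin (mtop N) A" "g0 \<in> A" "openin (mtop M) B" "x \<in> B" "L > 0"
    "\<And>g g' y. g \<in> A \<Longrightarrow> g' \<in> A \<Longrightarrow> y \<in> B \<Longrightarrow> d (\<phi> (h \<otimes>\<^bsub>G\<^esub> g) y) (\<phi> (h \<otimes>\<^bsub>G\<^esub> g') y) \<le> L * norm (\<xi> g - \<xi> g')"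
proof -
  have g0: "g0 \<in> carrier G" using is_chart_topspace(1)[OF smooth_manifold_chart[OF smooth_N U(1)]] U(2) lie_group_topspace[OF lie] by auto
  define k where "k = h \<otimes>\<^bsub>G\<^esub> g0"
  have k: "k \<in> carrier G" using h g0 by (simp add: k_def)
  define z where "z = \<phi> k x"
  have z: "z \<in> topspace (mtop M)" using element_image[OF k x] by (simp add: z_def)
  obtain U1 \<xi>1 where U1: "(U1, \<xi>1) \<in> atlas N" "k \<in> U1"
    by (rule smooth_manifold_chart_exists[OF smooth_N, of k]) (auto simp: k lie_group_topspace[OF lie])
  obtain U2 \<xi>2 where U2: "(U2, \<xi>2) \<in> atlas N" "h \<in> U2"
    by (rule smooth_manifold_chart_exists[OF smooth_N, of h]) (auto simp: h lie_group_topspace[OF lie])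
  obtain V \<psi> where V: "(V, \<psi>) \<in> atlas M" "x \<in> V"
    by (rule smooth_manifold_chart_exists[OF M x])
  obtain Z \<kappa> where Z: "(Z, \<kappa>) \<in> atlas M" "z \<in> Z"
    by (rule smooth_manifold_chart_exists[OF M z])
  obtain W L1 where W: "openin (mtop M) W" "z \<in> W" "W \<subseteq> Z" "L1 > 0"
    and L1: "\<And>x y. x \<in> W \<Longrightarrow> y \<in> W \<Longrightarrow> d x y \<le> L1 * norm (\<kappa> x - \<kappa> y)"
    using locally_finsler_chart_lipschitz[OF M d Z] by metis
  have zZ: "\<phi> k x \<in> Z" "\<phi> k x \<in> W" using Z W by (auto simp: z_def)
  obtain A2 B2 L2 where 2: "openin (mtop N) A2" "k \<in> A2" "openin (mtop M) B2" "x \<in> B2" "L2 > 0"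
    and L2: "\<And>g y g' y'. g \<in> A2 \<Longrightarrow> g' \<in> A2 \<Longrightarrow> y \<in> B2 \<Longrightarrow> y' \<in> B2 \<Longrightarrow>
      norm (\<kappa> (\<phi> g y) - \<kappa> (\<phi> g' y')) \<le> L2 * norm ((\<xi>1 g, \<psi> y) - (\<xi>1 g', \<psi> y'))"
    using smooth_map2_locally_lipschitz[OF smooth_N M M smooth_act U1(1) V(1) Z(1) U1(2) V(2) zZ(1)] by metis
  obtain A3 B3 where 3: "openin (mtop N) A3" "openin (mtop M) B3" "k \<in> A3" "x \<in> B3"
    and W3: "\<And>g y. g \<in> A3 \<Longrightarrow> y \<in> B3 \<Longrightarrow> \<phi> g y \<in> W"
    using smooth_map2_open_box[OF smooth_act W(1), of k x] k x zZ lie_group_topspace[OF lie] by metis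
  have kU1: "h \<otimes>\<^bsub>G\<^esub> g0 \<in> U1" using U1 by (simp add: k_def)
  obtain A4 B4 L4 where 4: "openin (mtop N) A4" "h \<in> A4" "openin (mtop N) B4" "g0 \<in> B4" "L4 > 0"
    and L4: "\<And>g y g' y'. g \<in> A4 \<Longrightarrow> g' \<in> A4 \<Longrightarrow> y \<in> B4 \<Longrightarrow> y' \<in> B4 \<Longrightarrow>
      norm (\<xi>1 (g \<otimes>\<^bsub>G\<^esub> y) - \<xi>1 (g' \<otimes>\<^bsub>G\<^esub> y')) \<le> L4 * norm ((\<xi>2 g, \<xi> y) - (\<xi>2 g', \<xi> y'))"
    using smooth_map2_locally_lipschitz[OF smooth_N smooth_N smooth_N smooth_mult U2(1) U(1) U1(1) U2(2) U(2) kU1] by metis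
  \<comment> \<open>For \<open>g\<close> in this set the translate by \<open>h\<close> satisfies
    both conditions on the acting element: the coordinate estimate on \<open>A2\<close>, and on
    \<open>A3\<close> that the image stays in \<open>W\<close>, where \<open>d\<close> is
    controlled.\<close>
  define A where "A = B4 \<inter> {g \<in> topspace (mtop N). h \<otimes>\<^bsub>G\<^esub> g \<in> A2 \<inter> A3}"
  show thesis
  proof (rule that[of A "B2 \<inter> B3" "L1 * (L2 * L4)"])
    have "continuous_map (mtop N) (mtop N) (\<lambda>g. h \<otimes>\<^bsub>G\<^esub> g)"
      by (rule smooth_map2_continuous_right[OF smooth_mult]) (simp add: h lie_group_topspace[OF lie])
    then show "openin (mtop N) A"
      unfolding A_def using 2 3 4 by (intro openin_Int openin_continuous_map_preimage) auto
    show "g0 \<in> A" using 2 3 4 g0 by (simp add: A_def k_def lie_group_topspace[OF lie])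
    show "openin (mtop M) (B2 \<inter> B3)" "x \<in> B2 \<inter> B3" using 2 3 by auto
    show "L1 * (L2 * L4) > 0" using W 2 4 by simp
    fix g g' y assume g: "g \<in> A" "g' \<in> A" and y: "y \<in> B2 \<inter> B3"
    have "d (\<phi> (h \<otimes>\<^bsub>G\<^esub> g) y) (\<phi> (h \<otimes>\<^bsub>G\<^esub> g') y)
        \<le> L1 * norm (\<kappa> (\<phi> (h \<otimes>\<^bsub>G\<^esub> g) y) - \<kappa> (\<phi> (h \<otimes>\<^bsub>G\<^esub> g') y))"
      using g y by (intro L1 W3) (auto simp: A_def)
    also have "norm (\<kappa> (\<phi> (h \<otimes>\<^bsub>G\<^esub> g) y) - \<kappa> (\<phi> (h \<otimes>\<^bsub>G\<^esub> g') y))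
        \<le> L2 * norm (\<xi>1 (h \<otimes>\<^bsub>G\<^esub> g) - \<xi>1 (h \<otimes>\<^bsub>G\<^esub> g'))"
      using L2[of "h \<otimes>\<^bsub>G\<^esub> g" "h \<otimes>\<^bsub>G\<^esub> g'" y y] g y by (simp add: A_def norm_Pair)
    also have "norm (\<xi>1 (h \<otimes>\<^bsub>G\<^esub> g) - \<xi>1 (h \<otimes>\<^bsub>G\<^esub> g')) \<le> L4 * norm (\<xi> g - \<xi> g')"
      using L4[of h h g g'] g 4 by (simp add: A_def norm_Pair)
    finally show "d (\<phi> (h \<otimes>\<^bsub>G\<^esub> g) y) (\<phi> (h \<otimes>\<^bsub>G\<^esub> g') y) \<le> L1 * (L2 * L4) * norm (\<xi> g - \<xi> g')"
      using W(4) 2(5) by (simp add: mult.assoc mult_left_mono)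
  qed
qed

text \<open>A finite subcover of \<open>X\<close> leaves finitely many neighbourhoods of
  \<open>g0\<close>, whose intersection is open. The sum of the finitely many positive constants
  dominates each of them.\<close>

lemma translated_action_lipschitz_on_compact:
  assumes U: "(U, \<xi>) \<in> atlas N" "g0 \<in> U" and h: "h \<in> carrier G"
  obtains A L where "openin (mtop N) A" "g0 \<in> A" "L \<ge> 0"
    "\<And>g g' y. g \<in> A \<Longrightarrow> g' \<in> A \<Longrightarrow> y \<in> X \<Longrightarrow> d (\<phi> (h \<otimes>\<^bsub>G\<^esub> g) y) (\<phi> (h \<otimes>\<^bsub>G\<^esub> g') y) \<le> L * norm (\<xi> g - \<xi> g')"
proof -
  define P where "P x A B L \<longleftrightarrow> openin (mtop N) A \<and> g0 \<in> A \<and> openin (mtop M) B \<and> x \<in> B \<and> (L::real) > 0 \<and>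
    (\<forall>g\<in>A. \<forall>g'\<in>A. \<forall>y\<in>B. d (\<phi> (h \<otimes>\<^bsub>G\<^esub> g) y) (\<phi> (h \<otimes>\<^bsub>G\<^esub> g') y) \<le> L * norm (\<xi> g - \<xi> g'))" for x A B L
  have "\<exists>A B L. P x A B L" if "x \<in> X" for x
  proof -
    have "x \<in> topspace (mtop M)" using that compactin_subset_topspace[OF X(1)] by blast
    from translated_action_locally_lipschitz[OF U h this] show ?thesis
      unfolding P_def by (metis (no_types))
  qed
  then obtain A B L where P: "\<And>x. x \<in> X \<Longrightarrow> P x (A x) (B x) (L x)" by metis
  then have AB: "openin (mtop N) (A x)" "g0 \<in> A x" "openin (mtop M) (B x)" "x \<in> B x" "L x > 0"
    and L: "\<And>g g' y. g \<in> A x \<Longrightarrow> g' \<in> A x \<Longrightarrow> y \<in> B x \<Longrightarrow>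
      d (\<phi> (h \<otimes>\<^bsub>G\<^esub> g) y) (\<phi> (h \<otimes>\<^bsub>G\<^esub> g') y) \<le> L x * norm (\<xi> g - \<xi> g')" if "x \<in> X" for x
    using that unfolding P_def by blast+
  have "\<exists>\<F>. finite \<F> \<and> \<F> \<subseteq> B ` X \<and> X \<subseteq> \<Union>\<F>"
    using AB by (intro compactinD[OF X(1)]) auto
  then obtain K where K: "finite K" "K \<subseteq> X" "X \<subseteq> \<Union>(B ` K)"
    by (metis finite_subset_image)
  \<comment> \<open>Openness of the intersection requires a non-empty family; this is supplied by
    \<open>X \<noteq> {}\<close>.\<close>
  have "K \<noteq> {}" using K(3) X(2) by auto
  show thesis
  proof (rule that[of "\<Inter>(A ` K)" "sum L K"])
    show "openin (mtop N) (\<Inter>(A ` K))" using K AB \<open>K \<noteq> {}\<close> by (intro openin_Inter) auto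
    show "g0 \<in> \<Inter>(A ` K)" using AB K by auto
    show "sum L K \<ge> 0" using AB(5) K by (intro sum_nonneg) (auto intro: less_imp_le)
    fix g g' y assume g: "g \<in> \<Inter>(A ` K)" "g' \<in> \<Inter>(A ` K)" and y: "y \<in> X"
    obtain x where x: "x \<in> K" "y \<in> B x" using K(3) y by blast
    have "d (\<phi> (h \<otimes>\<^bsub>G\<^esub> g) y) (\<phi> (h \<otimes>\<^bsub>G\<^esub> g') y) \<le> L x * norm (\<xi> g - \<xi> g')"
      using L[of x g g' y] x g K by blast
    also have "L x \<le> sum L K"
      using AB(5) K x by (intro member_le_sum) (auto intro: less_imp_le)
    finally show "d (\<phi> (h \<otimes>\<^bsub>G\<^esub> g) y) (\<phi> (h \<otimes>\<^bsub>G\<^esub> g') y) \<le> sum L K * norm (\<xi> g - \<xi> g')"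
      by (simp add: mult_right_mono)
  qed
qed

text \<open>The path is moved by the inverse of \<open>h\<close> to the coset of \<open>g0\<close>,
  lifted there by the section, and moved back by \<open>h\<close>. Two lifted values displace every
  point of \<open>X\<close> by little, which bounds the Hausdorff distance.\<close>

lemma C1_path_coset_locally_lipschitz:
  fixes Q :: "('g set, 'k::euclidean_space) manifold"
  assumes hom: "homogeneous_manifold G N (set_stabilizer G \<phi> X) Q"
    and \<eta>: "C1_path_on Q a b \<eta>" and x: "x \<in> {a..b}"
  shows "\<exists>\<delta>>0. \<exists>L\<ge>0. \<forall>s\<in>{a..b} \<inter> ball x \<delta>. \<forall>t\<in>{a..b} \<inter> ball x \<delta>.
    coset_dist G \<phi> d X (\<eta> s) (\<eta> t) \<le> L * \<bar>s - t\<bar>"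
proof -
  define H where "H = set_stabilizer G \<phi> X"
  let ?\<pi> = "\<lambda>g. g <#\<^bsub>G\<^esub> H"
  have H: "subgroup H G" unfolding H_def by (rule subgroup_set_stabilizer[OF group_action_axioms compactin_subset_topspace[OF X(1)]])
  have HG: "H \<subseteq> carrier G" using H by (rule subgroup.subset)
  have homH: "homogeneous_manifold G N H Q" using hom by (simp add: H_def)
  have Q: "smooth_manifold Q" and actQ: "smooth_map (prod_manifold N Q) Q (\<lambda>(g, A). g <#\<^bsub>G\<^esub> A)"
    using hom by (auto simp: homogeneous_manifold_def)
  have cont: "continuous_map (top_of_set {a..b}) (mtop Q) \<eta>" using \<eta> by (simp add: C1_path_on_def)
  then have \<eta>Q: "\<eta> t \<in> topspace (mtop Q)" if "t \<in> {a..b}" for t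
    using that by (auto simp: continuous_map_def)
  obtain g0 U \<xi> V \<psi> Y s Ls where U: "(U, \<xi>) \<in> atlas N" "g0 \<in> U" and V: "(V, \<psi>) \<in> atlas Q"
    and Y: "openin (mtop Q) Y" "?\<pi> g0 \<in> Y" "Y \<subseteq> V" and s0: "s (?\<pi> g0) = g0" "Ls \<ge> 0"
    and s: "\<And>q. q \<in> Y \<Longrightarrow> s q \<in> U \<and> ?\<pi> (s q) = q"
    and Ls: "\<And>q q'. q \<in> Y \<Longrightarrow> q' \<in> Y \<Longrightarrow> norm (\<xi> (s q) - \<xi> (s q')) \<le> Ls * norm (\<psi> q - \<psi> q')"
    using lipschitz_local_section[OF lie H homH] by metis
  have cU: "is_chart N U \<xi>" and cV: "is_chart Q V \<psi>" using smooth_manifold_chart smooth_N Q U V by blast+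
  have UG: "U \<subseteq> carrier G" using is_chart_topspace(1)[OF cU] lie_group_topspace[OF lie] by simp
  obtain k where k: "k \<in> carrier G" "\<eta> x = ?\<pi> k"
    using \<eta>Q[OF x] coset_exists[OF lie H homH] by metis
  \<comment> \<open>Chosen so that translation by \<open>h\<close> carries the coset of
    \<open>g0\<close> to \<open>\<eta> x\<close>.\<close>
  define h where "h = k \<otimes>\<^bsub>G\<^esub> inv\<^bsub>G\<^esub> g0"
  have g0: "g0 \<in> carrier G" using U UG by blast
  have h: "h \<in> carrier G" using k g0 by (simp add: h_def)
  let ?w = "\<lambda>q. inv\<^bsub>G\<^esub> h <#\<^bsub>G\<^esub> q"
  have wx: "?w (\<eta> x) = ?\<pi> g0"
  proof -
    have "inv\<^bsub>G\<^esub> h \<otimes>\<^bsub>G\<^esub> k = g0" using k g0 by (simp add: h_def inv_mult_group m_assoc)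
    then show ?thesis using k h HG by (simp add: lcos_m_assoc)
  qed
  have hw: "h <#\<^bsub>G\<^esub> ?w q = q" if q: "q \<in> topspace (mtop Q)" for q
  proof -
    obtain g where "g \<in> carrier G" "q = ?\<pi> g" using coset_exists[OF lie H homH q] by metis
    then show ?thesis using h HG by (simp add: lcos_m_assoc flip: m_assoc)
  qed
  obtain A LD where A: "openin (mtop N) A" "g0 \<in> A" "LD \<ge> 0"
    and LD: "\<And>g g' y. g \<in> A \<Longrightarrow> g' \<in> A \<Longrightarrow> y \<in> X \<Longrightarrow> d (\<phi> (h \<otimes>\<^bsub>G\<^esub> g) y) (\<phi> (h \<otimes>\<^bsub>G\<^esub> g') y) \<le> LD * norm (\<xi> g - \<xi> g')"
    using translated_action_lipschitz_on_compact[OF U h] by metis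
  \<comment> \<open>The lift must land in \<open>A\<close>. Continuity of \<open>s\<close> at the
    coset of \<open>g0\<close> comes from its Lipschitz bound in coordinates, anchored at
    \<open>s0\<close>; the radius has \<open>Ls + 1\<close> in the denominator to allow for
    \<open>Ls = 0\<close>.\<close>
  obtain Y' where Y': "openin (mtop Q) Y'" "?\<pi> g0 \<in> Y'" "Y' \<subseteq> Y" "\<And>q. q \<in> Y' \<Longrightarrow> s q \<in> A"
  proof -
    have "openin (top_of_set (model N)) (\<xi> ` (U \<inter> A))"
      using A cU by (intro is_chart_open_image[OF cU]) (auto simp: is_chart_def)
    then obtain \<epsilon> where \<epsilon>: "\<epsilon> > 0" "ball (\<xi> g0) \<epsilon> \<inter> model N \<subseteq> \<xi> ` (U \<inter> A)"
      using U A unfolding openin_contains_ball by blast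
    let ?B = "ball (\<psi> (?\<pi> g0)) (\<epsilon> / (Ls + 1))"
    have pos: "\<epsilon> / (Ls + 1) > 0" using \<epsilon> s0 by simp
    show thesis
    proof (rule that[of "Y \<inter> {q \<in> V. \<psi> q \<in> ?B}"])
      show "openin (mtop Q) (Y \<inter> {q \<in> V. \<psi> q \<in> ?B})"
        by (intro openin_Int Y is_chart_open_preimage_open[OF cV] open_ball)
      show "?\<pi> g0 \<in> Y \<inter> {q \<in> V. \<psi> q \<in> ?B}" using Y pos by auto
      fix q assume q: "q \<in> Y \<inter> {q \<in> V. \<psi> q \<in> ?B}"
      have "norm (\<xi> (s q) - \<xi> g0) \<le> Ls * norm (\<psi> q - \<psi> (?\<pi> g0))" using Ls[of q "?\<pi> g0"] q Y s0 by simp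
      also have "\<dots> \<le> Ls * (\<epsilon> / (Ls + 1))"
        using q s0(2) by (intro mult_left_mono) (auto simp: dist_norm norm_minus_commute)
      also have "\<dots> < \<epsilon>" using s0(2) \<epsilon>(1) by (simp add: field_simps)
      finally have "\<xi> (s q) \<in> ball (\<xi> g0) \<epsilon>" by (simp add: dist_norm norm_minus_commute)
      moreover have sqU: "s q \<in> U" using s q by blast
      moreover have "\<xi> (s q) \<in> model N" using chart_in_model[OF smooth_N U(1)] sqU by simp
      ultimately have "\<xi> (s q) \<in> \<xi> ` (U \<inter> A)" using \<epsilon>(2) by blast
      then show "s q \<in> A" using sqU is_chart_inj[OF cU] by (auto dest: inj_onD)
    qed simp
  qed
  \<comment> \<open>The section is controlled in the chart \<open>\<psi>\<close> at the coset of
    \<open>g0\<close>, the path in a chart \<open>\<psi>1\<close> at \<open>\<eta> x\<close>. The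
    smooth action on the coset space, with the group element held at the inverse of
    \<open>h\<close>, compares the two.\<close>
  obtain V1 \<psi>1 where V1: "(V1, \<psi>1) \<in> atlas Q" "\<eta> x \<in> V1"
    by (rule smooth_manifold_chart_exists[OF Q \<eta>Q[OF x]])
  have invh: "inv\<^bsub>G\<^esub> h \<in> topspace (mtop N)" using h lie_group_topspace[OF lie] by simp
  obtain U1 \<xi>1 where U1: "(U1, \<xi>1) \<in> atlas N" "inv\<^bsub>G\<^esub> h \<in> U1"
    by (rule smooth_manifold_chart_exists[OF smooth_N invh])
  have wV: "?w (\<eta> x) \<in> V" using wx Y by auto
  obtain A4 B4 L4 where 4: "inv\<^bsub>G\<^esub> h \<in> A4" "openin (mtop Q) B4" "\<eta> x \<in> B4" "L4 > 0"
    and L4: "\<And>g q g' q'. g \<in> A4 \<Longrightarrow> g' \<in> A4 \<Longrightarrow> q \<in> B4 \<Longrightarrow> q' \<in> B4 \<Longrightarrow>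
      norm (\<psi> (g <#\<^bsub>G\<^esub> q) - \<psi> (g' <#\<^bsub>G\<^esub> q')) \<le> L4 * norm ((\<xi>1 g, \<psi>1 q) - (\<xi>1 g', \<psi>1 q'))"
    using smooth_map2_locally_lipschitz[OF smooth_N Q Q actQ U1(1) V1(1) V U1(2) V1(2) wV] by metis
  define B where "B = B4 \<inter> {q \<in> topspace (mtop Q). ?w q \<in> Y'}"
  have B: "openin (mtop Q) B"
    unfolding B_def
    by (intro openin_Int 4 openin_continuous_map_preimage[OF smooth_map2_continuous_right[OF actQ invh] Y'(1)])
  have "openin (top_of_set {a..b}) {t \<in> topspace (top_of_set {a..b}). \<eta> t \<in> B}"
    by (rule openin_continuous_map_preimage[OF cont B])
  moreover have "\<eta> x \<in> B" using 4 \<eta>Q[OF x] wx Y' by (simp add: B_def)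
  ultimately obtain \<delta>1 where \<delta>1: "\<delta>1 > 0" "ball x \<delta>1 \<inter> {a..b} \<subseteq> {t \<in> {a..b}. \<eta> t \<in> B}"
    using x unfolding openin_contains_ball by auto
  have V1o: "openin (mtop Q) V1" using smooth_manifold_chart[OF Q V1(1)] by (simp add: is_chart_def)
  obtain \<delta>2 L5 where \<delta>2: "\<delta>2 > 0" "L5 \<ge> 0"
    and L5: "\<And>t u. t \<in> {a..b} \<inter> ball x \<delta>2 \<Longrightarrow> u \<in> {a..b} \<inter> ball x \<delta>2 \<Longrightarrow>
      norm (\<psi>1 (\<eta> t) - \<psi>1 (\<eta> u)) \<le> L5 * \<bar>t - u\<bar>"
    by (rule C1_path_locally_lipschitz[OF \<eta> V1(1) V1o x V1(2)]) blast
  define \<delta> where "\<delta> = min \<delta>1 \<delta>2"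
  \<comment> \<open>The factors belong, in this order, to the action on \<open>X\<close>, the
    section, the translation of cosets and the path.\<close>
  have bound: "coset_dist G \<phi> d X (\<eta> t) (\<eta> u) \<le> LD * (Ls * (L4 * L5)) * \<bar>t - u\<bar>"
    if t: "t \<in> {a..b} \<inter> ball x \<delta>" and u: "u \<in> {a..b} \<inter> ball x \<delta>" for t u
  proof -
    have B: "\<eta> t \<in> B" "\<eta> u \<in> B" using \<delta>1(2) t u by (auto simp: \<delta>_def)
    then have Yt: "?w (\<eta> t) \<in> Y'" "?w (\<eta> u) \<in> Y'" by (auto simp: B_def)
    define g where "g q = h \<otimes>\<^bsub>G\<^esub> s (?w q)" for q
    have g: "g (\<eta> v) \<in> carrier G" "\<eta> v = ?\<pi> (g (\<eta> v))" if "\<eta> v \<in> B" for v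
    proof -
      have wY: "?w (\<eta> v) \<in> Y" using that Y' by (auto simp: B_def)
      then have sG: "s (?w (\<eta> v)) \<in> carrier G" using s UG by blast
      then show "g (\<eta> v) \<in> carrier G" using h by (simp add: g_def)
      have "?\<pi> (g (\<eta> v)) = h <#\<^bsub>G\<^esub> ?\<pi> (s (?w (\<eta> v)))"
        unfolding g_def using lcos_m_assoc[OF HG h sG] by simp
      also have "\<dots> = h <#\<^bsub>G\<^esub> ?w (\<eta> v)" using s[OF wY] by simp
      also have "\<dots> = \<eta> v" using hw that by (simp add: B_def)
      finally show "\<eta> v = ?\<pi> (g (\<eta> v))" by simp
    qed
    \<comment> \<open>Independence of the representatives allows the lifted elements to replace the
      chosen ones.\<close>
    have "coset_dist G \<phi> d X (\<eta> t) (\<eta> u) = hausdorff_dist d (\<phi> (g (\<eta> t)) ` X) (\<phi> (g (\<eta> u)) ` X)"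
      using coset_dist_eq[OF group_action_axioms compactin_subset_topspace[OF X(1)] g(1)[OF B(1)] g(1)[OF B(2)], of d] g(2)[OF B(1)] g(2)[OF B(2)]
      by (simp add: H_def)
    also have "\<dots> \<le> LD * norm (\<xi> (s (?w (\<eta> t))) - \<xi> (s (?w (\<eta> u))))"
      unfolding g_def by (intro hausdorff_dist_image_le X LD Y' Yt)
    also have "\<dots> \<le> LD * (Ls * norm (\<psi> (?w (\<eta> t)) - \<psi> (?w (\<eta> u))))"
      using Yt Y'(3) A by (intro mult_left_mono Ls) auto
    also have "\<dots> \<le> LD * (Ls * (L4 * norm (\<psi>1 (\<eta> t) - \<psi>1 (\<eta> u))))"
      using L4[of "inv\<^bsub>G\<^esub> h" "inv\<^bsub>G\<^esub> h" "\<eta> t" "\<eta> u"] 4 B A s0 by (intro mult_left_mono) (auto simp: B_def norm_Pair)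
    also have "\<dots> \<le> LD * (Ls * (L4 * (L5 * \<bar>t - u\<bar>)))"
      using 4 A s0 t u by (intro mult_left_mono L5) (auto simp: \<delta>_def)
    finally show ?thesis by (simp add: mult.assoc)
  qed
  show ?thesis
  proof (intro exI conjI ballI)
    show "\<delta> > 0" using \<delta>1 \<delta>2 by (simp add: \<delta>_def)
    show "LD * (Ls * (L4 * L5)) \<ge> 0" using A s0 4 \<delta>2 by simp
  qed (rule bound)
qed

end

theorem proposition6p2:
  fixes G :: "('g, 'x) monoid_scheme"
    and N :: "('g, 'e::euclidean_space) manifold"
    and M :: "('m, 'f::euclidean_space) manifold"
    and Q :: "('g set, 'k::euclidean_space) manifold"
    and d :: "'m \<Rightarrow> 'm \<Rightarrow> real"
    and X :: "'m set"
    and \<phi> :: "'g \<Rightarrow> 'm \<Rightarrow> 'm"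
    and \<eta> :: "real \<Rightarrow> 'g set"
    and a b :: real
  assumes "lie_group G N"
    and "smooth_manifold M"
    and "d \<in> locally_finsler_metrics M"
    and "compactin (mtop M) X" and "X \<noteq> {}"
    and "smooth_action G N M \<phi>"
    and "homogeneous_manifold G N (set_stabilizer G \<phi> X) Q"
    and "piecewise_C1_path Q a b \<eta>"
  shows "lipschitz_path (\<lambda>p q. ereal (coset_dist G \<phi> d X p q)) a b \<eta> \<and>
         rectifiable_path (\<lambda>p q. ereal (coset_dist G \<phi> d X p q)) a b \<eta> \<and>
         lipschitz_path (coset_dist_hat G \<phi> d X) a b \<eta> \<and>
         rectifiable_path (coset_dist_hat G \<phi> d X) a b \<eta>"
proof -
  let ?S = "lcosets\<^bsub>G\<^esub> (set_stabilizer G \<phi> X)"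
  have metric: "Metric_space ?S (coset_dist G \<phi> d X)"
    by (rule Metric_space_coset_dist_Lie[OF assms(1-6)])
  have "continuous_map (top_of_set {a..b}) (mtop Q) \<eta>" using assms(8) by (simp add: piecewise_C1_path_def)
  then have \<eta>: "\<eta> t \<in> ?S" if "t \<in> {a..b}" for t
    using that assms(7) by (auto simp: continuous_map_def homogeneous_manifold_def)
  obtain n t where t: "interval_partition a b n t" and C1: "\<And>i. i < n \<Longrightarrow> C1_path_on Q (t i) (t (Suc i)) \<eta>"
    using assms(8) by (auto simp: piecewise_C1_path_def)
  have ends: "t 0 = a" "t n = b" using t by (auto simp: interval_partition_def)
  \<comment> \<open>On each closed piece the derivative is continuous up to the ends, so the local
    estimate holds at the partition points too, from either side.\<close>
  have 1: "lipschitz_path (\<lambda>p q. ereal (coset_dist G \<phi> d X p q)) a b \<eta>"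
  proof (rule lipschitz_path_partition[OF metric \<eta> t])
    fix i assume i: "i < n"
    have le: "a \<le> t i" "t i \<le> t (Suc i)" "t (Suc i) \<le> b"
      using interval_partition_mono[OF t, of 0 i] interval_partition_mono[OF t, of i "Suc i"]
        interval_partition_mono[OF t, of "Suc i" n] i ends by auto
    show "lipschitz_path (\<lambda>p q. ereal (coset_dist G \<phi> d X p q)) (t i) (t (Suc i)) \<eta>"
      by (rule lipschitz_path_local[OF metric \<eta> le(2) C1_path_coset_locally_lipschitz[OF assms(1-7) C1[OF i]]])
        (use le in auto)
  qed
  then have 2: "lipschitz_path (coset_dist_hat G \<phi> d X) a b \<eta>"
    unfolding coset_dist_hat_def by (rule lipschitz_path_induced_dist[OF metric \<eta>, rotated])
  show ?thesis using 1 2 by (blast intro: lipschitz_path_rectifiable)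
qed

end
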